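(* Let $N\ge1$, $\gamma>1$ and $\omega\in\mathbb{R}$. Then: (i) Any minimizing sequence of $d(\omega)$ is relatively compact in $\Sigma(\mathbb{R}^N)$. That is, if a sequence $\{u_n\}\subseteq\Sigma(\mathbb{R}^N)$ is such that $I_\omega(u_n)=0$ for all $n$ and $S_\omega(u_n)\to d(\omega)$ as $n\to+\infty$, then, up to a subsequence, there exists $\varphi\in\Sigma(\mathbb{R}^N)$ satisfying $S_\omega(\varphi)=d(\omega)$ and $u_n\to\varphi$ in $\Sigma(\mathbb{R}^N)$. (ii) The set of ground states is given by $\mathcal{G}_\omega=\{e^{i\theta}\phi_\omega:\ \theta\in\mathbb{R}\}$, where $$\phi_\omega(x):=e^{\frac{\omega+\gamma N}{2}}e^{-\frac{\gamma}{2}|x|^2},\qquad x\in\mathbb{R}^N.$$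
   Context: All functions are complex valued. $\mathrm{Log}$ is the natural logarithm, with $|z|^2\mathrm{Log}|z|^2=0$ at $z=0$. $\Sigma(\mathbb{R}^N)=\{u\in H^1(\mathbb{R}^N): |x|u\in L^2(\mathbb{R}^N)\}$, a Hilbert space with norm $\|u\|_\Sigma^2=\int_{\mathbb{R}^N}(|\nabla u|^2+|x|^2|u|^2)\,dx$. For $u\in\Sigma(\mathbb{R}^N)$ define $$S_\omega(u)=\tfrac12\|\nabla u\|_{L^2}^2+\tfrac{\gamma(\gamma-1)}{2}\|xu\|_{L^2}^2+\tfrac{\omega+1}{2}\|u\|_{L^2}^2-\tfrac12\int_{\mathbb{R}^N}|u|^2\mathrm{Log}|u|^2dx,$$ $$I_\omega(u)=\|\nabla u\|_{L^2}^2+\gamma(\gamma-1)\|xu\|_{L^2}^2+\omega\|u\|_{L^2}^2-\int_{\mathbb{R}^N}|u|^2\mathrm{Log}|u|^2dx,$$ $$d(\omega)=\inf\{S_\omega(u): u\in\Sigma(\mathbb{R}^N)\setminus\{0\},\ I_\omega(u)=0\}=\tfrac12\inf\{\|u\|_{L^2}^2: u\in\Sigma(\mathbb{R}^N)\setminus\{0\},\ I_\omega(u)=0\}.$$ The set of ground states is $$\mathcal{G}_\omega=\{\varphi\in\Sigma(\mathbb{R}^N)\setminus\{0\}: S_\omega(\varphi)=d(\omega),\ I_\omega(\varphi)=0\}.$$ *)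

theory Defs
  imports "HOL-Analysis.Analysis"
begin

text \<open>
  Elements of $L^2$, $H^1$ and $\Sigma$ are represented by functions
  \<open>real ^ 'n \<Rightarrow> complex\<close>; representatives of one class are those that agree almost everywhere.
  Measurability and integrals refer to the (complete) measure \<^const>\<open>lebesgue\<close>, so
  all sets of functions below are closed under almost-everywhere equality.
\<close>

definition partial_derivative :: "'n::finite \<Rightarrow> (real ^ 'n \<Rightarrow> complex) \<Rightarrow> real ^ 'n \<Rightarrow> complex"
  where "partial_derivative i f x = frechet_derivative f (at x) (axis i 1)"

primrec k_times_differentiable :: "nat \<Rightarrow> (real ^ 'n::finite \<Rightarrow> complex) \<Rightarrow> bool" where
  "k_times_differentiable 0 f \<longleftrightarrow> continuous_on UNIV f"
| "k_times_differentiable (Suc k) f \<longleftrightarrow>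
     f differentiable_on UNIV \<and> (\<forall>i. k_times_differentiable k (partial_derivative i f))"

definition test_function :: "(real ^ 'n::finite \<Rightarrow> complex) \<Rightarrow> bool"
  where "test_function f \<longleftrightarrow>
    (\<forall>k. k_times_differentiable k f) \<and> compact (closure (support_on UNIV f))"

definition square_integrable :: "(real ^ 'n::finite \<Rightarrow> 'b::euclidean_space) \<Rightarrow> bool"
  where "square_integrable f \<longleftrightarrow>
    f \<in> borel_measurable lebesgue \<and> integrable lebesgue (\<lambda>x. (norm (f x))\<^sup>2)"

definition L2_norm :: "(real ^ 'n::finite \<Rightarrow> 'b::euclidean_space) \<Rightarrow> real"
  where "L2_norm f = sqrt (\<integral>x. (norm (f x))\<^sup>2 \<partial>lebesgue)"

text \<open>
  \<open>g\<close> is an $L^2$ weak (distributional) gradient of \<open>u\<close>; only meaningful for \<open>u\<close> in $L^2$.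
\<close>

definition has_weak_gradient ::
    "(real ^ 'n::finite \<Rightarrow> complex) \<Rightarrow> (real ^ 'n \<Rightarrow> complex ^ 'n) \<Rightarrow> bool"
  where "has_weak_gradient u g \<longleftrightarrow> square_integrable g \<and>
    (\<forall>i f. test_function f \<longrightarrow>
      (\<integral>x. u x * partial_derivative i f x \<partial>lebesgue) = - (\<integral>x. g x $ i * f x \<partial>lebesgue))"

definition H1 :: "(real ^ 'n::finite \<Rightarrow> complex) set"
  where "H1 = {u. square_integrable u \<and> (\<exists>g. has_weak_gradient u g)}"

text \<open>
  The weak gradient is unique up to null sets, so the choice of representative
  does not affect any of the integrals below.
\<close>

definition weak_gradient :: "(real ^ 'n::finite \<Rightarrow> complex) \<Rightarrow> real ^ 'n \<Rightarrow> complex ^ 'n"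
  where "weak_gradient u = (SOME g. has_weak_gradient u g)"

definition Sigma_space :: "(real ^ 'n::finite \<Rightarrow> complex) set"
  where "Sigma_space = {u \<in> H1. square_integrable (\<lambda>x. norm x *\<^sub>R u x)}"

definition Sigma_norm :: "(real ^ 'n::finite \<Rightarrow> complex) \<Rightarrow> real"
  where "Sigma_norm u =
    sqrt (\<integral>x. (norm (weak_gradient u x))\<^sup>2 + (norm x)\<^sup>2 * (norm (u x))\<^sup>2 \<partial>lebesgue)"

definition Sigma_nonzero :: "(real ^ 'n::finite \<Rightarrow> complex) set"
  where "Sigma_nonzero = {u \<in> Sigma_space. \<not> (AE x in lebesgue. u x = 0)}"

text \<open>
  The integrand vanishes where \<open>u\<close> does, since the factor \<open>(norm (u x))\<^sup>2\<close> is zero there.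
  It is integrable for every \<open>u\<close> in \<open>Sigma_space\<close>.
\<close>

definition log_term :: "(real ^ 'n::finite \<Rightarrow> complex) \<Rightarrow> real"
  where "log_term u = (\<integral>x. (norm (u x))\<^sup>2 * ln ((norm (u x))\<^sup>2) \<partial>lebesgue)"

definition action :: "real \<Rightarrow> real \<Rightarrow> (real ^ 'n::finite \<Rightarrow> complex) \<Rightarrow> real"
  where "action \<gamma> \<omega> u =
    1/2 * (L2_norm (weak_gradient u))\<^sup>2
    + \<gamma> * (\<gamma> - 1) / 2 * (L2_norm (\<lambda>x. norm x *\<^sub>R u x))\<^sup>2
    + (\<omega> + 1) / 2 * (L2_norm u)\<^sup>2
    - 1/2 * log_term u"

definition nehari :: "real \<Rightarrow> real \<Rightarrow> (real ^ 'n::finite \<Rightarrow> complex) \<Rightarrow> real"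
  where "nehari \<gamma> \<omega> u =
    (L2_norm (weak_gradient u))\<^sup>2
    + \<gamma> * (\<gamma> - 1) * (L2_norm (\<lambda>x. norm x *\<^sub>R u x))\<^sup>2
    + \<omega> * (L2_norm u)\<^sup>2
    - log_term u"

lemma action_eq_nehari: "action \<gamma> \<omega> u = 1/2 * nehari \<gamma> \<omega> u + 1/2 * (L2_norm u)\<^sup>2"
  by (simp add: action_def nehari_def field_simps)

text \<open>
  The type argument carries the dimension. By \<open>action_eq_nehari\<close> the infimum is over a set of
  nonnegative reals; the set is nonempty for \<open>\<gamma> > 1\<close>.
\<close>

definition min_action :: "'n::finite itself \<Rightarrow> real \<Rightarrow> real \<Rightarrow> real"
  where "min_action _ \<gamma> \<omega> =
    Inf {action \<gamma> \<omega> u | u :: real ^ 'n \<Rightarrow> complex. u \<in> Sigma_nonzero \<and> nehari \<gamma> \<omega> u = 0}"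

definition ground_states :: "real \<Rightarrow> real \<Rightarrow> (real ^ 'n::finite \<Rightarrow> complex) set"
  where "ground_states \<gamma> \<omega> =
    {\<phi> \<in> Sigma_nonzero. action \<gamma> \<omega> \<phi> = min_action TYPE('n) \<gamma> \<omega> \<and> nehari \<gamma> \<omega> \<phi> = 0}"

definition gausson :: "real \<Rightarrow> real \<Rightarrow> real ^ 'n::finite \<Rightarrow> complex"
  where "gausson \<gamma> \<omega> x =
    of_real (exp ((\<omega> + \<gamma> * real CARD('n)) / 2) * exp (- (\<gamma> / 2) * (norm x)\<^sup>2))"

end

theory Submission
  imports Defs "HOL-Probability.Distributions" "HOL-Real_Asymp.Real_Asymp"
begin

text \<open>
  Let \<open>\<phi>(x) = exp(- \<gamma>|x|\<^sup>2/2)\<close>, let \<open>Z\<close> be the integral of \<open>\<phi>\<^sup>2\<close>, and for \<open>u\<close> in \<open>\<Sigma>\<close> consider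
  the twisted gradient \<open>T u = \<nabla>u + \<gamma>xu = \<phi> \<nabla>(u/\<phi>)\<close>, which vanishes exactly on the multiples of \<open>\<phi>\<close>.
  Expanding \<open>|T u|\<^sup>2\<close> and integrating by parts gives the uncertainty identity
  \<open>\<parallel>T u\<parallel>\<^sup>2 = \<parallel>\<nabla>u\<parallel>\<^sup>2 + \<gamma>\<^sup>2\<parallel>xu\<parallel>\<^sup>2 - \<gamma>N\<parallel>u\<parallel>\<^sup>2\<close> (\<open>weak_grad_uncertainty\<close>). The sharp logarithmic Sobolev
  inequality of the Gaussian probability measure \<open>\<phi>\<^sup>2/Z\<close>, applied to \<open>u/\<phi>\<close>, becomes
  \<open>\<integral>|u|\<^sup>2 ln |u|\<^sup>2 + \<gamma>\<parallel>xu\<parallel>\<^sup>2 \<le> \<parallel>T u\<parallel>\<^sup>2/\<gamma> + \<parallel>u\<parallel>\<^sup>2 ln (\<parallel>u\<parallel>\<^sup>2/Z)\<close> (\<open>weak_grad_log_sobolev\<close>). Together they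
  bound the Nehari functional from below (\<open>nehari_lower_bound\<close>):
  \<open>I(u) \<ge> (1 - 1/\<gamma>)\<parallel>T u\<parallel>\<^sup>2 + \<parallel>u\<parallel>\<^sup>2 (\<omega> + \<gamma>N - ln (\<parallel>u\<parallel>\<^sup>2/Z))\<close>.

  Since \<open>\<gamma> > 1\<close>, a nonzero \<open>u\<close> with \<open>I(u) = 0\<close> has mass at least \<open>exp(\<omega> + \<gamma>N) Z\<close>, which is the mass of
  the gausson. On the constraint the action is half the mass, so this determines the minimal action.
  Along a minimizing sequence the mass tends to the minimal value, hence \<open>\<parallel>T u\<parallel>\<close> tends to \<open>0\<close>. By the
  Gaussian Poincare inequality (\<open>weak_grad_poincare\<close>) the sequence approaches its projections
  onto the line spanned by \<open>\<phi>\<close>; their coefficients are bounded complex numbers, so a subsequence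
  converges in \<open>L\<^sup>2\<close>, and the uncertainty identity upgrades this to convergence in \<open>\<Sigma>\<close>. For a ground
  state \<open>T u = 0\<close>, so that \<open>u\<close> is a multiple of \<open>\<phi>\<close>, and its mass fixes the modulus of the factor.

  Both Gaussian inequalities are instances of one entropy inequality (\<open>phi_entropy\<close>), for the
  functions \<open>t ln t\<close> and \<open>t\<^sup>2\<close>. It is proved for bounded continuously differentiable functions
  with bounded gradient, by following the entropy along the rotation of two independent Gaussian vectors. General
  \<open>u\<close> are reached by cutting off and mollifying (\<open>c1_compact_dense\<close>). In the logarithmic term
  Fatou's lemma gives the inequality that is needed in the limit, because \<open>t ln t\<close> is bounded below
  and the Gaussian measure is finite; it also yields the integrability of \<open>|u|\<^sup>2 ln |u|\<^sup>2\<close>.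
\<close>

section \<open>Derivatives of integrals\<close>

text \<open>
  Dominated convergence for the difference quotients along an arbitrary sequence. The mean value
  inequality converts the bound on \<open>k'\<close> into the dominating function \<open>2 B\<close>.
\<close>

lemma has_derivative_integral_dominated:
  fixes k :: "'p::real_normed_vector \<Rightarrow> 'a \<Rightarrow> 'b::{banach, second_countable_topology}"
  assumes r: "r > 0"
    and int: "\<And>p. p \<in> ball p0 r \<Longrightarrow> integrable M (k p)"
    and der: "\<And>p y. p \<in> ball p0 r \<Longrightarrow> y \<in> space M \<Longrightarrow> ((\<lambda>p. k p y) has_derivative k' p y) (at p)"
    and bd: "\<And>p y h. p \<in> ball p0 r \<Longrightarrow> y \<in> space M \<Longrightarrow> norm (k' p y h) \<le> B y * norm h"
    and Bnn: "\<And>y. y \<in> space M \<Longrightarrow> 0 \<le> B y" and B: "integrable M B"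
    and meas: "\<And>h. (\<lambda>y. k' p0 y h) \<in> borel_measurable M"
  shows "((\<lambda>p. \<integral>y. k p y \<partial>M) has_derivative (\<lambda>h. \<integral>y. k' p0 y h \<partial>M)) (at p0)"
proof -
  have p0: "p0 \<in> ball p0 r" using r by simp
  have lin: "linear (k' p0 y)" if "y \<in> space M" for y
    using der[OF p0 that] by (rule has_derivative_linear)
  have int': "integrable M (\<lambda>y. k' p0 y h)" for h
    by (rule Bochner_Integration.integrable_bound[OF integrable_mult_left[OF B, of "norm h"]])
       (auto simp: meas intro!: AE_I2 order_trans[OF bd[OF p0]])
  have BL: "bounded_linear (\<lambda>h. \<integral>y. k' p0 y h \<partial>M)"
  proof (rule bounded_linear_intro[where K="\<integral>y. B y \<partial>M"])
    show "(\<integral>y. k' p0 y (x + z) \<partial>M) = (\<integral>y. k' p0 y x \<partial>M) + (\<integral>y. k' p0 y z \<partial>M)" for x z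
      by (subst Bochner_Integration.integral_add[symmetric])
         (auto intro!: int' Bochner_Integration.integral_cong simp: linear_add[OF lin])
    show "(\<integral>y. k' p0 y (a *\<^sub>R x) \<partial>M) = a *\<^sub>R (\<integral>y. k' p0 y x \<partial>M)" for a x
      by (simp add: linear_scale[OF lin] flip: integral_scaleR_right cong: Bochner_Integration.integral_cong)
    show "norm (\<integral>y. k' p0 y x \<partial>M) \<le> norm x * (\<integral>y. B y \<partial>M)" for x
    proof -
      have "norm (\<integral>y. k' p0 y x \<partial>M) \<le> (\<integral>y. norm (k' p0 y x) \<partial>M)"
        by (rule integral_norm_bound)
      also have "\<dots> \<le> (\<integral>y. B y * norm x \<partial>M)"
        using bd[OF p0] by (intro integral_mono integrable_norm int' integrable_mult_left B) auto
      finally have "norm (\<integral>y. k' p0 y x \<partial>M) \<le> (\<integral>y. B y * norm x \<partial>M)" .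
      then show ?thesis by (simp add: mult.commute)
    qed
  qed
  have lim: "((\<lambda>h. norm ((\<integral>y. k (p0 + h) y \<partial>M) - (\<integral>y. k p0 y \<partial>M) - (\<integral>y. k' p0 y h \<partial>M)) / norm h) \<longlongrightarrow> 0)
      (at 0 within ball 0 r)"
    unfolding tendsto_at_iff_sequentially comp_def
  proof (intro allI impI)
    fix X :: "nat \<Rightarrow> 'p"
    assume X: "\<forall>i. X i \<in> ball 0 r - {0}" and X0: "X \<longlonglongrightarrow> 0"
    have XB: "p0 + X i \<in> ball p0 r" and Xne: "X i \<noteq> 0" for i
      using X by (auto simp: dist_norm)
    define R where "R i y = (k (p0 + X i) y - k p0 y - k' p0 y (X i)) /\<^sub>R norm (X i)" for i y
    have "(\<lambda>i. \<integral>y. R i y \<partial>M) \<longlonglongrightarrow> (\<integral>y. 0 \<partial>M)"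
    proof (rule integral_dominated_convergence[where w="\<lambda>y. 2 * B y"])
      show "integrable M (\<lambda>y. 2 * B y)" using B by simp
      show "R i \<in> borel_measurable M" for i
        unfolding R_def using int[OF XB[of i]] int[OF p0] meas[of "X i"] by measurable
      show "AE y in M. (\<lambda>i. R i y) \<longlonglongrightarrow> 0"
      proof (rule AE_I2)
        fix y assume y: "y \<in> space M"
        have "((\<lambda>h. norm (k (p0 + h) y - k p0 y - k' p0 y h) / norm h) \<longlongrightarrow> 0) (at 0)"
          using der[OF p0 y] unfolding has_derivative_at by simp
        then have "(\<lambda>i. norm (k (p0 + X i) y - k p0 y - k' p0 y (X i)) / norm (X i)) \<longlonglongrightarrow> 0"
          using X0 Xne unfolding tendsto_at_iff_sequentially comp_def by auto
        then have "(\<lambda>i. norm (R i y)) \<longlonglongrightarrow> 0"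
          by (simp add: R_def divide_inverse mult.commute)
        then show "(\<lambda>i. R i y) \<longlonglongrightarrow> 0" by (rule tendsto_norm_zero_cancel)
      qed
      show "AE y in M. norm (R i y) \<le> 2 * B y" for i
      proof (rule AE_I2)
        fix y assume y: "y \<in> space M"
        have "norm (k (p0 + X i) y - k p0 y) \<le> B y * norm (p0 + X i - p0)"
          by (rule differentiable_bound[OF convex_ball _ _ XB p0, where f'="\<lambda>p. k' p y"])
             (use bd[OF _ y] in \<open>auto intro!: onorm_bound Bnn has_derivative_at_withinI[OF der] y simp del: mem_ball\<close>)
        moreover have "norm (k' p0 y (X i)) \<le> B y * norm (X i)" by (rule bd[OF p0 y])
        ultimately have "norm (k (p0 + X i) y - k p0 y - k' p0 y (X i)) \<le> 2 * B y * norm (X i)"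
          using norm_triangle_ineq4[of "k (p0 + X i) y - k p0 y" "k' p0 y (X i)"] by simp
        then show "norm (R i y) \<le> 2 * B y"
          using Xne[of i] by (simp add: R_def divide_simps)
      qed
    qed simp
    moreover have "(\<integral>y. R i y \<partial>M) = ((\<integral>y. k (p0 + X i) y \<partial>M) - (\<integral>y. k p0 y \<partial>M) - (\<integral>y. k' p0 y (X i) \<partial>M)) /\<^sub>R norm (X i)" for i
      unfolding R_def using int[OF XB[of i]] int[OF p0] int'[of "X i"] by simp
    ultimately have "(\<lambda>i. norm (((\<integral>y. k (p0 + X i) y \<partial>M) - (\<integral>y. k p0 y \<partial>M) - (\<integral>y. k' p0 y (X i) \<partial>M)) /\<^sub>R norm (X i))) \<longlonglongrightarrow> 0"
      using tendsto_norm_zero by fastforce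
    then show "(\<lambda>i. norm ((\<integral>y. k (p0 + X i) y \<partial>M) - (\<integral>y. k p0 y \<partial>M) - (\<integral>y. k' p0 y (X i) \<partial>M)) / norm (X i)) \<longlonglongrightarrow> 0"
      by (simp add: divide_inverse mult.commute)
  qed
  then have "((\<lambda>h. norm ((\<integral>y. k (p0 + h) y \<partial>M) - (\<integral>y. k p0 y \<partial>M) - (\<integral>y. k' p0 y h \<partial>M)) / norm h) \<longlongrightarrow> 0) (at 0)"
    using r by (simp add: at_within_open[of 0 "ball 0 r"])
  then show ?thesis using BL by (simp add: has_derivative_at)
qed

lemma integral_translation_lborel:
  fixes F :: "'a::euclidean_space \<Rightarrow> 'b::{banach, second_countable_topology}"
  assumes "F \<in> borel_measurable borel"
  shows "integrable lborel (\<lambda>x. F (x + c)) \<longleftrightarrow> integrable lborel F"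
    and "(\<integral>x. F (x + c) \<partial>lborel) = (\<integral>x. F x \<partial>lborel)"
proof -
  have m: "(+) c \<in> lborel \<rightarrow>\<^sub>M borel" by simp
  show "integrable lborel (\<lambda>x. F (x + c)) \<longleftrightarrow> integrable lborel F"
    using integrable_distr_eq[OF m assms] by (simp add: lborel_distr_plus add.commute)
  show "(\<integral>x. F (x + c) \<partial>lborel) = (\<integral>x. F x \<partial>lborel)"
    using integral_distr[OF m assms] by (simp add: lborel_distr_plus add.commute)
qed

text \<open>
  By translation invariance the integral of \<open>x \<mapsto> F (x + t v)\<close> does not depend on \<open>t\<close>, and
  the integral of \<open>F'\<close> is its derivative at \<open>t = 0\<close>. Every integration by parts below has this
  form.
\<close>

lemma integral_directional_derivative_eq_0:
  fixes F :: "'a::euclidean_space \<Rightarrow> 'b::euclidean_space"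
  assumes r: "r > 0"
    and F: "integrable lborel F" and F'm: "F' \<in> borel_measurable borel"
    and der: "\<And>x. ((\<lambda>t. F (x + t *\<^sub>R v)) has_vector_derivative F' x) (at 0)"
    and bd: "\<And>x t. \<bar>t\<bar> < r \<Longrightarrow> norm (F' (x + t *\<^sub>R v)) \<le> B x"
    and B: "integrable lborel B"
  shows "integrable lborel F'" "(\<integral>x. F' x \<partial>lborel) = 0"
proof -
  have Fm: "F \<in> borel_measurable borel" using F by simp
  note tr = integral_translation_lborel[OF Fm]
  show F': "integrable lborel F'"
    by (rule Bochner_Integration.integrable_bound[OF B])
       (use F'm bd[of 0] r in \<open>auto intro!: AE_I2 order_trans[OF _ abs_ge_self]\<close>)
  have "((\<lambda>t. \<integral>x. F (x + t *\<^sub>R v) \<partial>lborel) has_derivative (\<lambda>h. \<integral>x. h *\<^sub>R F' (x + 0 *\<^sub>R v) \<partial>lborel)) (at (0::real))"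
  proof (rule has_derivative_integral_dominated[where B=B, OF r])
    show "((\<lambda>t. F (y + t *\<^sub>R v)) has_derivative (\<lambda>h. h *\<^sub>R F' (y + t *\<^sub>R v))) (at t)" for t y
    proof -
      have "((\<lambda>s. F ((y + t *\<^sub>R v) + s *\<^sub>R v)) has_vector_derivative F' (y + t *\<^sub>R v)) (at 0)" by (rule der)
      then have "((\<lambda>s. F (y + (t + s) *\<^sub>R v)) has_vector_derivative F' (y + t *\<^sub>R v)) (at 0)" by (simp add: algebra_simps)
      then have "((\<lambda>s. F (y + s *\<^sub>R v)) has_vector_derivative F' (y + t *\<^sub>R v)) (at t)"
        by (simp add: has_vector_derivative_def has_derivative_at algebra_simps)
      then show ?thesis by (simp add: has_vector_derivative_def)
    qed
    show "norm (h *\<^sub>R F' (y + t *\<^sub>R v)) \<le> B y * norm h" if "t \<in> ball 0 r" for t y h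
      using mult_left_mono[OF bd[of t y], of "\<bar>h\<bar>"] that by (simp add: dist_norm mult.commute)
    show "0 \<le> B x" for x using order_trans[OF norm_ge_zero bd[of 0 x]] r by simp
  qed (use tr F F'm B in auto)
  then have "((\<lambda>t. \<integral>x. F x \<partial>lborel) has_derivative (\<lambda>h. \<integral>x. h *\<^sub>R F' x \<partial>lborel)) (at (0::real))"
    by (simp add: tr)
  then have "(\<lambda>h::real. \<integral>x. h *\<^sub>R F' x \<partial>lborel) = (\<lambda>h. 0)"
    using has_derivative_const has_derivative_unique by blast
  from fun_cong[OF this, of 1] show "(\<integral>x. F' x \<partial>lborel) = 0" by simp
qed

section \<open>Gaussian measures\<close>

abbreviation gauss_mass :: "'a::euclidean_space itself \<Rightarrow> real \<Rightarrow> real" where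
  "gauss_mass _ \<gamma> \<equiv> (\<integral>y. exp (- \<gamma> * (norm (y :: 'a))\<^sup>2) \<partial>lborel)"

lemma integrable_gauss:
  fixes \<gamma> :: real
  assumes "\<gamma> > 0"
  shows "integrable lborel (\<lambda>x::'a::euclidean_space. exp (- \<gamma> * (norm x)\<^sup>2))"
proof (rule integrableI_nonneg)
  have "\<And>x::'a. exp (- \<gamma> * (norm x)\<^sup>2) = (\<Prod>b\<in>Basis. exp (- \<gamma> * (x \<bullet> b)\<^sup>2))"
    by (simp add: exp_sum[symmetric] sum_distrib_left[symmetric] sum_negf power2_norm_eq_inner)
       (simp add: euclidean_inner[of x x for x::'a] power2_eq_square)
  then have "(\<integral>\<^sup>+(x::'a). ennreal (exp (- \<gamma> * (norm x)\<^sup>2)) \<partial>lborel)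
     = (\<integral>\<^sup>+(x::'a). (\<Prod>b\<in>Basis. ennreal (exp (- \<gamma> * (x \<bullet> b)\<^sup>2))) \<partial>lborel)"
    by (simp add: prod_ennreal)
  also have "\<dots> = (\<Prod>b\<in>(Basis::'a set). (\<integral>\<^sup>+x. ennreal (exp (- \<gamma> * x\<^sup>2)) \<partial>lborel))"
    by (rule nn_integral_lborel_prod) auto
  also have "\<dots> < \<infinity>"
  proof -
    define \<sigma> where "\<sigma> = sqrt (1 / (2 * \<gamma>))"
    have \<sigma>: "\<sigma> > 0" and \<sigma>2: "2 * \<sigma>\<^sup>2 = 1 / \<gamma>" using assms by (auto simp: \<sigma>_def)
    have "integrable lborel (\<lambda>x. sqrt (2 * pi * \<sigma>\<^sup>2) * normal_density 0 \<sigma> x)"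
      using \<sigma> by (intro integrable_mult_right integrable_normal_density)
    moreover have "sqrt (2 * pi * \<sigma>\<^sup>2) * normal_density 0 \<sigma> x = exp (- \<gamma> * x\<^sup>2)" for x
      using \<sigma> assms by (simp add: normal_density_def \<sigma>2)
    ultimately have "integrable lborel (\<lambda>x. exp (- \<gamma> * x\<^sup>2))" by simp
    then have "(\<integral>\<^sup>+x. ennreal (exp (- \<gamma> * x\<^sup>2)) \<partial>lborel) < \<infinity>"
      by (auto simp: integrable_iff_bounded)
    then show ?thesis by (auto simp: power_less_top_ennreal)
  qed
  finally show "(\<integral>\<^sup>+(x::'a). ennreal (exp (- \<gamma> * (norm x)\<^sup>2)) \<partial>lborel) < \<infinity>" .
qed auto

text \<open>
  The centred Gaussian probability measure whose covariance is the identity divided by \<open>2 \<gamma>\<close>.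
\<close>

definition gaussian :: "real \<Rightarrow> 'a::euclidean_space measure" where
  "gaussian \<gamma> = density lborel
     (\<lambda>x. ennreal (exp (- \<gamma> * (norm x)\<^sup>2) / gauss_mass TYPE('a) \<gamma>))"

lemma sets_gaussian [simp, measurable_cong]: "sets (gaussian \<gamma>) = sets borel"
  by (simp add: gaussian_def)

lemma space_gaussian [simp]: "space (gaussian \<gamma>) = UNIV"
  by (simp add: gaussian_def)

lemma gauss_mass_pos:
  assumes "\<gamma> > 0"
  shows "gauss_mass TYPE('a::euclidean_space) \<gamma> > 0"
proof -
  have "\<not> (AE y::'a in lborel. False)"
    using AE_iff_null_sets[of "UNIV :: 'a set" lborel] by (auto simp: null_sets_def)
  then have "(\<integral>(y::'a). exp (- \<gamma> * (norm y)\<^sup>2) \<partial>lborel) \<noteq> 0"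
    using integrable_gauss[OF assms, where 'a='a]
    by (subst integral_nonneg_eq_0_iff_AE) auto
  then show ?thesis
    by (simp add: order_less_le)
qed

lemma prob_space_gaussian:
  assumes "\<gamma> > 0"
  shows "prob_space (gaussian \<gamma> :: 'a::euclidean_space measure)"
proof
  let ?Z = "gauss_mass TYPE('a) \<gamma>"
  have "emeasure (gaussian \<gamma>) (space (gaussian \<gamma> :: 'a measure))
      = (\<integral>\<^sup>+(x::'a). ennreal (exp (- \<gamma> * (norm x)\<^sup>2) / ?Z) \<partial>lborel)"
    by (simp add: gaussian_def emeasure_density)
  also have "\<dots> = ennreal (\<integral>(x::'a). exp (- \<gamma> * (norm x)\<^sup>2) / ?Z \<partial>lborel)"
    using gauss_mass_pos[OF assms, where 'a='a] integrable_gauss[OF assms, where 'a='a]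
    by (intro nn_integral_eq_integral) auto
  also have "\<dots> = 1"
    using gauss_mass_pos[OF assms, where 'a='a] by simp
  finally show "emeasure (gaussian \<gamma>) (space (gaussian \<gamma> :: 'a measure)) = 1" .
qed

lemma integrable_divideR_iff:
  fixes g :: "'a \<Rightarrow> 'b::{banach, second_countable_topology}"
  assumes "c \<noteq> 0"
  shows "integrable M (\<lambda>x. g x /\<^sub>R c) \<longleftrightarrow> integrable M g"
proof
  assume "integrable M (\<lambda>x. g x /\<^sub>R c)"
  then have "integrable M (\<lambda>x. c *\<^sub>R (g x /\<^sub>R c))" by (rule integrable_scaleR_right)
  then show "integrable M g" using assms by simp
qed (rule integrable_scaleR_right)

lemma integral_gaussian:
  fixes f :: "'a::euclidean_space \<Rightarrow> 'b::{banach, second_countable_topology}"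
  assumes \<gamma>: "\<gamma> > 0" and f: "f \<in> borel_measurable borel"
  shows "integral\<^sup>L (gaussian \<gamma>) f =
      (\<integral>x. exp (- \<gamma> * (norm x)\<^sup>2) *\<^sub>R f x \<partial>lborel) /\<^sub>R gauss_mass TYPE('a) \<gamma>"
    and "integrable (gaussian \<gamma>) f \<longleftrightarrow> integrable lborel (\<lambda>x. exp (- \<gamma> * (norm x)\<^sup>2) *\<^sub>R f x)"
proof -
  note Z = gauss_mass_pos[OF \<gamma>, where 'a='a]
  let ?Z = "gauss_mass TYPE('a) \<gamma>"
  have *: "(exp (- \<gamma> * (norm x)\<^sup>2) / ?Z) *\<^sub>R f x = (exp (- \<gamma> * (norm x)\<^sup>2) *\<^sub>R f x) /\<^sub>R ?Z" for x
    by (simp add: divide_inverse mult.commute)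
  show "integral\<^sup>L (gaussian \<gamma>) f = (\<integral>x. exp (- \<gamma> * (norm x)\<^sup>2) *\<^sub>R f x \<partial>lborel) /\<^sub>R ?Z"
  proof -
    have "integral\<^sup>L (gaussian \<gamma>) f = (\<integral>x. (exp (- \<gamma> * (norm x)\<^sup>2) / ?Z) *\<^sub>R f x \<partial>lborel)"
      unfolding gaussian_def using Z f by (intro integral_density) auto
    also have "\<dots> = (\<integral>x. (exp (- \<gamma> * (norm x)\<^sup>2) *\<^sub>R f x) /\<^sub>R ?Z \<partial>lborel)" by (simp only: *)
    finally show ?thesis by (simp only: integral_scaleR_right)
  qed
  show "integrable (gaussian \<gamma>) f \<longleftrightarrow> integrable lborel (\<lambda>x. exp (- \<gamma> * (norm x)\<^sup>2) *\<^sub>R f x)"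
  proof -
    have "integrable (gaussian \<gamma>) f \<longleftrightarrow> integrable lborel (\<lambda>x. (exp (- \<gamma> * (norm x)\<^sup>2) / ?Z) *\<^sub>R f x)"
      unfolding gaussian_def using Z f by (intro integrable_density) auto
    also have "\<dots> \<longleftrightarrow> integrable lborel (\<lambda>x. exp (- \<gamma> * (norm x)\<^sup>2) *\<^sub>R f x)"
      unfolding * using Z by (intro integrable_divideR_iff) simp
    finally show ?thesis .
  qed
qed

text \<open>
  Half of the exponent absorbs the growth of the norm.
\<close>

lemma norm_gauss_bound:
  assumes "\<gamma> > 0"
  shows "norm (x::'a::real_normed_vector) * exp (- \<gamma> * (norm x)\<^sup>2) \<le> (1 + 2 / \<gamma>) * exp (- (\<gamma> / 2) * (norm x)\<^sup>2)"
proof -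
  let ?n = "norm x" and ?e = "exp ((\<gamma> / 2) * (norm x)\<^sup>2)"
  have "?n \<le> 1 + ?n\<^sup>2"
  proof -
    have "2 * ?n \<le> 1 + ?n\<^sup>2" using zero_le_power2[of "?n - 1"] by (simp add: power2_diff)
    then show ?thesis using norm_ge_zero[of x] by linarith
  qed
  also have "?n\<^sup>2 \<le> (2 / \<gamma>) * ?e"
    using exp_ge_add_one_self[of "(\<gamma> / 2) * (norm x)\<^sup>2"] assms by (simp add: field_simps)
  also have "1 \<le> ?e" using assms by simp
  finally have "?n \<le> (1 + 2 / \<gamma>) * ?e" by (simp add: algebra_simps)
  then have "?n * exp (- \<gamma> * ?n\<^sup>2) \<le> (1 + 2 / \<gamma>) * ?e * exp (- \<gamma> * ?n\<^sup>2)"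
    by (intro mult_right_mono) auto
  also have "\<dots> = (1 + 2 / \<gamma>) * exp (- (\<gamma> / 2) * ?n\<^sup>2)"
    by (simp add: mult.assoc exp_add[symmetric])
  finally show ?thesis .
qed

lemma integrable_norm_gaussian:
  assumes "\<gamma> > 0"
  shows "integrable (gaussian \<gamma> :: 'a::euclidean_space measure) norm"
proof -
  have "integrable lborel (\<lambda>x::'a. exp (- \<gamma> * (norm x)\<^sup>2) *\<^sub>R norm x)"
  proof (rule Bochner_Integration.integrable_bound)
    show "integrable lborel (\<lambda>x::'a. (1 + 2 / \<gamma>) * exp (- (\<gamma> / 2) * (norm x)\<^sup>2))"
      using assms by (intro integrable_mult_right integrable_gauss) auto
    show "AE x::'a in lborel. norm (exp (- \<gamma> * (norm x)\<^sup>2) *\<^sub>R norm x) \<le> norm ((1 + 2 / \<gamma>) * exp (- (\<gamma> / 2) * (norm x)\<^sup>2))"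
      using norm_gauss_bound[OF assms] assms by (intro AE_I2) (simp add: mult.commute abs_mult)
  qed auto
  then show ?thesis by (subst integral_gaussian(2)[OF assms]) auto
qed

text \<open>
  Tonelli's theorem reduces a shear to a translation in one of the two variables.
\<close>

lemma nn_integral_lborel_shear:
  fixes F :: "'a::euclidean_space \<times> 'a \<Rightarrow> ennreal"
  assumes [measurable]: "F \<in> borel_measurable borel"
  shows "(\<integral>\<^sup>+p. F (fst p + t *\<^sub>R snd p, snd p) \<partial>lborel) = (\<integral>\<^sup>+p. F p \<partial>lborel)"
    and "(\<integral>\<^sup>+p. F (fst p, snd p + t *\<^sub>R fst p) \<partial>lborel) = (\<integral>\<^sup>+p. F p \<partial>lborel)"
proof -
  have tr: "(\<integral>\<^sup>+x. G (x + c) \<partial>lborel) = (\<integral>\<^sup>+x. G x \<partial>lborel)" 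
    if [measurable]: "G \<in> borel_measurable borel" for G :: "'a \<Rightarrow> ennreal" and c
    by (subst lborel_distr_plus[of c, symmetric]) (simp add: nn_integral_distr add.commute)
  note [simp del] = lborel_prod
  have F[measurable]: "F \<in> borel_measurable (lborel \<Otimes>\<^sub>M lborel)" by (simp add: lborel_prod)
  have F1[measurable]: "(\<lambda>p. F (fst p + t *\<^sub>R snd p, snd p)) \<in> borel_measurable (lborel \<Otimes>\<^sub>M lborel)"
    and F2[measurable]: "(\<lambda>p. F (fst p, snd p + t *\<^sub>R fst p)) \<in> borel_measurable (lborel \<Otimes>\<^sub>M lborel)"
    by measurable
  have "(\<integral>\<^sup>+p. F (fst p + t *\<^sub>R snd p, snd p) \<partial>(lborel \<Otimes>\<^sub>M lborel)) = (\<integral>\<^sup>+y. \<integral>\<^sup>+x. F (x + t *\<^sub>R y, y) \<partial>lborel \<partial>lborel)"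
    by (subst lborel_pair.nn_integral_snd[symmetric]) auto
  also have "\<dots> = (\<integral>\<^sup>+y. \<integral>\<^sup>+x. F (x, y) \<partial>lborel \<partial>lborel)"
    by (intro nn_integral_cong tr) measurable
  also have "\<dots> = (\<integral>\<^sup>+p. F p \<partial>(lborel \<Otimes>\<^sub>M lborel))"
    by (subst lborel_pair.nn_integral_snd) auto
  finally show "(\<integral>\<^sup>+p. F (fst p + t *\<^sub>R snd p, snd p) \<partial>lborel) = (\<integral>\<^sup>+p. F p \<partial>lborel)"
    by (simp add: lborel_prod)
  have "(\<integral>\<^sup>+p. F (fst p, snd p + t *\<^sub>R fst p) \<partial>(lborel \<Otimes>\<^sub>M lborel)) = (\<integral>\<^sup>+x. \<integral>\<^sup>+y. F (x, y + t *\<^sub>R x) \<partial>lborel \<partial>lborel)"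
    by (subst lborel.nn_integral_fst[symmetric]) auto
  also have "\<dots> = (\<integral>\<^sup>+x. \<integral>\<^sup>+y. F (x, y) \<partial>lborel \<partial>lborel)"
    by (intro nn_integral_cong tr) measurable
  also have "\<dots> = (\<integral>\<^sup>+p. F p \<partial>(lborel \<Otimes>\<^sub>M lborel))"
    by (subst lborel.nn_integral_fst) auto
  finally show "(\<integral>\<^sup>+p. F (fst p, snd p + t *\<^sub>R fst p) \<partial>lborel) = (\<integral>\<^sup>+p. F p \<partial>lborel)"
    by (simp add: lborel_prod)
qed

definition rotation :: "real \<Rightarrow> 'a::real_vector \<times> 'a \<Rightarrow> 'a \<times> 'a" where
  "rotation \<theta> p = (cos \<theta> *\<^sub>R fst p + sin \<theta> *\<^sub>R snd p, cos \<theta> *\<^sub>R snd p - sin \<theta> *\<^sub>R fst p)"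

lemma rotation_measurable [measurable]: "(rotation \<theta> :: 'a::euclidean_space \<times> 'a \<Rightarrow> 'a \<times> 'a) \<in> borel \<rightarrow>\<^sub>M borel"
  unfolding rotation_def by (intro borel_measurable_continuous_onI continuous_intros)

lemma nn_integral_lborel_rotation:
  fixes F :: "'a::euclidean_space \<times> 'a \<Rightarrow> ennreal"
  assumes [measurable]: "F \<in> borel_measurable borel" and \<theta>: "\<theta> \<in> {0..pi/2}"
  shows "(\<integral>\<^sup>+p. F (rotation \<theta> p) \<partial>lborel) = (\<integral>\<^sup>+p. F p \<partial>lborel)"
proof (cases "\<theta> = 0")
  case True
  then show ?thesis by (simp add: rotation_def)
next
  case False
  let ?c = "cos \<theta>" and ?s = "sin \<theta>"
  have s: "?s > 0" using False \<theta> by (intro sin_gt_zero) auto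
  define t where "t = (1 - ?c) / ?s"
  have t: "t * ?s = 1 - ?c" using s by (simp add: t_def)
  have t2: "t * (1 + ?c) = ?s"
  proof -
    have "t * (1 + ?c) * ?s = (t * ?s) * (1 + ?c)" by simp
    also have "\<dots> = (1 - ?c) * (1 + ?c)" by (simp only: t)
    also have "\<dots> = ?s * ?s" using sin_cos_squared_add[of \<theta>] by (simp add: power2_eq_square algebra_simps)
    finally show ?thesis using s by simp
  qed
  let ?S = "\<lambda>p::'a\<times>'a. (fst p + t *\<^sub>R snd p, snd p)"
  let ?T = "\<lambda>p::'a\<times>'a. (fst p, snd p + (- ?s) *\<^sub>R fst p)"
  have [measurable]: "?S \<in> borel \<rightarrow>\<^sub>M borel" "?T \<in> borel \<rightarrow>\<^sub>M borel"
    by (intro borel_measurable_continuous_onI continuous_intros)+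
  \<comment> \<open>A rotation is a product of three shears.\<close>
  have R: "rotation \<theta> p = ?S (?T (?S p))" for p
  proof -
    have a1: "1 - t * ?s = ?c" using t by simp
    have "t + t * (1 - t * ?s) = t * (1 + ?c)" by (simp only: a1) (simp add: algebra_simps)
    then have a2: "t + t * (1 - t * ?s) = ?s" using t2 by simp
    have "fst p + t *\<^sub>R snd p + t *\<^sub>R (snd p + (- ?s) *\<^sub>R (fst p + t *\<^sub>R snd p))
        = (1 - t * ?s) *\<^sub>R fst p + (t + t * (1 - t * ?s)) *\<^sub>R snd p"
      "snd p + (- ?s) *\<^sub>R (fst p + t *\<^sub>R snd p) = (1 - t * ?s) *\<^sub>R snd p - ?s *\<^sub>R fst p"
      by (simp_all add: algebra_simps) (metis mult_2_right scaleR_left_distrib)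
    then have "fst p + t *\<^sub>R snd p + t *\<^sub>R (snd p + (- ?s) *\<^sub>R (fst p + t *\<^sub>R snd p)) = ?c *\<^sub>R fst p + ?s *\<^sub>R snd p"
      "snd p + (- ?s) *\<^sub>R (fst p + t *\<^sub>R snd p) = ?c *\<^sub>R snd p - ?s *\<^sub>R fst p"
      using a1 a2 by (simp_all only:)
    then show ?thesis by (simp add: rotation_def)
  qed
  have m1: "(\<lambda>p. F (?S p)) \<in> borel_measurable borel"
    by (rule measurable_compose[of ?S]) measurable
  have m2: "(\<lambda>p. F (?S (?T p))) \<in> borel_measurable borel"
    by (rule measurable_compose[of ?T borel borel, OF _ m1]) measurable
  have "(\<integral>\<^sup>+p. F (rotation \<theta> p) \<partial>lborel) = (\<integral>\<^sup>+p. F (?S (?T (?S p))) \<partial>lborel)" by (simp only: R)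
  also have "\<dots> = (\<integral>\<^sup>+p. F (?S (?T p)) \<partial>lborel)"
    by (rule nn_integral_lborel_shear(1)[OF m2])
  also have "\<dots> = (\<integral>\<^sup>+p. F (?S p) \<partial>lborel)"
    by (rule nn_integral_lborel_shear(2)[OF m1])
  also have "\<dots> = (\<integral>\<^sup>+p. F p \<partial>lborel)"
    by (rule nn_integral_lborel_shear(1)) measurable
  finally show ?thesis .
qed

text \<open>
  The joint density of two independent copies depends only on \<open>|x|\<^sup>2 + |y|\<^sup>2\<close>, which a rotation
  preserves.
\<close>

lemma distr_gaussian_rotation:
  assumes \<gamma>: "\<gamma> > 0" and \<theta>: "\<theta> \<in> {0..pi/2}"
  shows "distr (gaussian \<gamma> \<Otimes>\<^sub>M gaussian \<gamma>) (gaussian \<gamma> \<Otimes>\<^sub>M gaussian \<gamma>) (rotation \<theta>)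
     = (gaussian \<gamma> \<Otimes>\<^sub>M gaussian \<gamma> :: ('a::euclidean_space \<times> 'a) measure)"
proof -
  let ?Z = "gauss_mass TYPE('a) \<gamma>"
  let ?p = "\<lambda>x::'a. ennreal (exp (- \<gamma> * (norm x)\<^sup>2) / ?Z)"
  let ?M = "gaussian \<gamma> :: 'a measure"
  interpret prob_space ?M by (rule prob_space_gaussian[OF \<gamma>])
  have sf: "sigma_finite_measure (density lborel ?p)"
    using sigma_finite_measure_axioms by (simp add: gaussian_def)
  have M2: "?M \<Otimes>\<^sub>M ?M = density lborel (\<lambda>(x,y). ?p x * ?p y)"
    using pair_measure_density[OF _ _ lborel.sigma_finite_measure_axioms sf, of ?p]
    by (simp add: gaussian_def lborel_prod)
  have sets2: "sets (?M \<Otimes>\<^sub>M ?M) = sets borel" unfolding M2 by simp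
  have pp: "?p x * ?p y = ennreal (exp (- \<gamma> * ((norm x)\<^sup>2 + (norm y)\<^sup>2)) / ?Z\<^sup>2)" for x y
    using gauss_mass_pos[OF \<gamma>, where 'a='a]
    by (simp add: ennreal_mult'[symmetric] exp_add[symmetric] algebra_simps power2_eq_square)
  have inv: "(norm (fst (rotation \<theta> q)))\<^sup>2 + (norm (snd (rotation \<theta> q)))\<^sup>2 = (norm (fst q))\<^sup>2 + (norm (snd q))\<^sup>2" for q :: "'a\<times>'a"
  proof -
    have e: "cos \<theta> * (cos \<theta> * y) + sin \<theta> * (sin \<theta> * y) = y" for y
    proof -
      have "cos \<theta> * (cos \<theta> * y) + sin \<theta> * (sin \<theta> * y) = ((cos \<theta>)\<^sup>2 + (sin \<theta>)\<^sup>2) * y"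
        by (simp only: power2_eq_square distrib_right mult.assoc)
      then show ?thesis by simp
    qed
    have "(norm (fst (rotation \<theta> q)))\<^sup>2 + (norm (snd (rotation \<theta> q)))\<^sup>2
      = (cos \<theta> * (cos \<theta> * (norm (fst q))\<^sup>2) + sin \<theta> * (sin \<theta> * (norm (fst q))\<^sup>2))
      + (cos \<theta> * (cos \<theta> * (norm (snd q))\<^sup>2) + sin \<theta> * (sin \<theta> * (norm (snd q))\<^sup>2))"
      unfolding rotation_def power2_norm_eq_inner
      by (simp add: algebra_simps inner_commute)
    then show ?thesis by (simp only: e)
  qed
  have rotm: "rotation \<theta> \<in> (?M \<Otimes>\<^sub>M ?M) \<rightarrow>\<^sub>M (?M \<Otimes>\<^sub>M ?M)"
    by (simp add: measurable_cong_sets[OF sets2 sets2])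
  show ?thesis
  proof (rule measure_eqI)
    fix A assume "A \<in> sets (distr (?M \<Otimes>\<^sub>M ?M) (?M \<Otimes>\<^sub>M ?M) (rotation \<theta>))"
    then have [measurable]: "A \<in> sets borel" by (simp only: sets_distr sets2)
    let ?D = "\<lambda>q. (\<lambda>(x,y). ?p x * ?p y) q"
    have ind: "(\<lambda>q. indicator A (rotation \<theta> q) :: ennreal) \<in> borel_measurable borel" by measurable
    have "(\<lambda>q::'a\<times>'a. exp (- \<gamma> * ((norm (fst q))\<^sup>2 + (norm (snd q))\<^sup>2)) / ?Z\<^sup>2) \<in> borel_measurable borel"
      by (intro borel_measurable_continuous_onI continuous_intros) (use gauss_mass_pos[OF \<gamma>, where 'a='a] in auto)
    then have pm: "?D \<in> borel_measurable borel"
      by (simp only: pp split_beta) (rule measurable_compose[OF _ measurable_ennreal])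
    have "emeasure (distr (?M \<Otimes>\<^sub>M ?M) (?M \<Otimes>\<^sub>M ?M) (rotation \<theta>)) A = (\<integral>\<^sup>+q. indicator A (rotation \<theta> q) \<partial>(?M \<Otimes>\<^sub>M ?M))"
    proof -
      have "rotation \<theta> -` A \<inter> space (?M \<Otimes>\<^sub>M ?M) \<in> sets (?M \<Otimes>\<^sub>M ?M)"
        using rotm by (rule measurable_sets) (simp only: sets2, fact)
      then show ?thesis
        using rotm by (subst emeasure_distr) (simp_all only: sets2 \<open>A \<in> sets borel\<close> nn_integral_indicator[symmetric],
          auto simp: indicator_def intro!: nn_integral_cong)
    qed
    also have "\<dots> = (\<integral>\<^sup>+q. ?D q * indicator A (rotation \<theta> q) \<partial>lborel)"
      unfolding M2 using ind pm by (subst nn_integral_density) simp_all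
    also have "\<dots> = (\<integral>\<^sup>+q. ?D (rotation \<theta> q) * indicator A (rotation \<theta> q) \<partial>lborel)"
      by (intro nn_integral_cong) (simp only: pp split_beta inv)
    also have "\<dots> = (\<integral>\<^sup>+q. ?D q * indicator A q \<partial>lborel)"
      by (rule nn_integral_lborel_rotation[OF borel_measurable_times_ennreal[OF pm] \<theta>]) measurable
    also have "\<dots> = emeasure (?M \<Otimes>\<^sub>M ?M) A"
      unfolding M2 using pm by (subst emeasure_density) auto
    finally show "emeasure (distr (?M \<Otimes>\<^sub>M ?M) (?M \<Otimes>\<^sub>M ?M) (rotation \<theta>)) A = emeasure (?M \<Otimes>\<^sub>M ?M) A" .
  qed simp
qed

lemma integral_gaussian_rotation:
  fixes F :: "'a::euclidean_space \<times> 'a \<Rightarrow> 'b::{banach, second_countable_topology}"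
  assumes \<gamma>: "\<gamma> > 0" and \<theta>: "\<theta> \<in> {0..pi/2}" and F: "F \<in> borel_measurable borel"
  shows "(\<integral>p. F (rotation \<theta> p) \<partial>(gaussian \<gamma> \<Otimes>\<^sub>M gaussian \<gamma>)) = (\<integral>p. F p \<partial>(gaussian \<gamma> \<Otimes>\<^sub>M gaussian \<gamma>))"
    and "integrable (gaussian \<gamma> \<Otimes>\<^sub>M gaussian \<gamma>) (\<lambda>p. F (rotation \<theta> p)) \<longleftrightarrow> integrable (gaussian \<gamma> \<Otimes>\<^sub>M gaussian \<gamma>) F"
proof -
  let ?M = "gaussian \<gamma> :: 'a measure"
  have sets2: "sets (?M \<Otimes>\<^sub>M ?M) = sets borel"
    by (metis borel_prod sets_pair_measure_cong sets_gaussian)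
  have rotm: "rotation \<theta> \<in> (?M \<Otimes>\<^sub>M ?M) \<rightarrow>\<^sub>M (?M \<Otimes>\<^sub>M ?M)"
    by (simp add: measurable_cong_sets[OF sets2 sets2])
  have Fm: "F \<in> borel_measurable (?M \<Otimes>\<^sub>M ?M)"
    using F by (simp add: measurable_cong_sets[OF sets2 refl])
  show "(\<integral>p. F (rotation \<theta> p) \<partial>(?M \<Otimes>\<^sub>M ?M)) = (\<integral>p. F p \<partial>(?M \<Otimes>\<^sub>M ?M))"
    by (subst (2) distr_gaussian_rotation[OF \<gamma> \<theta>, symmetric], subst integral_distr[OF rotm Fm]) simp
  show "integrable (?M \<Otimes>\<^sub>M ?M) (\<lambda>p. F (rotation \<theta> p)) \<longleftrightarrow> integrable (?M \<Otimes>\<^sub>M ?M) F"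
    using integrable_distr_eq[OF rotm Fm] by (simp add: distr_gaussian_rotation[OF \<gamma> \<theta>])
qed

text \<open>
  Domination uniform in the shift, so that one can differentiate under the integral.
\<close>

lemma gauss_shift_bound:
  assumes "\<gamma> > 0" "norm (h::'a::real_inner) \<le> 1"
  shows "exp (- \<gamma> * (norm (x + h))\<^sup>2) \<le> exp \<gamma> * exp (- (\<gamma> / 2) * (norm x)\<^sup>2)"
proof -
  have "(norm x)\<^sup>2 = (norm ((x + h) - h))\<^sup>2" by simp
  also have "\<dots> \<le> 2 * (norm (x + h))\<^sup>2 + 2 * (norm h)\<^sup>2"
    using zero_le_power2[of "norm ((x + h) + h)"]
    by (simp only: power2_norm_eq_inner) (simp add: inner_simps inner_commute)
  also have "\<dots> \<le> 2 * (norm (x + h))\<^sup>2 + 2"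
    using power_mono[OF assms(2), of 2] by simp
  finally have "\<gamma> * (norm x)\<^sup>2 \<le> \<gamma> * (2 * (norm (x + h))\<^sup>2 + 2)" using assms by (intro mult_left_mono) auto
  then show ?thesis by (simp add: exp_add[symmetric] algebra_simps)
qed

text \<open>
  The derivative of \<open>H(x) exp(- \<gamma>|x|\<^sup>2)\<close> in the direction \<open>v\<close> has integral zero.
\<close>

lemma gaussian_integration_by_parts:
  fixes H :: "'a::euclidean_space \<Rightarrow> real"
  assumes \<gamma>: "\<gamma> > 0"
    and der: "\<And>x. (H has_derivative (\<lambda>h. D x \<bullet> h)) (at x)"
    and Dm: "D \<in> borel_measurable borel"
    and Hb: "\<And>x. \<bar>H x\<bar> \<le> C" and Db: "\<And>x. norm (D x) \<le> C"
  shows "(\<integral>x. H x * (v \<bullet> x) \<partial>gaussian \<gamma>) = (\<integral>x. v \<bullet> D x \<partial>gaussian \<gamma>) / (2 * \<gamma>)"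
proof -
  let ?g = "\<lambda>x::'a. exp (- \<gamma> * (norm x)\<^sup>2)"
  define F where "F x = H x * ?g x" for x
  define F' where "F' x = (D x \<bullet> v) * ?g x - H x * (2 * \<gamma> * (x \<bullet> v)) * ?g x" for x
  define r where "r = 1 / (norm v + 1)"
  have nv: "norm v + 1 > 0" by (simp add: add_nonneg_pos)
  have r: "r > 0" using nv by (simp add: r_def)
  have rv: "norm (t *\<^sub>R v) \<le> 1" if "\<bar>t\<bar> < r" for t
  proof -
    have "\<bar>t\<bar> * norm v \<le> r * (norm v + 1)" using that by (intro mult_mono) auto
    also have "\<dots> = 1" using nv by (simp add: r_def)
    finally show ?thesis by simp
  qed
  have C0: "C \<ge> 0" using Hb[of 0] by simp
  have Hc: "continuous_on UNIV H"
    using der has_derivative_continuous by (metis continuous_at_imp_continuous_on)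
  then have Hm[measurable]: "H \<in> borel_measurable borel" by (rule borel_measurable_continuous_onI)
  note Dm[measurable]
  define K where "K = C * norm v * (1 + 2 * \<gamma> * (1 + 2 / \<gamma>))"
  have K0: "K \<ge> 0" using \<gamma> C0 by (simp add: K_def)
  have F'b: "norm (F' y) \<le> K * exp (- (\<gamma>/2) * (norm y)\<^sup>2)" for y
  proof -
    have "norm (F' y) \<le> norm ((D y \<bullet> v) * ?g y) + norm (H y * (2 * \<gamma> * (y \<bullet> v)) * ?g y)"
      unfolding F'_def by (rule norm_triangle_ineq4)
    also have "norm ((D y \<bullet> v) * ?g y) \<le> (C * norm v) * exp (- (\<gamma>/2) * (norm y)\<^sup>2)"
      using Cauchy_Schwarz_ineq2[of "D y" v] mult_right_mono[OF Db[of y], of "norm v"] \<gamma> C0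
      by (auto simp: abs_mult intro!: mult_mono)
    also have "norm (H y * (2 * \<gamma> * (y \<bullet> v)) * ?g y) = (\<bar>H y\<bar> * (2 * \<gamma>)) * (\<bar>y \<bullet> v\<bar> * ?g y)"
      using \<gamma> by (simp add: abs_mult)
    also have "\<dots> \<le> (C * (2 * \<gamma>)) * (norm v * ((1 + 2 / \<gamma>) * exp (- (\<gamma>/2) * (norm y)\<^sup>2)))"
    proof (rule mult_mono)
      have "\<bar>y \<bullet> v\<bar> * ?g y \<le> (norm v * norm y) * ?g y"
        using Cauchy_Schwarz_ineq2[of y v] by (intro mult_right_mono) (auto simp: mult.commute)
      also have "\<dots> = norm v * (norm y * ?g y)" by simp
      also have "\<dots> \<le> norm v * ((1 + 2 / \<gamma>) * exp (- (\<gamma>/2) * (norm y)\<^sup>2))"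
        using norm_gauss_bound[OF \<gamma>, of y] by (intro mult_left_mono) auto
      finally show "\<bar>y \<bullet> v\<bar> * ?g y \<le> norm v * ((1 + 2 / \<gamma>) * exp (- (\<gamma>/2) * (norm y)\<^sup>2))" .
    qed (use Hb C0 \<gamma> in auto)
    also have "C * norm v * exp (- (\<gamma>/2) * (norm y)\<^sup>2) + (C * (2 * \<gamma>)) * (norm v * ((1 + 2 / \<gamma>) * exp (- (\<gamma>/2) * (norm y)\<^sup>2)))
        = K * exp (- (\<gamma>/2) * (norm y)\<^sup>2)"
      unfolding K_def by algebra
    finally show ?thesis by simp
  qed
  have F_int: "integrable lborel F"
  proof (rule Bochner_Integration.integrable_bound)
    show "integrable lborel (\<lambda>x::'a. C * ?g x)" by (intro integrable_mult_right integrable_gauss \<gamma>)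
    show "AE x::'a in lborel. norm (F x) \<le> norm (C * ?g x)"
      using C0 Hb by (auto simp: F_def abs_mult intro!: AE_I2 mult_right_mono)
    show "F \<in> borel_measurable lborel" unfolding F_def by measurable
  qed
  have F'm: "F' \<in> borel_measurable borel" unfolding F'_def by measurable
  have F'der: "((\<lambda>t. F (x + t *\<^sub>R v)) has_vector_derivative F' x) (at 0)" for x
    unfolding F_def F'_def has_vector_derivative_def power2_norm_eq_inner
    by (rule has_derivative_eq_rhs, (rule derivative_intros has_derivative_compose[OF _ der] | simp)+)
       (auto simp: fun_eq_iff inner_commute algebra_simps)
  have F'bd: "norm (F' (x + t *\<^sub>R v)) \<le> K * exp (\<gamma>/2) * exp (- (\<gamma>/4) * (norm x)\<^sup>2)" if "\<bar>t\<bar> < r" for x t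
  proof -
    have "norm (F' (x + t *\<^sub>R v)) \<le> K * exp (- (\<gamma>/2) * (norm (x + t *\<^sub>R v))\<^sup>2)" by (rule F'b)
    also have "\<dots> \<le> K * (exp (\<gamma>/2) * exp (- (\<gamma>/2/2) * (norm x)\<^sup>2))"
      using \<gamma> K0 rv[OF that] by (intro mult_left_mono gauss_shift_bound) auto
    finally show ?thesis by simp
  qed
  have B: "integrable lborel (\<lambda>x::'a. K * exp (\<gamma>/2) * exp (- (\<gamma>/4) * (norm x)\<^sup>2))"
    using \<gamma> by (intro integrable_mult_right integrable_gauss) auto
  note zero = integral_directional_derivative_eq_0[OF r F_int F'm F'der F'bd B]
  have i1: "integrable lborel (\<lambda>x. ?g x * (v \<bullet> D x))"
  proof (rule Bochner_Integration.integrable_bound)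
    show "integrable lborel (\<lambda>x::'a. norm v * C * ?g x)" by (intro integrable_mult_right integrable_gauss \<gamma>)
    show "AE x::'a in lborel. norm (?g x * (v \<bullet> D x)) \<le> norm (norm v * C * ?g x)"
    proof (rule AE_I2)
      fix x :: 'a
      have "\<bar>v \<bullet> D x\<bar> \<le> norm v * C"
        using Cauchy_Schwarz_ineq2[of v "D x"] mult_left_mono[OF Db[of x], of "norm v"] by simp
      then show "norm (?g x * (v \<bullet> D x)) \<le> norm (norm v * C * ?g x)"
        using C0 by (simp add: abs_mult mult.commute[of "norm v * C"] mult_left_mono)
    qed
  qed simp
  have "(\<integral>x. ?g x * (2 * \<gamma> * (H x * (v \<bullet> x))) \<partial>lborel) = (\<integral>x. ?g x * (v \<bullet> D x) - F' x \<partial>lborel)"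
    by (rule Bochner_Integration.integral_cong) (auto simp: F'_def inner_commute algebra_simps)
  also have "\<dots> = (\<integral>x. ?g x * (v \<bullet> D x) \<partial>lborel)"
    using i1 zero by simp
  finally have "2 * \<gamma> * (\<integral>x. ?g x * (H x * (v \<bullet> x)) \<partial>lborel) = (\<integral>x. ?g x * (v \<bullet> D x) \<partial>lborel)"
    by (simp add: mult.left_commute flip: integral_mult_right_zero)
  then have "(\<integral>x. ?g x * (H x * (v \<bullet> x)) \<partial>lborel) = (\<integral>x. ?g x * (v \<bullet> D x) \<partial>lborel) / (2 * \<gamma>)"
    using \<gamma> by (simp add: field_simps)
  then show ?thesis using \<gamma> by (simp add: integral_gaussian)
qed

section \<open>The entropy inequality of Gaussian measures\<close>

text \<open>
  For independent Gaussian vectors \<open>X\<close> and \<open>Z\<close> the vector \<open>X cos \<theta> + Z sin \<theta>\<close> interpolates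
  between \<open>X\<close> and \<open>Z\<close>. Given \<open>X = x\<close>, the conditional expectations of \<open>f\<close> and of its gradient \<open>D\<close> at
  this vector are \<open>q \<theta> x\<close> and \<open>Q \<theta> x\<close>, and \<open>r \<theta> x\<close> is the derivative of \<open>q \<theta> x\<close> in \<open>\<theta>\<close>. The
  expectation of \<open>\<Psi>(q \<theta> X)\<close> runs from the expectation of \<open>\<Psi>(f)\<close> at \<open>\<theta> = 0\<close> to the value of \<open>\<Psi>\<close> at
  the expectation of \<open>f\<close> at \<open>\<theta> = \<pi>/2\<close>. The functions \<open>\<Psi>1\<close> and \<open>\<Psi>2\<close> are the first two derivatives of \<open>\<Psi>\<close>.
\<close>

locale gaussian_interpolation =
  fixes \<gamma> :: real and f :: "'a::euclidean_space \<Rightarrow> real" and D :: "'a \<Rightarrow> 'a"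
    and \<Psi> \<Psi>1 \<Psi>2 :: "real \<Rightarrow> real" and a b L :: real
  assumes \<gamma>: "\<gamma> > 0"
    and f_der: "\<And>x. (f has_derivative (\<lambda>h. D x \<bullet> h)) (at x)"
    and D_cont: "continuous_on UNIV D"
    and D_bd: "\<And>x. norm (D x) \<le> L"
    and f_range: "\<And>x. f x \<in> {a..b}"
    and \<Psi>_der: "\<And>t. t \<in> {a..b} \<Longrightarrow> (\<Psi> has_real_derivative \<Psi>1 t) (at t)"
    and \<Psi>1_der: "\<And>t. t \<in> {a..b} \<Longrightarrow> (\<Psi>1 has_real_derivative \<Psi>2 t) (at t)"
    and \<Psi>2_cont: "continuous_on {a..b} \<Psi>2"
begin

abbreviation M :: "'a measure" where "M \<equiv> gaussian \<gamma>"

sublocale prob_space M by (rule prob_space_gaussian[OF \<gamma>])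
sublocale pair: pair_prob_space M M ..

lemma prob_UNIV [simp]: "measure M UNIV = 1"
  using prob_space by simp

definition q :: "real \<Rightarrow> 'a \<Rightarrow> real" where
  "q \<theta> x = (\<integral>z. f (cos \<theta> *\<^sub>R x + sin \<theta> *\<^sub>R z) \<partial>M)"

definition Q :: "real \<Rightarrow> 'a \<Rightarrow> 'a" where
  "Q \<theta> x = (\<integral>z. D (cos \<theta> *\<^sub>R x + sin \<theta> *\<^sub>R z) \<partial>M)"

definition r :: "real \<Rightarrow> 'a \<Rightarrow> real" where
  "r \<theta> x = (\<integral>z. D (cos \<theta> *\<^sub>R x + sin \<theta> *\<^sub>R z) \<bullet> (cos \<theta> *\<^sub>R z - sin \<theta> *\<^sub>R x) \<partial>M)"

lemma L_nonneg: "L \<ge> 0" using D_bd[of 0] norm_ge_zero[of "D 0"] by linarith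

lemma f_cont: "continuous_on UNIV f"
  using f_der has_derivative_continuous by (metis continuous_at_imp_continuous_on)

lemma f_meas [measurable]: "f \<in> borel_measurable borel"
  using f_cont by (rule borel_measurable_continuous_onI)

lemma D_meas [measurable]: "D \<in> borel_measurable borel"
  using D_cont by (rule borel_measurable_continuous_onI)

lemma f_bd: "\<bar>f x\<bar> \<le> \<bar>a\<bar> + \<bar>b\<bar>"
  using f_range[of x] by auto

lemma integrable_f: "g \<in> borel_measurable borel \<Longrightarrow> integrable M (\<lambda>z. f (g z))"
  by (rule integrable_const_bound[where B="\<bar>a\<bar> + \<bar>b\<bar>"]) (auto intro!: AE_I2 f_bd)

lemma integrable_D: "g \<in> borel_measurable borel \<Longrightarrow> integrable M (\<lambda>z. D (g z))"
  by (rule integrable_const_bound[where B=L]) (auto intro!: AE_I2 D_bd)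

lemma q_range: "q \<theta> x \<in> {a..b}"
proof -
  have i: "integrable M (\<lambda>z. f (cos \<theta> *\<^sub>R x + sin \<theta> *\<^sub>R z))" by (rule integrable_f) measurable
  have "(\<integral>z. a \<partial>M) \<le> q \<theta> x" "q \<theta> x \<le> (\<integral>z. b \<partial>M)"
    unfolding q_def using f_range by (intro integral_mono i; simp)+
  then show ?thesis by (simp add: prob_space)
qed

lemma Q_bd: "norm (Q \<theta> x) \<le> L"
proof -
  have "norm (Q \<theta> x) \<le> (\<integral>z. norm (D (cos \<theta> *\<^sub>R x + sin \<theta> *\<^sub>R z)) \<partial>M)"
    unfolding Q_def by (rule integral_norm_bound)
  also have "\<dots> \<le> (\<integral>z. L \<partial>M)"
    by (intro integral_mono integrable_norm integrable_D) (auto simp: D_bd)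
  finally show ?thesis by (simp add: prob_space)
qed

lemma Q_meas [measurable]: "Q \<theta> \<in> borel_measurable borel"
  unfolding Q_def by measurable

lemma r_meas [measurable]: "r \<theta> \<in> borel_measurable borel"
  unfolding r_def by measurable

lemma q_der: "(q \<theta> has_derivative (\<lambda>h. (cos \<theta> *\<^sub>R Q \<theta> x) \<bullet> h)) (at x)"
proof -
  have "(q \<theta> has_derivative (\<lambda>h. \<integral>z. D (cos \<theta> *\<^sub>R x + sin \<theta> *\<^sub>R z) \<bullet> (cos \<theta> *\<^sub>R h) \<partial>M)) (at x)"
    unfolding q_def
  proof (rule has_derivative_integral_dominated[where r=1 and B="\<lambda>_. L"])
    show "((\<lambda>p. f (cos \<theta> *\<^sub>R p + sin \<theta> *\<^sub>R y)) has_derivative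
        (\<lambda>h. D (cos \<theta> *\<^sub>R p + sin \<theta> *\<^sub>R y) \<bullet> cos \<theta> *\<^sub>R h)) (at p)" for p y
      by (rule has_derivative_compose[OF _ f_der]) (auto intro!: derivative_eq_intros)
    show "norm (D (cos \<theta> *\<^sub>R p + sin \<theta> *\<^sub>R y) \<bullet> cos \<theta> *\<^sub>R h) \<le> L * norm h" for p y h
    proof -
      have "norm (D (cos \<theta> *\<^sub>R p + sin \<theta> *\<^sub>R y) \<bullet> cos \<theta> *\<^sub>R h) \<le> norm (D (cos \<theta> *\<^sub>R p + sin \<theta> *\<^sub>R y)) * norm (cos \<theta> *\<^sub>R h)"
        by (simp only: real_norm_def Cauchy_Schwarz_ineq2)
      also have "\<dots> \<le> L * norm h"
        using L_nonneg by (intro mult_mono D_bd) (auto simp: mult_left_le_one_le)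
      finally show ?thesis .
    qed
  qed (auto intro!: integrable_f L_nonneg)
  moreover have "(\<integral>z. D (cos \<theta> *\<^sub>R x + sin \<theta> *\<^sub>R z) \<bullet> (cos \<theta> *\<^sub>R h) \<partial>M) = (cos \<theta> *\<^sub>R Q \<theta> x) \<bullet> h" for h
    unfolding Q_def by (subst integral_inner_left) (auto intro!: integrable_D)
  ultimately show ?thesis by (simp only:)
qed

lemma q_cont: "continuous_on UNIV (q \<theta>)"
  using q_der has_derivative_continuous by (metis continuous_at_imp_continuous_on)

lemma q_meas [measurable]: "q \<theta> \<in> borel_measurable borel"
  using q_cont by (rule borel_measurable_continuous_onI)

lemma r_integrand_bd:
  "\<bar>D y \<bullet> (cos \<theta> *\<^sub>R z - sin \<theta> *\<^sub>R x)\<bar> \<le> L * (norm x + norm z)"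
proof -
  have "\<bar>D y \<bullet> (cos \<theta> *\<^sub>R z - sin \<theta> *\<^sub>R x)\<bar> \<le> norm (D y) * norm (cos \<theta> *\<^sub>R z - sin \<theta> *\<^sub>R x)"
    by (rule Cauchy_Schwarz_ineq2)
  also have "norm (cos \<theta> *\<^sub>R z - sin \<theta> *\<^sub>R x) \<le> norm (cos \<theta> *\<^sub>R z) + norm (sin \<theta> *\<^sub>R x)"
    by (rule norm_triangle_ineq4)
  also have "\<dots> \<le> norm x + norm z"
    using mult_right_mono[OF abs_cos_le_one[of \<theta>], of "norm z"] mult_right_mono[OF abs_sin_le_one[of \<theta>], of "norm x"]
    by simp
  finally have "\<bar>D y \<bullet> (cos \<theta> *\<^sub>R z - sin \<theta> *\<^sub>R x)\<bar> \<le> norm (D y) * (norm x + norm z)"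
    by (simp add: mult_left_mono)
  also have "\<dots> \<le> L * (norm x + norm z)"
    using D_bd[of y] by (intro mult_right_mono) simp_all
  finally show ?thesis .
qed

lemma r_bd: "\<bar>r \<theta> x\<bar> \<le> L * (norm x + (\<integral>z. norm z \<partial>M))"
proof -
  have "\<bar>r \<theta> x\<bar> \<le> (\<integral>z. \<bar>D (cos \<theta> *\<^sub>R x + sin \<theta> *\<^sub>R z) \<bullet> (cos \<theta> *\<^sub>R z - sin \<theta> *\<^sub>R x)\<bar> \<partial>M)"
    unfolding r_def by (rule integral_abs_bound)
  also have "\<dots> \<le> (\<integral>z. L * (norm x + norm z) \<partial>M)"
    by (rule integral_mono_AE') (use r_integrand_bd L_nonneg integrable_norm_gaussian[OF \<gamma>, where 'a='a] in auto)
  also have "\<dots> = L * (norm x + (\<integral>z. norm z \<partial>M))"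
    using integrable_norm_gaussian[OF \<gamma>, where 'a='a] by (simp add: prob_space)
  finally show ?thesis .
qed

lemma q_der_angle: "((\<lambda>\<theta>. q \<theta> x) has_real_derivative r \<theta> x) (at \<theta>)"
proof -
  have "((\<lambda>\<theta>. q \<theta> x) has_derivative (\<lambda>h. \<integral>z. h * (D (cos \<theta> *\<^sub>R x + sin \<theta> *\<^sub>R z) \<bullet> (cos \<theta> *\<^sub>R z - sin \<theta> *\<^sub>R x)) \<partial>M)) (at \<theta>)"
    unfolding q_def
  proof (rule has_derivative_integral_dominated[where r=1 and B="\<lambda>z. L * (norm x + norm z)"])
    show "((\<lambda>p. f (cos p *\<^sub>R x + sin p *\<^sub>R y)) has_derivative
        (\<lambda>h. h * (D (cos p *\<^sub>R x + sin p *\<^sub>R y) \<bullet> (cos p *\<^sub>R y - sin p *\<^sub>R x)))) (at p)" for p y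
    proof -
      have "((\<lambda>p. cos p *\<^sub>R x + sin p *\<^sub>R y) has_derivative (\<lambda>h. h *\<^sub>R (cos p *\<^sub>R y - sin p *\<^sub>R x))) (at p)"
      proof -
        have "((\<lambda>p. cos p *\<^sub>R x) has_vector_derivative (- sin p *\<^sub>R x)) (at p)"
          "((\<lambda>p. sin p *\<^sub>R y) has_vector_derivative (cos p *\<^sub>R y)) (at p)"
          by (rule has_vector_derivative_eq_rhs, rule has_vector_derivative_scaleR, rule derivative_intros,
              rule derivative_intros, rule derivative_intros, simp)+
        from has_vector_derivative_add[OF this] show ?thesis
          by (simp add: has_vector_derivative_def)
      qed
      from has_derivative_compose[OF this f_der] show ?thesis by simp
    qed
    show "norm (h * (D (cos p *\<^sub>R x + sin p *\<^sub>R y) \<bullet> (cos p *\<^sub>R y - sin p *\<^sub>R x))) \<le> L * (norm x + norm y) * norm h" for p y h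
      using mult_left_mono[OF r_integrand_bd[of "cos p *\<^sub>R x + sin p *\<^sub>R y" p y x], of "\<bar>h\<bar>"]
      by (simp add: abs_mult mult.commute)
  qed (auto intro!: integrable_f mult_nonneg_nonneg L_nonneg simp: integrable_norm_gaussian[OF \<gamma>, where 'a='a])
  then show ?thesis
    by (simp add: r_def has_field_derivative_def mult_commute_abs)
qed

lemma \<Psi>1_cont: "continuous_on {a..b} \<Psi>1"
  using \<Psi>1_der by (meson DERIV_isCont continuous_at_imp_continuous_on)

lemma \<Psi>_cont: "continuous_on {a..b} \<Psi>"
  using \<Psi>_der by (meson DERIV_isCont continuous_at_imp_continuous_on)

lemma comp_cont:
  assumes "continuous_on {a..b} G" "continuous_on UNIV g" "\<And>x. g x \<in> {a..b}"
  shows "continuous_on UNIV (\<lambda>x. G (g x))"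
  by (rule continuous_on_compose2[OF assms(1,2)]) (use assms(3) in blast)

lemma comp_bd:
  assumes "continuous_on {a..b} (G :: real \<Rightarrow> real)"
  obtains C where "C > 0" "\<And>t. t \<in> {a..b} \<Longrightarrow> \<bar>G t\<bar> \<le> C"
proof -
  have "bounded (G ` {a..b})"
    using compact_continuous_image[OF assms compact_Icc] by (rule compact_imp_bounded)
  then obtain C where "C > 0" "\<forall>x\<in>G ` {a..b}. norm x \<le> C" by (auto simp: bounded_pos)
  then show thesis using that[of C] by simp
qed

lemma \<Psi>_meas [measurable]: "(\<lambda>x. \<Psi> (q \<theta> x)) \<in> borel_measurable borel"
    "(\<lambda>x. \<Psi>1 (q \<theta> x)) \<in> borel_measurable borel" "(\<lambda>x. \<Psi>2 (q \<theta> x)) \<in> borel_measurable borel"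
  by (intro borel_measurable_continuous_onI comp_cont[OF \<Psi>_cont q_cont q_range]
      comp_cont[OF \<Psi>1_cont q_cont q_range] comp_cont[OF \<Psi>2_cont q_cont q_range])+

lemma entropy_der:
  "((\<lambda>\<theta>. \<integral>x. \<Psi> (q \<theta> x) \<partial>M) has_real_derivative (\<integral>x. \<Psi>1 (q \<theta> x) * r \<theta> x \<partial>M)) (at \<theta>)"
proof -
  obtain C where C: "C > 0" "\<And>t. t \<in> {a..b} \<Longrightarrow> \<bar>\<Psi>1 t\<bar> \<le> C" by (rule comp_bd[OF \<Psi>1_cont]) blast
  obtain C' where C': "C' > 0" "\<And>t. t \<in> {a..b} \<Longrightarrow> \<bar>\<Psi> t\<bar> \<le> C'" by (rule comp_bd[OF \<Psi>_cont]) blast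
  have "((\<lambda>\<theta>. \<integral>x. \<Psi> (q \<theta> x) \<partial>M) has_derivative (\<lambda>h. \<integral>x. (\<Psi>1 (q \<theta> x) * r \<theta> x) * h \<partial>M)) (at \<theta>)"
  proof (rule has_derivative_integral_dominated[where r=1 and B="\<lambda>x. C * (L * (norm x + (\<integral>z. norm z \<partial>M)))"])
    show "((\<lambda>p. \<Psi> (q p y)) has_derivative (\<lambda>h. (\<Psi>1 (q p y) * r p y) * h)) (at p)" for p y
      using DERIV_chain2[OF \<Psi>_der[OF q_range] q_der_angle] by (simp add: has_field_derivative_def)
    show "norm (\<Psi>1 (q p y) * r p y * h) \<le> C * (L * (norm y + (\<integral>z. norm z \<partial>M))) * norm h" for p y h
    proof -
      have "\<bar>\<Psi>1 (q p y)\<bar> * \<bar>r p y\<bar> \<le> C * (L * (norm y + (\<integral>z. norm z \<partial>M)))"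
        using C(1) by (intro mult_mono C(2) q_range r_bd) simp_all
      from mult_right_mono[OF this, of "\<bar>h\<bar>"] show ?thesis by (simp add: abs_mult)
    qed
    show "integrable M (\<lambda>x. \<Psi> (q p x))" for p
      by (rule integrable_const_bound[where B=C']) (auto intro!: AE_I2 C' q_range)
  qed (use C in \<open>auto intro!: mult_nonneg_nonneg add_nonneg_nonneg L_nonneg simp: integrable_norm_gaussian[OF \<gamma>, where 'a='a]\<close>)
  then show ?thesis by (simp add: has_field_derivative_def)
qed

lemma integrable_norm_sum:
  "integrable (M \<Otimes>\<^sub>M M) (\<lambda>p. norm (fst p) + norm (snd p))"
  by (rule pair.Fubini_integrable) (auto simp: integrable_norm_gaussian[OF \<gamma>, where 'a='a])

lemma sets_pair: "sets (M \<Otimes>\<^sub>M M) = sets borel"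
  by (metis borel_prod sets_pair_measure_cong sets_gaussian)

lemma measurable_pair: "F \<in> borel_measurable borel \<Longrightarrow> F \<in> borel_measurable (M \<Otimes>\<^sub>M M)"
  by (simp add: measurable_cong_sets[OF sets_pair refl])

lemma rotation_fst_back:
  "cos \<theta> *\<^sub>R fst (rotation \<theta> p) - sin \<theta> *\<^sub>R snd (rotation \<theta> p) = (fst p :: 'a)"
proof -
  have "cos \<theta> *\<^sub>R fst (rotation \<theta> p) - sin \<theta> *\<^sub>R snd (rotation \<theta> p)
      = (cos \<theta> * cos \<theta> + sin \<theta> * sin \<theta>) *\<^sub>R fst p"
    unfolding scaleR_left_distrib
    by (simp add: rotation_def scaleR_diff_right scaleR_add_right mult.commute)
  then show ?thesis by simp
qed

lemma continuous_fst_snd: 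
  "continuous_on UNIV (\<lambda>p::'a\<times>'a. cos \<theta> *\<^sub>R fst p - sin \<theta> *\<^sub>R snd p)"
  by (intro continuous_intros)

text \<open>
  In terms of the rotated pair \<open>A = X cos \<theta> + Z sin \<theta>\<close>, \<open>B = Z cos \<theta> - X sin \<theta>\<close> the left-hand
  side is the expectation of \<open>\<Psi>1 (q \<theta> (A cos \<theta> - B sin \<theta>)) (D A \<bullet> B)\<close>. Integration by parts in \<open>B\<close>
  removes the linear factor and differentiates \<open>\<Psi>1 \<circ> q \<theta>\<close>; rotating back gives the right-hand side.
\<close>

lemma entropy_production:
  assumes \<theta>: "\<theta> \<in> {0..pi/2}"
  shows "(\<integral>x. \<Psi>1 (q \<theta> x) * r \<theta> x \<partial>M) = - (sin \<theta> * cos \<theta> / (2 * \<gamma>)) * (\<integral>x. \<Psi>2 (q \<theta> x) * (norm (Q \<theta> x))\<^sup>2 \<partial>M)"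
proof -
  let ?c = "cos \<theta>" and ?s = "sin \<theta>"
  let ?X = "\<lambda>p::'a\<times>'a. ?c *\<^sub>R fst p - ?s *\<^sub>R snd p"
  obtain C1 where C1: "C1 > 0" "\<And>t. t \<in> {a..b} \<Longrightarrow> \<bar>\<Psi>1 t\<bar> \<le> C1" by (rule comp_bd[OF \<Psi>1_cont]) blast
  obtain C2 where C2: "C2 > 0" "\<And>t. t \<in> {a..b} \<Longrightarrow> \<bar>\<Psi>2 t\<bar> \<le> C2" by (rule comp_bd[OF \<Psi>2_cont]) blast
  have X_m[measurable]: "?X \<in> borel \<rightarrow>\<^sub>M borel" by (intro borel_measurable_continuous_onI continuous_fst_snd)
  have fst_m: "(fst :: 'a\<times>'a \<Rightarrow> 'a) \<in> borel \<rightarrow>\<^sub>M borel" and snd_m: "(snd :: 'a\<times>'a \<Rightarrow> 'a) \<in> borel \<rightarrow>\<^sub>M borel"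
    by (intro borel_measurable_continuous_onI continuous_intros)+
  note compose = measurable_compose[OF fst_m] measurable_compose[OF snd_m] measurable_compose[OF X_m]
  define V where "V p = \<Psi>1 (q \<theta> (?X p)) * (D (fst p) \<bullet> snd p)" for p
  define W where "W p = \<Psi>2 (q \<theta> (?X p)) * (D (fst p) \<bullet> Q \<theta> (?X p))" for p
  have V_m: "V \<in> borel_measurable borel" unfolding V_def
    by (intro borel_measurable_times borel_measurable_inner compose(1)[OF D_meas] snd_m compose(3)[OF \<Psi>_meas(2)])
  have W_m: "W \<in> borel_measurable borel" unfolding W_def
    by (intro borel_measurable_times borel_measurable_inner compose(1)[OF D_meas] compose(3)[OF Q_meas] compose(3)[OF \<Psi>_meas(3)])
  have V_bd: "\<bar>V p\<bar> \<le> C1 * L * (norm (fst p) + norm (snd p))" for p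
  proof -
    have "\<bar>D (fst p) \<bullet> snd p\<bar> \<le> norm (D (fst p)) * norm (snd p)" by (rule Cauchy_Schwarz_ineq2)
    also have "\<dots> \<le> L * (norm (fst p) + norm (snd p))"
      using L_nonneg by (intro mult_mono D_bd) auto
    finally have "\<bar>V p\<bar> \<le> C1 * (L * (norm (fst p) + norm (snd p)))"
      unfolding V_def abs_mult using C1(1) by (intro mult_mono C1(2) q_range) auto
    then show ?thesis by (simp add: mult.assoc)
  qed
  have W_bd: "\<bar>W p\<bar> \<le> C2 * (L * L)" for p
  proof -
    have "\<bar>D (fst p) \<bullet> Q \<theta> (?X p)\<bar> \<le> norm (D (fst p)) * norm (Q \<theta> (?X p))" by (rule Cauchy_Schwarz_ineq2)
    also have "\<dots> \<le> L * L"
      using L_nonneg by (intro mult_mono D_bd Q_bd) auto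
    finally show ?thesis
      unfolding W_def abs_mult using C2(1) by (intro mult_mono C2(2) q_range) auto
  qed
  have V_int: "integrable (M \<Otimes>\<^sub>M M) V"
    by (rule Bochner_Integration.integrable_bound[OF integrable_mult_right[OF integrable_norm_sum]])
       (use V_bd in \<open>auto intro!: measurable_pair V_m AE_I2 order_trans[OF V_bd abs_ge_self]\<close>)
  have W_int: "integrable (M \<Otimes>\<^sub>M M) W"
    by (rule pair.integrable_const_bound[where B="C2 * (L * L)"])
       (use W_bd in \<open>auto intro!: measurable_pair W_m AE_I2\<close>)
  note V_int' = integral_gaussian_rotation(2)[OF \<gamma> \<theta> V_m, THEN iffD2, OF V_int]
  note W_int' = integral_gaussian_rotation(2)[OF \<gamma> \<theta> W_m, THEN iffD2, OF W_int]
  have Vrot: "V (rotation \<theta> (x, z)) = \<Psi>1 (q \<theta> x) * (D (?c *\<^sub>R x + ?s *\<^sub>R z) \<bullet> (?c *\<^sub>R z - ?s *\<^sub>R x))" for x z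
    unfolding V_def rotation_fst_back by (simp add: rotation_def)
  have Wrot: "W (rotation \<theta> (x, z)) = \<Psi>2 (q \<theta> x) * (D (?c *\<^sub>R x + ?s *\<^sub>R z) \<bullet> Q \<theta> x)" for x z
    unfolding W_def rotation_fst_back by (simp add: rotation_def)
  have "(\<integral>x. \<Psi>1 (q \<theta> x) * r \<theta> x \<partial>M) = (\<integral>x. \<integral>z. V (rotation \<theta> (x, z)) \<partial>M \<partial>M)"
    unfolding Vrot r_def by simp
  also have "\<dots> = (\<integral>p. V p \<partial>(M \<Otimes>\<^sub>M M))"
    using pair.integral_fst'[OF V_int'] integral_gaussian_rotation(1)[OF \<gamma> \<theta> V_m] by simp
  also have "\<dots> = (\<integral>x. \<integral>z. V (x, z) \<partial>M \<partial>M)"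
    using pair.integral_fst'[OF V_int] by simp
  also have "\<dots> = (\<integral>x. (- (?s * ?c / (2 * \<gamma>))) * (\<integral>z. W (x, z) \<partial>M) \<partial>M)"
  proof (rule Bochner_Integration.integral_cong)
    fix x :: 'a
    let ?G = "\<lambda>z. (- ?s * ?c * \<Psi>2 (q \<theta> (?X (x, z)))) *\<^sub>R Q \<theta> (?X (x, z))"
    have Xz_m: "(\<lambda>z. ?X (x, z)) \<in> borel \<rightarrow>\<^sub>M borel"
      by (intro borel_measurable_continuous_onI continuous_intros)
    have "(\<integral>z. V (x, z) \<partial>M) = (\<integral>z. \<Psi>1 (q \<theta> (?X (x, z))) * (D x \<bullet> z) \<partial>M)"
      by (simp add: V_def)
    also have "\<dots> = (\<integral>z. D x \<bullet> ?G z \<partial>M) / (2 * \<gamma>)"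
    proof (rule gaussian_integration_by_parts[OF \<gamma>, where C="max C1 (C2 * L)"])
      show "((\<lambda>z. \<Psi>1 (q \<theta> (?X (x, z)))) has_derivative (\<lambda>h. ?G z \<bullet> h)) (at z)" for z
      proof -
        have "((\<lambda>z. ?X (x, z)) has_derivative (\<lambda>h. - ?s *\<^sub>R h)) (at z)"
          by (auto intro!: derivative_eq_intros)
        from has_derivative_compose[OF this q_der]
        have "((\<lambda>z. q \<theta> (?X (x, z))) has_derivative (\<lambda>h. (?c *\<^sub>R Q \<theta> (?X (x, z))) \<bullet> (- ?s *\<^sub>R h))) (at z)" .
        from has_derivative_compose[OF this \<Psi>1_der[OF q_range, unfolded has_field_derivative_def]]
        show ?thesis by (rule has_derivative_eq_rhs) (simp add: fun_eq_iff)
      qed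
      show "?G \<in> borel_measurable borel"
        by (intro borel_measurable_scaleR borel_measurable_times borel_measurable_const
             measurable_compose[OF Xz_m \<Psi>_meas(3)] measurable_compose[OF Xz_m Q_meas])
      show "\<bar>\<Psi>1 (q \<theta> (?X (x, z)))\<bar> \<le> max C1 (C2 * L)" for z
        using C1(2)[OF q_range, of \<theta> "?X (x, z)"] by linarith
      show "norm (?G z) \<le> max C1 (C2 * L)" for z
      proof -
        have "\<bar>?s * ?c\<bar> \<le> 1" by (simp add: abs_mult mult_le_one)
        moreover have "\<bar>\<Psi>2 (q \<theta> (?X (x, z)))\<bar> * norm (Q \<theta> (?X (x, z))) \<le> C2 * L"
          using C2(1) by (intro mult_mono C2(2) q_range Q_bd) auto
        ultimately have "\<bar>?s * ?c\<bar> * (\<bar>\<Psi>2 (q \<theta> (?X (x, z)))\<bar> * norm (Q \<theta> (?X (x, z)))) \<le> 1 * (C2 * L)"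
          by (rule mult_mono) auto
        then show ?thesis by (simp add: abs_mult mult.assoc)
      qed
    qed
    also have "(\<integral>z. D x \<bullet> ?G z \<partial>M) = (\<integral>z. (- (?s * ?c)) * W (x, z) \<partial>M)"
      by (simp add: W_def mult.assoc)
    also have "\<dots> / (2 * \<gamma>) = (- (?s * ?c / (2 * \<gamma>))) * (\<integral>z. W (x, z) \<partial>M)"
      by (subst integral_mult_right_zero) simp
    finally show "(\<integral>z. V (x, z) \<partial>M) = (- (?s * ?c / (2 * \<gamma>))) * (\<integral>z. W (x, z) \<partial>M)" .
  qed simp
  also have "\<dots> = (- (?s * ?c / (2 * \<gamma>))) * (\<integral>x. \<integral>z. W (x, z) \<partial>M \<partial>M)"
    by (rule integral_mult_right_zero)
  also have "(\<integral>x. \<integral>z. W (x, z) \<partial>M \<partial>M) = (\<integral>x. \<integral>z. W (rotation \<theta> (x, z)) \<partial>M \<partial>M)"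
    using pair.integral_fst'[OF W_int'] pair.integral_fst'[OF W_int] integral_gaussian_rotation(1)[OF \<gamma> \<theta> W_m] by simp
  also have "\<dots> = (\<integral>x. \<Psi>2 (q \<theta> x) * (norm (Q \<theta> x))\<^sup>2 \<partial>M)"
  proof (rule Bochner_Integration.integral_cong)
    fix x
    have "(\<integral>z. D (?c *\<^sub>R x + ?s *\<^sub>R z) \<bullet> Q \<theta> x \<partial>M) = Q \<theta> x \<bullet> Q \<theta> x"
      unfolding Q_def by (subst integral_inner_left) (auto intro!: integrable_D)
    then show "(\<integral>z. W (rotation \<theta> (x, z)) \<partial>M) = \<Psi>2 (q \<theta> x) * (norm (Q \<theta> x))\<^sup>2"
      unfolding Wrot by (simp add: power2_norm_eq_inner)
  qed simp
  finally show ?thesis .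
qed

text \<open>
  The hypothesis provides an affine minorant of \<open>(m, v) \<mapsto> \<Psi>2 m |v|\<^sup>2\<close> touching it at any given point.
  Jensen's inequality therefore bounds the entropy production at angle \<open>\<theta>\<close> by the same expression
  for \<open>f\<close> and \<open>D\<close> in place of \<open>q \<theta>\<close> and \<open>Q \<theta>\<close>. Integrating \<open>sin \<theta> cos \<theta> / (2 \<gamma>)\<close> over the quarter
  circle gives the constant \<open>1 / (4 \<gamma>)\<close>.
\<close>

theorem phi_entropy:
  assumes conv: "\<And>m0 v0::'a. m0 \<in> {a..b} \<Longrightarrow> \<exists>d c. \<forall>m\<in>{a..b}. \<forall>v.
      \<Psi>2 m0 * (norm v0)\<^sup>2 + d \<bullet> (v - v0) + c * (m - m0) \<le> \<Psi>2 m * (norm v)\<^sup>2"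
  shows "(\<integral>x. \<Psi> (f x) \<partial>M) - \<Psi> (\<integral>x. f x \<partial>M) \<le> (\<integral>x. \<Psi>2 (f x) * (norm (D x))\<^sup>2 \<partial>M) / (4 * \<gamma>)"
proof -
  define G where "G x = \<Psi>2 (f x) * (norm (D x))\<^sup>2" for x
  define K where "K = (\<integral>x. G x \<partial>M)"
  obtain C2 where C2: "C2 > 0" "\<And>t. t \<in> {a..b} \<Longrightarrow> \<bar>\<Psi>2 t\<bar> \<le> C2" by (rule comp_bd[OF \<Psi>2_cont]) blast
  have f2_m: "(\<lambda>x. \<Psi>2 (f x)) \<in> borel_measurable borel"
    by (intro borel_measurable_continuous_onI comp_cont[OF \<Psi>2_cont f_cont f_range])
  have G_m[measurable]: "G \<in> borel_measurable borel" unfolding G_def using f2_m by measurable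
  have prod_bd: "\<bar>\<Psi>2 m * (norm v)\<^sup>2\<bar> \<le> C2 * L\<^sup>2" if "m \<in> {a..b}" "norm v \<le> L" for m and v :: 'a
    unfolding abs_mult using C2(1) that by (intro mult_mono C2(2)) (auto intro!: power_mono)
  have G_bd: "\<bar>G x\<bar> \<le> C2 * L\<^sup>2" for x unfolding G_def by (intro prod_bd f_range D_bd)
  have G_int: "g \<in> borel_measurable borel \<Longrightarrow> integrable M (\<lambda>z. G (g z))" for g
    by (rule integrable_const_bound[where B="C2 * L\<^sup>2"]) (auto intro!: AE_I2 G_bd)
  have mono: "- (sin \<theta> * cos \<theta> / (2 * \<gamma>)) * K \<le> (\<integral>x. \<Psi>1 (q \<theta> x) * r \<theta> x \<partial>M)" if \<theta>: "\<theta> \<in> {0..pi/2}" for \<theta>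
  proof -
    let ?y = "\<lambda>(x::'a) z. cos \<theta> *\<^sub>R x + sin \<theta> *\<^sub>R z"
    have y_m: "(\<lambda>z. ?y x z) \<in> borel_measurable borel" for x
      by (intro borel_measurable_continuous_onI continuous_intros)
    have jensen: "\<Psi>2 (q \<theta> x) * (norm (Q \<theta> x))\<^sup>2 \<le> (\<integral>z. G (?y x z) \<partial>M)" for x
    proof -
      obtain d c where dc: "\<And>m v. m \<in> {a..b} \<Longrightarrow> \<Psi>2 (q \<theta> x) * (norm (Q \<theta> x))\<^sup>2 + d \<bullet> (v - Q \<theta> x) + c * (m - q \<theta> x) \<le> \<Psi>2 m * (norm v)\<^sup>2"
        using conv[OF q_range[of \<theta> x], of "Q \<theta> x"] by blast
      have "\<Psi>2 (q \<theta> x) * (norm (Q \<theta> x))\<^sup>2 = \<Psi>2 (q \<theta> x) * (norm (Q \<theta> x))\<^sup>2 + d \<bullet> ((\<integral>z. D (?y x z) \<partial>M) - Q \<theta> x) + c * ((\<integral>z. f (?y x z) \<partial>M) - q \<theta> x)"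
        by (simp add: q_def Q_def)
      also have "\<dots> = (\<integral>z. \<Psi>2 (q \<theta> x) * (norm (Q \<theta> x))\<^sup>2 + d \<bullet> (D (?y x z) - Q \<theta> x) + c * (f (?y x z) - q \<theta> x) \<partial>M)"
        using integrable_D[OF y_m, of x] integrable_f[OF y_m, of x] by simp
      also have "\<dots> \<le> (\<integral>z. G (?y x z) \<partial>M)"
        using integrable_D[OF y_m, of x] integrable_f[OF y_m, of x]
        by (intro integral_mono G_int y_m) (auto simp: G_def intro!: dc f_range)
      finally show ?thesis .
    qed
    have fst_m: "(fst :: 'a\<times>'a \<Rightarrow> 'a) \<in> borel \<rightarrow>\<^sub>M borel"
      by (intro borel_measurable_continuous_onI continuous_intros)
    have Gf_m: "(\<lambda>p::'a\<times>'a. G (fst p)) \<in> borel_measurable borel"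
      by (rule measurable_compose[OF fst_m G_m])
    have Gf_int: "integrable (M \<Otimes>\<^sub>M M) (\<lambda>p. G (fst p))"
      by (rule pair.integrable_const_bound[where B="C2 * L\<^sup>2"])
         (auto intro!: measurable_pair Gf_m AE_I2 G_bd)
    note Gf_int' = integral_gaussian_rotation(2)[OF \<gamma> \<theta> Gf_m, THEN iffD2, OF Gf_int]
    have "(\<integral>x. \<Psi>2 (q \<theta> x) * (norm (Q \<theta> x))\<^sup>2 \<partial>M) \<le> (\<integral>x. \<integral>z. G (?y x z) \<partial>M \<partial>M)"
    proof (rule integral_mono)
      show "integrable M (\<lambda>x. \<Psi>2 (q \<theta> x) * (norm (Q \<theta> x))\<^sup>2)"
        by (rule integrable_const_bound[where B="C2 * L\<^sup>2"])
           (use prod_bd[OF q_range Q_bd] in \<open>auto intro!: AE_I2\<close>)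
      show "integrable M (\<lambda>x. \<integral>z. G (?y x z) \<partial>M)"
        using pair.integrable_fst'[OF Gf_int'] by (simp add: rotation_def)
    qed (rule jensen)
    also have "\<dots> = (\<integral>p. G (fst p) \<partial>(M \<Otimes>\<^sub>M M))"
      using pair.integral_fst'[OF Gf_int'] integral_gaussian_rotation(1)[OF \<gamma> \<theta> Gf_m] by (simp add: rotation_def)
    also have "\<dots> = K"
      using pair.integral_fst'[OF Gf_int] by (simp add: K_def)
    finally have le: "(\<integral>x. \<Psi>2 (q \<theta> x) * (norm (Q \<theta> x))\<^sup>2 \<partial>M) \<le> K" .
    have "sin \<theta> \<ge> 0" using \<theta> by (intro sin_ge_zero) auto
    moreover have "cos \<theta> \<ge> 0" using \<theta> by (intro cos_ge_zero) auto
    ultimately have "(sin \<theta> * cos \<theta> / (2 * \<gamma>)) * (\<integral>x. \<Psi>2 (q \<theta> x) * (norm (Q \<theta> x))\<^sup>2 \<partial>M) \<le> (sin \<theta> * cos \<theta> / (2 * \<gamma>)) * K"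
      using \<gamma> by (intro mult_left_mono le) auto
    then show ?thesis unfolding entropy_production[OF \<theta>] by simp
  qed
  let ?h = "\<lambda>\<theta>. (\<integral>x. \<Psi> (q \<theta> x) \<partial>M) + K / (4 * \<gamma>) * (sin \<theta>)\<^sup>2"
  have "?h 0 \<le> ?h (pi/2)"
  proof (rule DERIV_nonneg_imp_nondecreasing[where f="?h" and a=0 and b="pi/2"])
    fix \<theta> :: real assume \<theta>: "0 \<le> \<theta>" "\<theta> \<le> pi/2"
    have "(?h has_real_derivative ((\<integral>x. \<Psi>1 (q \<theta> x) * r \<theta> x \<partial>M) + K / (4 * \<gamma>) * (2 * (sin \<theta> * cos \<theta>)))) (at \<theta>)"
      by (rule derivative_eq_intros entropy_der refl | simp)+
    moreover have "0 \<le> (\<integral>x. \<Psi>1 (q \<theta> x) * r \<theta> x \<partial>M) + K / (4 * \<gamma>) * (2 * (sin \<theta> * cos \<theta>))"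
    proof -
      have "K / (4 * \<gamma>) * (2 * (sin \<theta> * cos \<theta>)) = sin \<theta> * cos \<theta> / (2 * \<gamma>) * K"
        using \<gamma> by (simp add: field_simps)
      moreover have "- (sin \<theta> * cos \<theta> / (2 * \<gamma>)) * K \<le> (\<integral>x. \<Psi>1 (q \<theta> x) * r \<theta> x \<partial>M)"
        using \<theta> by (intro mono) auto
      ultimately show ?thesis by linarith
    qed
    ultimately show "\<exists>y. (?h has_real_derivative y) (at \<theta>) \<and> 0 \<le> y"
      by blast
  qed simp
  then show ?thesis
    by (simp add: q_def K_def G_def)
qed

end

section \<open>Smooth functions with compact support\<close>

text \<open>
  Derivatives of these functions are linear combinations of functions of the same family, so that
  smoothness of compactly supported bumps becomes a matter of algebra.
\<close>

definition flat_exp :: "nat \<Rightarrow> real \<Rightarrow> real" where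
  "flat_exp k t = (if t > 0 then exp (- inverse t) * inverse t ^ k else 0)"

lemma flat_exp_tendsto_0: "(flat_exp k \<longlongrightarrow> 0) (at 0)"
proof -
  have "((\<lambda>s::real. s ^ k / exp s) \<longlongrightarrow> 0) at_top" by (rule tendsto_power_div_exp_0)
  from filterlim_compose[OF this filterlim_inverse_at_top_right]
  have "((\<lambda>t::real. inverse t ^ k / exp (inverse t)) \<longlongrightarrow> 0) (at_right 0)" .
  moreover have "\<forall>\<^sub>F t::real in at_right 0. inverse t ^ k / exp (inverse t) = flat_exp k t"
    by (auto simp: eventually_at_filter flat_exp_def exp_minus divide_inverse mult.commute)
  ultimately have "(flat_exp k \<longlongrightarrow> 0) (at_right 0)" by (rule Lim_transform_eventually)
  moreover have "(flat_exp k \<longlongrightarrow> 0) (at_left 0)"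
    by (rule Lim_transform_eventually[OF tendsto_const]) (auto simp: eventually_at_filter flat_exp_def)
  ultimately show ?thesis by (simp add: filterlim_at_split)
qed

lemma flat_exp_derivative:
  "(flat_exp k has_real_derivative flat_exp (k + 2) t - k * flat_exp (Suc k) t) (at t)"
proof -
  consider "t < 0" | "t = 0" | "t > 0" by linarith
  then show ?thesis
  proof cases
    case 1
    have "((\<lambda>t. 0) has_real_derivative 0) (at t)" by simp
    then have "(flat_exp k has_real_derivative 0) (at t)"
      by (rule has_field_derivative_transform_within_open[where S="{..<0}"]) (use 1 in \<open>auto simp: flat_exp_def\<close>)
    then show ?thesis using 1 by (simp add: flat_exp_def)
  next
    case 2
    have "\<forall>\<^sub>F h in at 0. flat_exp (Suc k) h = (flat_exp k (0 + h) - flat_exp k 0) / h"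
      by (auto simp: eventually_at_filter flat_exp_def divide_inverse power2_eq_square)
    then have "((\<lambda>h. (flat_exp k (0 + h) - flat_exp k 0) / h) \<longlongrightarrow> 0) (at 0)"
      by (rule Lim_transform_eventually[OF flat_exp_tendsto_0])
    then show ?thesis using 2 by (simp add: DERIV_def flat_exp_def)
  next
    case 3
    have 1: "((\<lambda>t. exp (- inverse t)) has_real_derivative exp (- inverse t) * inverse t ^ 2) (at t)"
      using 3 by (auto intro!: derivative_eq_intros simp: power2_eq_square)
    have 2: "((\<lambda>t. inverse t ^ k) has_real_derivative - (k * inverse t ^ Suc k)) (at t)"
      using DERIV_power[OF DERIV_inverse, of t k] 3 by (cases k) (auto simp: mult_ac power2_eq_square)
    have "((\<lambda>t. exp (- inverse t) * inverse t ^ k) has_real_derivative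
       exp (- inverse t) * inverse t ^ (k + 2) - k * (exp (- inverse t) * inverse t ^ Suc k)) (at t)"
      by (rule DERIV_cong[OF DERIV_mult[OF 1 2]]) (simp add: power_add power2_eq_square algebra_simps)
    then have "(flat_exp k has_real_derivative exp (- inverse t) * inverse t ^ (k + 2) - k * (exp (- inverse t) * inverse t ^ Suc k)) (at t)"
      by (rule has_field_derivative_transform_within_open[where S="{0<..}"]) (use 3 in \<open>auto simp: flat_exp_def\<close>)
    then show ?thesis using 3 by (simp add: flat_exp_def power2_eq_square)
  qed
qed

lemma flat_exp_nonneg: "flat_exp k t \<ge> 0" by (simp add: flat_exp_def)

lemma flat_exp_0_le: "flat_exp 0 t \<le> 1" by (auto simp: flat_exp_def)

text \<open>
  This bounds the gradient of the cutoff \<open>exp(- 1/(R\<^sup>2 - |x|\<^sup>2))\<close> by \<open>4 |x|\<close>, uniformly in \<open>R\<close>.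
\<close>

lemma flat_exp_2_le: "flat_exp 2 t \<le> 2"
proof (cases "t > 0")
  case True
  have "1 + inverse t + (inverse t)\<^sup>2 / 2 \<le> exp (inverse t)" using True by (intro exp_lower_Taylor_quadratic) simp
  moreover have "inverse t > 0" using True by simp
  ultimately have "(inverse t)\<^sup>2 \<le> 2 * exp (inverse t)" by linarith
  then have "exp (- inverse t) * (inverse t)\<^sup>2 \<le> exp (- inverse t) * (2 * exp (inverse t))" by (intro mult_left_mono) auto
  also have "\<dots> = 2" by (simp add: exp_minus)
  finally show ?thesis using True by (simp add: flat_exp_def power2_eq_square)
qed (simp add: flat_exp_def)

lemma flat_exp_continuous: "continuous_on S (flat_exp k)"
  using flat_exp_derivative DERIV_isCont by (meson continuous_at_imp_continuous_on)

text \<open>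
  An algebra that contains the bumps and is closed under partial derivatives; all its members are
  therefore smooth.
\<close>

inductive_set smooth_algebra :: "(real ^ 'n::finite \<Rightarrow> complex) set" where
  const: "(\<lambda>x. c) \<in> smooth_algebra"
| coord: "(\<lambda>x. of_real (x $ i)) \<in> smooth_algebra"
| bump: "(\<lambda>x. of_real (flat_exp k (\<rho> - (norm (x - a))\<^sup>2))) \<in> smooth_algebra"
| add: "f \<in> smooth_algebra \<Longrightarrow> g \<in> smooth_algebra \<Longrightarrow> (\<lambda>x. f x + g x) \<in> smooth_algebra"
| mult: "f \<in> smooth_algebra \<Longrightarrow> g \<in> smooth_algebra \<Longrightarrow> (\<lambda>x. f x * g x) \<in> smooth_algebra"

definition bump_grad :: "nat \<Rightarrow> real \<Rightarrow> 'a::real_inner \<Rightarrow> 'a" where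
  "bump_grad k \<rho> x = (- 2 * (flat_exp (k + 2) (\<rho> - (norm x)\<^sup>2) - k * flat_exp (Suc k) (\<rho> - (norm x)\<^sup>2))) *\<^sub>R x"

lemma bump_has_derivative:
  fixes a :: "'a::real_inner"
  shows "((\<lambda>x. flat_exp k (\<rho> - (norm (x - a))\<^sup>2)) has_derivative (\<lambda>h. bump_grad k \<rho> (x - a) \<bullet> h)) (at x)"
proof -
  have "((\<lambda>x. \<rho> - (norm (x - a))\<^sup>2) has_derivative (\<lambda>h. - 2 * ((x - a) \<bullet> h))) (at x)"
    unfolding power2_norm_eq_inner
    by (auto intro!: derivative_eq_intros simp: inner_commute algebra_simps)
  from has_derivative_compose[OF this flat_exp_derivative[unfolded has_field_derivative_def]]
  show ?thesis by (rule has_derivative_eq_rhs) (simp add: fun_eq_iff bump_grad_def algebra_simps)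
qed

lemma smooth_algebra_derivative:
  fixes f :: "real ^ 'n::finite \<Rightarrow> complex"
  assumes "f \<in> smooth_algebra"
  shows "\<exists>f'. (\<forall>x. (f has_derivative f' x) (at x)) \<and> (\<forall>i. (\<lambda>x. f' x (axis i 1)) \<in> smooth_algebra)"
  using assms
proof induction
  case (const c)
  show ?case by (rule exI[of _ "\<lambda>_ _. 0"]) (auto intro: smooth_algebra.const)
next
  case (coord j)
  have "((\<lambda>x. of_real (x $ j) :: complex) has_derivative (\<lambda>h. of_real (h $ j))) (at x)" for x :: "real ^ 'n"
    by (intro derivative_intros has_derivative_of_real bounded_linear.has_derivative[OF bounded_linear_vec_nth])
  moreover have "(\<lambda>x. of_real ((axis i 1 :: real ^ 'n) $ j) :: complex) \<in> smooth_algebra" for i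
    by (rule smooth_algebra.const)
  ultimately show ?case by (intro exI[of _ "\<lambda>x h. of_real (h $ j)"]) auto
next
  case (bump k \<rho> a)
  let ?F = "\<lambda>i x. (- 2 * (of_real (flat_exp (k + 2) (\<rho> - (norm (x - a))\<^sup>2)) + (- of_nat k) * of_real (flat_exp (Suc k) (\<rho> - (norm (x - a))\<^sup>2)))) * (of_real (x $ i) + of_real (- a $ i)) :: complex"
  have "((\<lambda>x. of_real (flat_exp k (\<rho> - (norm (x - a))\<^sup>2)) :: complex) has_derivative (\<lambda>h. of_real (bump_grad k \<rho> (x - a) \<bullet> h))) (at x)" for x
    by (intro has_derivative_of_real bump_has_derivative)
  moreover have "?F i \<in> smooth_algebra" for i
    by (intro smooth_algebra.intros)
  moreover have "?F i = (\<lambda>x. of_real (bump_grad k \<rho> (x - a) \<bullet> axis i 1))" for i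
    by (simp add: bump_grad_def inner_axis fun_eq_iff)
  ultimately show ?case by (intro exI[of _ "\<lambda>x h. of_real (bump_grad k \<rho> (x - a) \<bullet> h)"]) auto
next
  case (add f g)
  then obtain f' g' where *: "\<And>x. (f has_derivative f' x) (at x)" "\<And>i. (\<lambda>x. f' x (axis i 1)) \<in> smooth_algebra"
    "\<And>x. (g has_derivative g' x) (at x)" "\<And>i. (\<lambda>x. g' x (axis i 1)) \<in> smooth_algebra" by metis
  show ?case
    by (rule exI[of _ "\<lambda>x h. f' x h + g' x h"]) (intro conjI allI smooth_algebra.add has_derivative_add *)
next
  case (mult f g)
  then obtain f' g' where *: "\<And>x. (f has_derivative f' x) (at x)" "\<And>i. (\<lambda>x. f' x (axis i 1)) \<in> smooth_algebra"
    "\<And>x. (g has_derivative g' x) (at x)" "\<And>i. (\<lambda>x. g' x (axis i 1)) \<in> smooth_algebra" by metis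
  show ?case
    by (rule exI[of _ "\<lambda>x h. f x * g' x h + f' x h * g x"])
       (intro conjI allI smooth_algebra.add smooth_algebra.mult has_derivative_mult *(1,3) *(2) *(4) mult.hyps)
qed

lemma partial_derivative_eq:
  "(f has_derivative f') (at x) \<Longrightarrow> partial_derivative i f x = f' (axis i 1)"
  unfolding partial_derivative_def by (metis frechet_derivative_at)

lemma smooth_algebra_k_times:
  "f \<in> smooth_algebra \<Longrightarrow> k_times_differentiable k f"
proof (induction k arbitrary: f)
  case 0
  then obtain f' where "\<And>x. (f has_derivative f' x) (at x)" using smooth_algebra_derivative by metis
  then show ?case using has_derivative_continuous by (metis k_times_differentiable.simps(1) continuous_at_imp_continuous_on)
next
  case (Suc k)
  then obtain f' where f': "\<And>x. (f has_derivative f' x) (at x)" "\<And>i. (\<lambda>x. f' x (axis i 1)) \<in> smooth_algebra"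
    using smooth_algebra_derivative by metis
  have "partial_derivative i f = (\<lambda>x. f' x (axis i 1))" for i
    using partial_derivative_eq[OF f'(1)] by auto
  then show ?case using f' Suc.IH by (auto simp: differentiable_on_def differentiable_def)
qed

lemma smooth_algebra_test_function:
  assumes "f \<in> smooth_algebra" "bounded {x. f x \<noteq> 0}"
  shows "test_function f"
  unfolding test_function_def using smooth_algebra_k_times[OF assms(1)] assms(2)
  by (simp add: support_on_def compact_closure)

lemma test_function_props:
  fixes f :: "real ^ 'n::finite \<Rightarrow> complex"
  assumes "test_function f"
  shows "(f has_derivative frechet_derivative f (at x)) (at x)"
    and "continuous_on UNIV f" and "continuous_on UNIV (partial_derivative i f)"
    and "\<exists>R>0. \<forall>x. norm x \<ge> R \<longrightarrow> f x = 0"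
proof -
  have k: "k_times_differentiable k f" for k using assms by (simp add: test_function_def)
  have "f differentiable (at x)" using k[of 1] by (simp add: differentiable_on_def)
  then show "(f has_derivative frechet_derivative f (at x)) (at x)" by (simp add: frechet_derivative_works)
  show "continuous_on UNIV f" using k[of 0] by simp
  show "continuous_on UNIV (partial_derivative i f)" using k[of 1] by simp
  have "bounded {x. f x \<noteq> 0}"
    using assms by (simp add: test_function_def support_on_def compact_closure)
  then obtain R where "R > 0" "\<And>x. f x \<noteq> 0 \<Longrightarrow> norm x \<le> R" by (auto simp: bounded_pos)
  then show "\<exists>R>0. \<forall>x. norm x \<ge> R \<longrightarrow> f x = 0"
    by (intro exI[of _ "R + 1"]) force
qed

section \<open>Square-integrable functions and translations\<close>

definition sq_int :: "'a measure \<Rightarrow> ('a \<Rightarrow> 'b::euclidean_space) \<Rightarrow> bool" where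
  "sq_int M f \<longleftrightarrow> f \<in> borel_measurable M \<and> integrable M (\<lambda>x. (norm (f x))\<^sup>2)"

definition l2 :: "'a measure \<Rightarrow> ('a \<Rightarrow> 'b::euclidean_space) \<Rightarrow> real" where
  "l2 M f = sqrt (\<integral>x. (norm (f x))\<^sup>2 \<partial>M)"

lemma l2_nonneg [simp]: "l2 M f \<ge> 0" by (simp add: l2_def)

lemma l2_power2: "(l2 M f)\<^sup>2 = (\<integral>x. (norm (f x))\<^sup>2 \<partial>M)" by (simp add: l2_def)

lemma sq_int_measurable: "sq_int M f \<Longrightarrow> f \<in> borel_measurable M"
  by (simp add: sq_int_def)

lemma sq_int_integrable: "sq_int M f \<Longrightarrow> integrable M (\<lambda>x. (norm (f x))\<^sup>2)"
  by (simp add: sq_int_def)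

lemma sq_int_bound:
  assumes "sq_int M f" "g \<in> borel_measurable M" "AE x in M. norm (g x) \<le> C * norm (f x)"
  shows "sq_int M g" "l2 M g \<le> \<bar>C\<bar> * l2 M f"
proof -
  have ae: "AE x in M. (norm (g x))\<^sup>2 \<le> C\<^sup>2 * (norm (f x))\<^sup>2"
    using assms(3) by eventually_elim (metis norm_ge_zero power_mono power_mult_distrib)
  have i: "integrable M (\<lambda>x. C\<^sup>2 * (norm (f x))\<^sup>2)" using assms(1) by (simp add: sq_int_def)
  have ig: "integrable M (\<lambda>x. (norm (g x))\<^sup>2)"
    by (rule Bochner_Integration.integrable_bound[OF i]) (use assms(2) ae in auto)
  then show "sq_int M g" using assms(2) by (simp add: sq_int_def)
  have "(l2 M g)\<^sup>2 \<le> (\<bar>C\<bar> * l2 M f)\<^sup>2"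
    unfolding power_mult_distrib l2_power2 using integral_mono_AE[OF ig i ae] by simp
  then show "l2 M g \<le> \<bar>C\<bar> * l2 M f" by (rule power2_le_imp_le) simp
qed

lemma sq_int_scaleR [intro]: "sq_int M f \<Longrightarrow> sq_int M (\<lambda>x. c *\<^sub>R f x)"
  by (rule sq_int_bound(1)[where C="\<bar>c\<bar>"]) (auto simp: sq_int_def)

lemma sq_int_mult [intro]: "sq_int M f \<Longrightarrow> sq_int M (\<lambda>x. c * f x)" for c :: complex
  by (rule sq_int_bound(1)[where C="norm c"]) (auto simp: norm_mult sq_int_def)

lemma l2_scaleR: "l2 M (\<lambda>x. c *\<^sub>R f x) = \<bar>c\<bar> * l2 M f"
  by (simp add: l2_def power_mult_distrib real_sqrt_mult)

lemma l2_mult: "l2 M (\<lambda>x. c * f x) = norm c * l2 M f" for c :: complex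
  by (simp add: l2_def norm_mult power_mult_distrib real_sqrt_mult)

lemma sq_int_prod_integrable:
  assumes "sq_int M f" "sq_int M g"
  shows "integrable M (\<lambda>x. norm (f x) * norm (g x))"
proof (rule Bochner_Integration.integrable_bound)
  note [measurable] = assms[THEN sq_int_measurable]
  show "integrable M (\<lambda>x. (norm (f x))\<^sup>2 + (norm (g x))\<^sup>2)" using assms by (simp add: sq_int_def)
  have "norm (f x) * norm (g x) \<le> (norm (f x))\<^sup>2 + (norm (g x))\<^sup>2" for x
    using sum_squares_bound[of "norm (f x)" "norm (g x)"] mult_nonneg_nonneg[OF norm_ge_zero[of "f x"] norm_ge_zero[of "g x"]]
    by linarith
  then show "AE x in M. norm (norm (f x) * norm (g x)) \<le> norm ((norm (f x))\<^sup>2 + (norm (g x))\<^sup>2)" by simp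
  show "(\<lambda>x. norm (f x) * norm (g x)) \<in> borel_measurable M" by measurable
qed

lemma cauchy_schwarz_l2:
  assumes f: "sq_int M f" and g: "sq_int M g"
  shows "(\<integral>x. norm (f x) * norm (g x) \<partial>M) \<le> l2 M f * l2 M g"
proof -
  let ?A = "(l2 M f)\<^sup>2" and ?B = "(l2 M g)\<^sup>2" and ?C = "\<integral>x. norm (f x) * norm (g x) \<partial>M"
  have q: "0 \<le> ?A - 2 * t * ?C + t\<^sup>2 * ?B" for t
  proof -
    have "0 \<le> (\<integral>x. (norm (f x) - t * norm (g x))\<^sup>2 \<partial>M)" by simp
    also have "\<dots> = (\<integral>x. (norm (f x))\<^sup>2 - 2 * t * (norm (f x) * norm (g x)) + t\<^sup>2 * (norm (g x))\<^sup>2 \<partial>M)"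
      by (simp add: power2_eq_square algebra_simps)
    also have "\<dots> = ?A - 2 * t * ?C + t\<^sup>2 * ?B"
      using f g sq_int_prod_integrable[OF f g] by (simp add: sq_int_def l2_power2)
    finally show ?thesis .
  qed
  have C0: "?C \<ge> 0" by simp
  have "?C\<^sup>2 \<le> ?A * ?B"
  proof (cases "?B = 0")
    case True
    have "?C = 0"
    proof (rule ccontr)
      assume "?C \<noteq> 0"
      then have "?C > 0" using C0 by linarith
      then show False using q[of "(?A + 1) / (2 * ?C)"] True by (simp add: field_simps)
    qed
    then show ?thesis by simp
  next
    case False
    then have B: "?B > 0" by (simp add: order_less_le)
    have "0 \<le> (?A - 2 * (?C / ?B) * ?C + (?C / ?B)\<^sup>2 * ?B) * ?B" using q[of "?C / ?B"] B by (intro mult_nonneg_nonneg) auto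
    also have "\<dots> = ?A * ?B - ?C\<^sup>2"
    proof -
      have "(a - 2 * (c / b) * c + (c / b)\<^sup>2 * b) * b = a * b - c\<^sup>2" if "b > 0" for a b c :: real
        using that by (simp add: power2_eq_square field_simps)
      then show ?thesis using B by blast
    qed
    finally show ?thesis by simp
  qed
  then have "?C\<^sup>2 \<le> (l2 M f * l2 M g)\<^sup>2" by (simp add: power_mult_distrib)
  then show ?thesis by (rule power2_le_imp_le) simp
qed

lemma sq_int_add [intro]:
  assumes "sq_int M f" "sq_int M g"
  shows "sq_int M (\<lambda>x. f x + g x)"
proof -
  note [measurable] = assms[THEN sq_int_measurable]
  have "integrable M (\<lambda>x. (norm (f x + g x))\<^sup>2)"
  proof (rule Bochner_Integration.integrable_bound)
    show "integrable M (\<lambda>x. (norm (f x))\<^sup>2 + 2 * (norm (f x) * norm (g x)) + (norm (g x))\<^sup>2)"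
      using assms sq_int_prod_integrable[OF assms] by (simp add: sq_int_def)
    have "(norm (f x + g x))\<^sup>2 \<le> (norm (f x) + norm (g x))\<^sup>2" for x
      by (intro power_mono norm_triangle_ineq) auto
    then show "AE x in M. norm ((norm (f x + g x))\<^sup>2) \<le> norm ((norm (f x))\<^sup>2 + 2 * (norm (f x) * norm (g x)) + (norm (g x))\<^sup>2)"
      by (auto simp: power2_sum algebra_simps intro!: AE_I2 order_trans[OF _ abs_ge_self])
  qed measurable
  then show ?thesis using assms[THEN sq_int_measurable] by (simp add: sq_int_def)
qed

lemma l2_triangle:
  assumes "sq_int M f" "sq_int M g"
  shows "l2 M (\<lambda>x. f x + g x) \<le> l2 M f + l2 M g"
proof (rule power2_le_imp_le)
  have "(l2 M (\<lambda>x. f x + g x))\<^sup>2 \<le> (\<integral>x. (norm (f x))\<^sup>2 + 2 * (norm (f x) * norm (g x)) + (norm (g x))\<^sup>2 \<partial>M)"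
    unfolding l2_power2
  proof (rule integral_mono)
    show "integrable M (\<lambda>x. (norm (f x + g x))\<^sup>2)" using sq_int_add[OF assms] by (simp add: sq_int_def)
    show "integrable M (\<lambda>x. (norm (f x))\<^sup>2 + 2 * (norm (f x) * norm (g x)) + (norm (g x))\<^sup>2)"
      using assms sq_int_prod_integrable[OF assms] by (simp add: sq_int_def)
    fix x
    have "(norm (f x + g x))\<^sup>2 \<le> (norm (f x) + norm (g x))\<^sup>2"
      by (intro power_mono norm_triangle_ineq) auto
    then show "(norm (f x + g x))\<^sup>2 \<le> (norm (f x))\<^sup>2 + 2 * (norm (f x) * norm (g x)) + (norm (g x))\<^sup>2"
      by (simp add: power2_sum)
  qed
  also have "\<dots> = (l2 M f)\<^sup>2 + 2 * (\<integral>x. norm (f x) * norm (g x) \<partial>M) + (l2 M g)\<^sup>2"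
    using assms sq_int_prod_integrable[OF assms] by (simp add: sq_int_def l2_power2)
  also have "\<dots> \<le> (l2 M f + l2 M g)\<^sup>2"
    using cauchy_schwarz_l2[OF assms] by (simp add: power2_sum)
  finally show "(l2 M (\<lambda>x. f x + g x))\<^sup>2 \<le> (l2 M f + l2 M g)\<^sup>2" .
qed simp

lemma sq_int_diff [intro]: "sq_int M f \<Longrightarrow> sq_int M g \<Longrightarrow> sq_int M (\<lambda>x. f x - g x)"
  using sq_int_add[OF _ sq_int_scaleR[of M g "-1"], of f] by simp

lemma l2_minus_commute: "l2 M (\<lambda>x. f x - g x) = l2 M (\<lambda>x. g x - f x)"
  by (simp add: l2_def norm_minus_commute)

lemma l2_triangle_diff:
  assumes "sq_int M f" "sq_int M g" "sq_int M h"
  shows "l2 M (\<lambda>x. f x - h x) \<le> l2 M (\<lambda>x. f x - g x) + l2 M (\<lambda>x. g x - h x)"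
  using l2_triangle[OF sq_int_diff[OF assms(1,2)] sq_int_diff[OF assms(2,3)]] by simp

lemma l2_reverse_triangle:
  assumes "sq_int M f" "sq_int M g"
  shows "\<bar>l2 M f - l2 M g\<bar> \<le> l2 M (\<lambda>x. f x - g x)"
  using l2_triangle[OF sq_int_diff[OF assms] assms(2)] l2_triangle[OF sq_int_diff[OF assms(2,1)] assms(1)]
  by (simp add: l2_minus_commute[of M g f])

lemma l2_tendsto:
  assumes "\<And>n::nat. sq_int M (f n)" "sq_int M g" "(\<lambda>n. l2 M (\<lambda>x. f n x - g x)) \<longlonglongrightarrow> 0"
  shows "(\<lambda>n. l2 M (f n)) \<longlonglongrightarrow> l2 M g"
proof -
  have "(\<lambda>n. l2 M (f n) - l2 M g) \<longlonglongrightarrow> 0"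
    by (rule Lim_null_comparison[OF _ assms(3)]) (simp add: l2_reverse_triangle assms)
  then show ?thesis by (simp add: LIM_zero_iff)
qed

lemma l2_eq_0_iff: "sq_int M f \<Longrightarrow> l2 M f = 0 \<longleftrightarrow> (AE x in M. f x = 0)"
  unfolding l2_def sq_int_def by (simp add: integral_nonneg_eq_0_iff_AE)

lemma l1_translation_indicator:
  fixes A :: "'a::euclidean_space set"
  assumes A: "A \<in> sets borel" "emeasure lborel A < \<infinity>" and e: "e > 0"
  shows "\<exists>d>0. \<forall>h. norm h < d \<longrightarrow> (\<integral>x. \<bar>indicator A (x - h) - indicator A x :: real\<bar> \<partial>lborel) < e"
proof -
  let ?M = "density lborel (indicator A) :: 'a measure"
  have M: "finite_measure ?M" using A by (intro finite_measureI) (simp add: emeasure_density)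
  have inner: "emeasure ?M A = (SUP K\<in>{K. K \<subseteq> A \<and> compact K}. emeasure ?M K)"
    using A M by (intro inner_regular) (auto simp: finite_measure.emeasure_finite)
  have em: "emeasure ?M K = emeasure lborel K" if "K \<subseteq> A" "K \<in> sets borel" for K
    using that A by (simp add: emeasure_density Int_absorb1 flip: indicator_inter_arith)
  have sup: "emeasure lborel A = (SUP K\<in>{K. K \<subseteq> A \<and> compact K}. emeasure lborel K)"
  proof -
    have "(SUP K\<in>{K. K \<subseteq> A \<and> compact K}. emeasure ?M K) = (SUP K\<in>{K. K \<subseteq> A \<and> compact K}. emeasure lborel K)"
      by (intro SUP_cong refl) (auto intro!: em borel_compact)
    then show ?thesis using inner em[of A] A by simp
  qed
  have eqm: "emeasure lborel S = ennreal (measure lborel S)" if "S \<subseteq> A" for S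
    using that A emeasure_mono[OF that, of lborel] by (intro emeasure_eq_ennreal_measure) auto
  \<comment> \<open>Inner regularity of the finite measure with density the indicator of \<open>A\<close>.\<close>
  obtain K where K: "K \<subseteq> A" "compact K" "measure lborel A < measure lborel K + e / 8"
  proof (cases "measure lborel A = 0")
    case True
    then show thesis using that[of "{}"] e by simp
  next
    case False
    then have "measure lborel A > 0" by (simp add: zero_less_measure_iff)
    then have "ennreal (measure lborel A - e / 8) < emeasure lborel A"
      using e unfolding eqm[OF order_refl] by (intro ennreal_lessI) auto
    then obtain K where K: "K \<subseteq> A" "compact K" "ennreal (measure lborel A - e / 8) < emeasure lborel K"
      unfolding sup less_SUP_iff by auto
    have "measure lborel A - e / 8 < measure lborel K"
    proof (rule ccontr)
      assume "\<not> ?thesis"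
      then have "ennreal (measure lborel K) \<le> ennreal (measure lborel A - e / 8)" by (intro ennreal_leI) auto
      then show False using K(3) eqm[OF K(1)] by simp
    qed
    then show thesis using that[of K] K by simp
  qed
  have Kb: "K \<in> sets borel" using K(2) by (rule borel_compact)
  have AK: "emeasure lborel (A - K) < ennreal (e / 8)"
  proof -
    have "measure lborel (A - K) = measure lborel A - measure lborel K"
      using A Kb K(1) by (intro measure_Diff) auto
    then have "measure lborel (A - K) < e / 8" using K(3) by simp
    then show ?thesis using e eqm[of "A - K"] by (simp add: ennreal_lessI)
  qed
  obtain U where U: "open U" "K \<subseteq> U" "emeasure lebesgue (U - K) < ennreal (e / 8)"
  proof (rule sets_lebesgue_outer_open[of K "e / 8"])
    show "K \<in> sets lebesgue" using Kb by simp
  qed (use e in auto)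
  have UKb: "U - K \<in> sets borel" using U(1) Kb by auto
  have UK: "emeasure lborel (U - K) < ennreal (e / 8)" using U(3) UKb by simp
  obtain d where d: "d > 0" "(\<Union>x\<in>K. ball x d) \<subseteq> U"
    using compact_subset_open_imp_ball_epsilon_subset[OF K(2) U(1,2)] by blast
  let ?I = "\<lambda>S x. indicator S x :: real"
  have I: "integrable lborel (?I S)" "integrable lborel (\<lambda>x. ?I S (x - h))"
    "(\<integral>x. ?I S (x - h) \<partial>lborel) = (\<integral>x. ?I S x \<partial>lborel)"
    if "S \<in> sets borel" "emeasure lborel S < \<infinity>" for S :: "'a set" and h
    using that integral_translation_lborel[of "?I S" "- h"] by (auto simp: integrable_indicator_iff)
  have small: "(\<integral>x. ?I S x \<partial>lborel) < e / 8" if "S \<in> sets borel" "emeasure lborel S < ennreal (e / 8)" for S :: "'a set"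
  proof -
    have "emeasure lborel S \<noteq> \<infinity>" using that(2) by auto
    then have "ennreal (measure lborel S) < ennreal (e / 8)" using that by (simp add: emeasure_eq_ennreal_measure)
    then show ?thesis using that(1) e by (simp add: ennreal_less_iff)
  qed
  have AKb: "A - K \<in> sets borel" using A Kb by auto
  have fin: "emeasure lborel (A - K) < \<infinity>" "emeasure lborel (U - K) < \<infinity>" using AK UK by (auto intro: less_trans)
  have "(\<integral>x. \<bar>?I A (x - h) - ?I A x\<bar> \<partial>lborel) < e" if h: "norm h < d" for h
  proof -
    have pt: "\<bar>?I A (x - h) - ?I A x\<bar> \<le> ?I (A - K) (x - h) + ?I (U - K) (x - h) + (?I (A - K) x + ?I (U - K) x)" for x
    proof -
      have "x \<in> U" if "x - h \<in> K"
      proof -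
        have "x \<in> ball (x - h) d" using h by (simp add: dist_norm)
        then show ?thesis using d(2) that by blast
      qed
      moreover have "x - h \<in> U" if "x \<in> K"
      proof -
        have "x - h \<in> ball x d" using h by (simp add: dist_norm)
        then show ?thesis using d(2) that by blast
      qed
      ultimately show ?thesis using K(1) by (auto simp: indicator_def)
    qed
    have "(\<integral>x. \<bar>?I A (x - h) - ?I A x\<bar> \<partial>lborel)
        \<le> (\<integral>x. ?I (A - K) (x - h) + ?I (U - K) (x - h) + (?I (A - K) x + ?I (U - K) x) \<partial>lborel)"
      by (intro integral_mono integrable_abs Bochner_Integration.integrable_diff Bochner_Integration.integrable_add
          I A AKb UKb fin pt)
    also have "\<dots> = 2 * (\<integral>x. ?I (A - K) x \<partial>lborel) + 2 * (\<integral>x. ?I (U - K) x \<partial>lborel)"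
      using I[OF AKb fin(1)] I[OF UKb fin(2)] by simp
    also have "\<dots> < e" using small[OF AKb AK] small[OF UKb UK] e by linarith
    finally show ?thesis .
  qed
  then show ?thesis using d(1) by blast
qed

lemma l1_translation:
  fixes f :: "'a::euclidean_space \<Rightarrow> real"
  assumes "integrable lborel f" and e: "e > 0"
  shows "\<exists>d>0. \<forall>h. norm h < d \<longrightarrow> (\<integral>x. \<bar>f (x - h) - f x\<bar> \<partial>lborel) < e"
  using assms
proof (induction arbitrary: e rule: integrable_induct)
  case (base A c)
  then obtain d where d: "d > 0" "\<And>h. norm h < d \<Longrightarrow> (\<integral>x. \<bar>indicator A (x - h) - indicator A x :: real\<bar> \<partial>lborel) < e / (\<bar>c\<bar> + 1)"
    using l1_translation_indicator[of A "e / (\<bar>c\<bar> + 1)"] by (auto simp: add_nonneg_pos)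
  have "(\<integral>x. \<bar>indicator A (x - h) *\<^sub>R c - indicator A x *\<^sub>R c\<bar> \<partial>lborel) < e" if h: "norm h < d" for h
  proof -
    have "(\<integral>x. \<bar>indicator A (x - h) *\<^sub>R c - indicator A x *\<^sub>R c\<bar> \<partial>lborel) = (\<integral>x. \<bar>indicator A (x - h) - indicator A x\<bar> \<partial>lborel) * \<bar>c\<bar>"
      by (simp add: abs_mult flip: left_diff_distrib)
    also have "\<dots> \<le> (\<integral>x. \<bar>indicator A (x - h) - indicator A x\<bar> \<partial>lborel) * (\<bar>c\<bar> + 1)"
      by (intro mult_left_mono) auto
    also have "\<dots> < e" using d(2)[OF h] by (simp add: pos_less_divide_eq add_nonneg_pos)
    finally show ?thesis .
  qed
  then show ?case using d(1) by blast
next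
  case (add f g)
  obtain d1 where d1: "d1 > 0" "\<And>h. norm h < d1 \<Longrightarrow> (\<integral>x. \<bar>f (x - h) - f x\<bar> \<partial>lborel) < e / 2"
    using add.IH(1)[of "e/2"] add.prems by auto
  obtain d2 where d2: "d2 > 0" "\<And>h. norm h < d2 \<Longrightarrow> (\<integral>x. \<bar>g (x - h) - g x\<bar> \<partial>lborel) < e / 2"
    using add.IH(2)[of "e/2"] add.prems by auto
  have "(\<integral>x. \<bar>f (x - h) + g (x - h) - (f x + g x)\<bar> \<partial>lborel) < e" if h: "norm h < min d1 d2" for h
  proof -
    have i: "integrable lborel (\<lambda>x. f (x - h))" "integrable lborel (\<lambda>x. g (x - h))"
      using add.hyps integral_translation_lborel(1)[of f "- h"] integral_translation_lborel(1)[of g "- h"] by auto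
    have "(\<integral>x. \<bar>f (x - h) + g (x - h) - (f x + g x)\<bar> \<partial>lborel) \<le> (\<integral>x. \<bar>f (x - h) - f x\<bar> + \<bar>g (x - h) - g x\<bar> \<partial>lborel)"
      using i add.hyps by (intro integral_mono) auto
    also have "\<dots> < e" using i add.hyps d1(2)[of h] d2(2)[of h] h by simp
    finally show ?thesis .
  qed
  then show ?case using d1(1) d2(1) by (intro exI[of _ "min d1 d2"]) auto
next
  case (lim f s)
  have "(\<lambda>i. \<integral>x. \<bar>s i x - f x\<bar> \<partial>lborel) \<longlonglongrightarrow> (\<integral>(x::'a). 0 \<partial>lborel)"
  proof (rule integral_dominated_convergence[where w="\<lambda>x. 3 * \<bar>f x\<bar>"])
    show "AE x in lborel. (\<lambda>i. \<bar>s i x - f x\<bar>) \<longlonglongrightarrow> 0"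
      using lim.hyps(2) by (auto intro!: AE_I2 tendsto_rabs_zero simp: LIM_zero_iff)
    show "AE x in lborel. norm \<bar>s i x - f x\<bar> \<le> 3 * \<bar>f x\<bar>" for i
    proof (rule AE_I2)
      fix x :: 'a
      have "\<bar>s i x\<bar> \<le> 2 * \<bar>f x\<bar>" using lim.hyps(3)[of x i] by simp
      then show "norm \<bar>s i x - f x\<bar> \<le> 3 * \<bar>f x\<bar>" by simp
    qed
    show "(\<lambda>x. \<bar>s i x - f x\<bar>) \<in> borel_measurable lborel" for i using lim.hyps(1)[of i] lim.hyps(4) by measurable
  qed (use lim.hyps in auto)
  then have "\<forall>\<^sub>F i in sequentially. (\<integral>x. \<bar>s i x - f x\<bar> \<partial>lborel) < e / 3"
    using lim.prems by (intro order_tendstoD(2)) auto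
  then obtain i where i: "(\<integral>x. \<bar>s i x - f x\<bar> \<partial>lborel) < e / 3" by (auto simp: eventually_sequentially)
  obtain d where d: "d > 0" "\<And>h. norm h < d \<Longrightarrow> (\<integral>x. \<bar>s i (x - h) - s i x\<bar> \<partial>lborel) < e / 3"
    using lim.IH[of "e/3" i] lim.prems by auto
  have "(\<integral>x. \<bar>f (x - h) - f x\<bar> \<partial>lborel) < e" if h: "norm h < d" for h
  proof -
    have int: "integrable lborel (\<lambda>x. f (x - h))" "integrable lborel (\<lambda>x. s i (x - h))" "integrable lborel (s i)"
      using lim.hyps(1)[of i] lim.hyps(4) integral_translation_lborel(1)[of f "- h"] integral_translation_lborel(1)[of "s i" "- h"] by auto
    have "(\<integral>x. \<bar>f (x - h) - f x\<bar> \<partial>lborel) \<le> (\<integral>x. \<bar>s i (x - h) - f (x - h)\<bar> + \<bar>s i (x - h) - s i x\<bar> + \<bar>s i x - f x\<bar> \<partial>lborel)"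
      using int lim.hyps(4) by (intro integral_mono) auto
    also have "\<dots> = (\<integral>x. \<bar>s i (x - h) - f (x - h)\<bar> \<partial>lborel) + (\<integral>x. \<bar>s i (x - h) - s i x\<bar> \<partial>lborel) + (\<integral>x. \<bar>s i x - f x\<bar> \<partial>lborel)"
      using int lim.hyps(4) by simp
    also have "(\<integral>x. \<bar>s i (x - h) - f (x - h)\<bar> \<partial>lborel) = (\<integral>x. \<bar>s i x - f x\<bar> \<partial>lborel)"
      using integral_translation_lborel(2)[of "\<lambda>x. \<bar>s i x - f x\<bar>" "- h"] int(3) lim.hyps(4) by simp
    finally show ?thesis using i d(2)[OF h] by linarith
  qed
  then show ?case using d(1) by blast
qed

definition l2_continuous_translation :: "('a::euclidean_space \<Rightarrow> 'b::euclidean_space) \<Rightarrow> bool" where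
  "l2_continuous_translation u \<longleftrightarrow> (\<forall>e>0. \<exists>d>0. \<forall>h. norm h < d \<longrightarrow> l2 lborel (\<lambda>x. u (x - h) - u x) < e)"

lemma sq_int_translation:
  assumes "sq_int lborel u"
  shows "sq_int lborel (\<lambda>x. u (x - h))"
  using assms integral_translation_lborel(1)[of "\<lambda>x. (norm (u x))\<^sup>2" "- h"]
  unfolding sq_int_def by auto

text \<open>
  For nonnegative numbers \<open>(a - b)\<^sup>2 \<le> |a\<^sup>2 - b\<^sup>2|\<close>, which reduces the claim to the continuity
  of translations in \<open>L\<^sup>1\<close> for \<open>f\<^sup>2\<close>.
\<close>

lemma l2_translation_nonneg:
  fixes f :: "'a::euclidean_space \<Rightarrow> real"
  assumes f: "sq_int lborel f" and nn: "\<And>x. f x \<ge> 0"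
  shows "l2_continuous_translation f"
  unfolding l2_continuous_translation_def
proof (intro allI impI)
  fix e :: real assume e: "e > 0"
  have i: "integrable lborel (\<lambda>x. (f x)\<^sup>2)" using f by (simp add: sq_int_def)
  have i': "integrable lborel (\<lambda>x. (f (x - h))\<^sup>2)" for h using sq_int_translation[OF f, of h] by (simp add: sq_int_def)
  obtain d where d: "d > 0" "\<And>h. norm h < d \<Longrightarrow> (\<integral>x. \<bar>(f (x - h))\<^sup>2 - (f x)\<^sup>2\<bar> \<partial>lborel) < e\<^sup>2"
    using l1_translation[OF i, of "e\<^sup>2"] e by auto
  have "l2 lborel (\<lambda>x. f (x - h) - f x) < e" if h: "norm h < d" for h
  proof (rule power_less_imp_less_base)
    have pt: "(a - b)\<^sup>2 \<le> \<bar>a\<^sup>2 - b\<^sup>2\<bar>" if "a \<ge> 0" "b \<ge> 0" for a b :: real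
    proof -
      have "(a - b)\<^sup>2 = \<bar>a - b\<bar> * \<bar>a - b\<bar>" by (simp add: power2_eq_square)
      also have "\<dots> \<le> \<bar>a - b\<bar> * \<bar>a + b\<bar>" using that by (intro mult_left_mono) auto
      also have "\<dots> = \<bar>a\<^sup>2 - b\<^sup>2\<bar>" by (simp add: abs_mult[symmetric] power2_eq_square algebra_simps)
      finally show ?thesis .
    qed
    have "(l2 lborel (\<lambda>x. f (x - h) - f x))\<^sup>2 \<le> (\<integral>x. \<bar>(f (x - h))\<^sup>2 - (f x)\<^sup>2\<bar> \<partial>lborel)"
      unfolding l2_power2 using sq_int_diff[OF sq_int_translation[OF f, of h] f] i i'[of h]
      by (intro integral_mono) (auto simp: sq_int_def intro!: pt nn)
    then show "(l2 lborel (\<lambda>x. f (x - h) - f x))\<^sup>2 < e\<^sup>2" using d(2)[OF h] by simp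
  qed (use e in simp)
  then show "\<exists>d>0. \<forall>h. norm h < d \<longrightarrow> l2 lborel (\<lambda>x. f (x - h) - f x) < e" using d(1) by blast
qed

lemma l2_continuous_translation_add:
  assumes "sq_int lborel u" "sq_int lborel v" "l2_continuous_translation u" "l2_continuous_translation v"
  shows "l2_continuous_translation (\<lambda>x. u x + v x)"
  unfolding l2_continuous_translation_def
proof (intro allI impI)
  fix e :: real assume e: "e > 0"
  obtain d1 where d1: "d1 > 0" "\<And>h. norm h < d1 \<Longrightarrow> l2 lborel (\<lambda>x. u (x - h) - u x) < e / 2"
    using assms(3) e unfolding l2_continuous_translation_def by (metis half_gt_zero)
  obtain d2 where d2: "d2 > 0" "\<And>h. norm h < d2 \<Longrightarrow> l2 lborel (\<lambda>x. v (x - h) - v x) < e / 2"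
    using assms(4) e unfolding l2_continuous_translation_def by (metis half_gt_zero)
  have "l2 lborel (\<lambda>x. u (x - h) + v (x - h) - (u x + v x)) < e" if h: "norm h < min d1 d2" for h
  proof -
    have "l2 lborel (\<lambda>x. (u (x - h) - u x) + (v (x - h) - v x)) \<le> l2 lborel (\<lambda>x. u (x - h) - u x) + l2 lborel (\<lambda>x. v (x - h) - v x)"
      by (intro l2_triangle sq_int_diff sq_int_translation assms)
    then show ?thesis using d1(2)[of h] d2(2)[of h] h by (simp add: algebra_simps)
  qed
  then show "\<exists>d>0. \<forall>h. norm h < d \<longrightarrow> l2 lborel (\<lambda>x. u (x - h) + v (x - h) - (u x + v x)) < e"
    using d1(1) d2(1) by (intro exI[of _ "min d1 d2"]) auto
qed

lemma l2_continuous_translation_factor: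
  fixes f :: "'a::euclidean_space \<Rightarrow> real" and c :: "'b::euclidean_space"
  assumes "l2_continuous_translation f"
  shows "l2_continuous_translation (\<lambda>x. f x *\<^sub>R c)"
  unfolding l2_continuous_translation_def
proof (intro allI impI)
  fix e :: real assume e: "e > 0"
  have c: "norm c + 1 > 0" by (simp add: add_nonneg_pos)
  then obtain d where d: "d > 0" "\<And>h. norm h < d \<Longrightarrow> l2 lborel (\<lambda>x. f (x - h) - f x) < e / (norm c + 1)"
    using assms e unfolding l2_continuous_translation_def by (meson divide_pos_pos)
  have "l2 lborel (\<lambda>x. f (x - h) *\<^sub>R c - f x *\<^sub>R c) < e" if h: "norm h < d" for h
  proof -
    have "l2 lborel (\<lambda>x. f (x - h) *\<^sub>R c - f x *\<^sub>R c) = l2 lborel (\<lambda>x. f (x - h) - f x) * norm c"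
      by (simp add: l2_def power_mult_distrib real_sqrt_mult flip: scaleR_left_diff_distrib)
    also have "\<dots> \<le> l2 lborel (\<lambda>x. f (x - h) - f x) * (norm c + 1)" by (intro mult_left_mono) auto
    also have "\<dots> < e" using d(2)[OF h] c by (simp add: pos_less_divide_eq)
    finally show ?thesis .
  qed
  then show "\<exists>d>0. \<forall>h. norm h < d \<longrightarrow> l2 lborel (\<lambda>x. f (x - h) *\<^sub>R c - f x *\<^sub>R c) < e" using d(1) by blast
qed

text \<open>
  A complex function is a combination of four nonnegative ones.
\<close>

lemma l2_translation:
  fixes u :: "'a::euclidean_space \<Rightarrow> complex"
  assumes u: "sq_int lborel u"
  shows "l2_continuous_translation u"
proof -
  note [measurable] = sq_int_measurable[OF u]
  have part: "sq_int lborel (\<lambda>x. p (u x) *\<^sub>R c)" "l2_continuous_translation (\<lambda>x. p (u x) *\<^sub>R c)"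
    if p: "\<And>z. 0 \<le> p z" "\<And>z. p z \<le> norm z" "p \<in> borel_measurable borel" for p :: "complex \<Rightarrow> real" and c :: complex
  proof -
    have pm: "(\<lambda>x. p (u x)) \<in> borel_measurable lborel" using p(3) by measurable
    have "sq_int lborel (\<lambda>x. p (u x))"
      by (rule sq_int_bound(1)[OF u pm, of 1]) (use p in auto)
    then have "l2_continuous_translation (\<lambda>x. p (u x))" by (intro l2_translation_nonneg p)
    then show "l2_continuous_translation (\<lambda>x. p (u x) *\<^sub>R c)" by (rule l2_continuous_translation_factor)
    show "sq_int lborel (\<lambda>x. p (u x) *\<^sub>R c)"
      by (rule sq_int_bound(1)[OF u, of _ "norm c"]) (use p pm in \<open>auto simp: mult.commute intro!: mult_left_mono\<close>)
  qed
  have eq: "u = (\<lambda>x. (max 0 (Re (u x)) *\<^sub>R 1 + max 0 (- Re (u x)) *\<^sub>R (- 1)) + (max 0 (Im (u x)) *\<^sub>R \<i> + max 0 (- Im (u x)) *\<^sub>R (- \<i>)))"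
    by (auto simp: fun_eq_iff complex_eq_iff max_def)
  note p1 = part[of "\<lambda>z. max 0 (Re z)" 1] and p2 = part[of "\<lambda>z. max 0 (- Re z)" "-1"]
    and p3 = part[of "\<lambda>z. max 0 (Im z)" \<i>] and p4 = part[of "\<lambda>z. max 0 (- Im z)" "-\<i>"]
  have n: "Re z \<le> norm z" "- Re z \<le> norm z" "Im z \<le> norm z" "- Im z \<le> norm z" for z
    using abs_Re_le_cmod[of z] abs_Im_le_cmod[of z] by linarith+
  show ?thesis
    by (subst eq) (intro l2_continuous_translation_add sq_int_add p1 p2 p3 p4; (simp add: n | measurable))
qed

text \<open>
  Jensen's inequality for the probability measure \<open>P\<close>, followed by Tonelli's theorem.
\<close>

lemma l2_average_translation:
  fixes u :: "'a::euclidean_space \<Rightarrow> complex" and P :: "'a measure"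
  assumes u: "sq_int lborel u" and P: "prob_space P" "sets P = sets borel"
    and supp: "AE z in P. norm z < d"
    and d: "\<And>z. norm z < d \<Longrightarrow> l2 lborel (\<lambda>x. u (x + z) - u x) \<le> e"
  shows "sq_int lborel (\<lambda>x. \<integral>z. u (x + z) \<partial>P)"
    and "l2 lborel (\<lambda>x. (\<integral>z. u (x + z) \<partial>P) - u x) \<le> e"
proof -
  interpret P: prob_space P by fact
  note [measurable_cong] = P(2)
  note [measurable] = sq_int_measurable[OF u, simplified]
  interpret pair: pair_sigma_finite lborel P ..
  let ?A = "\<lambda>x. (\<integral>z. u (x + z) \<partial>P)"
  have Am: "?A \<in> borel_measurable lborel" by measurable
  have e0: "e \<ge> 0"
  proof -
    have "\<exists>z. norm (z::'a) < d"
    proof (rule ccontr)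
      assume "\<not> ?thesis"
      then have "AE z in P. False" using supp by simp
      then show False using P.AE_False by simp
    qed
    then show ?thesis using d l2_nonneg order_trans by metis
  qed
  \<comment> \<open>If the right-hand side is infinite, the left-hand side may be a default value of the integral.\<close>
  have pt: "ennreal ((norm (?A x - u x))\<^sup>2) \<le> (\<integral>\<^sup>+z. ennreal ((norm (u (x + z) - u x))\<^sup>2) \<partial>P)" for x
  proof (cases "(\<integral>\<^sup>+z. ennreal ((norm (u (x + z) - u x))\<^sup>2) \<partial>P) < \<infinity>")
    case True
    have s: "sq_int P (\<lambda>z. u (x + z) - u x)"
      unfolding sq_int_def using True by (auto simp: integrable_iff_bounded)
    have one: "sq_int P (\<lambda>_. 1::real)" by (simp add: sq_int_def)
    have i: "integrable P (\<lambda>z. u (x + z) - u x)"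
      using sq_int_prod_integrable[OF s one] sq_int_measurable[OF s] by (simp add: integrable_norm_iff)
    then have "integrable P (\<lambda>z. (u (x + z) - u x) + u x)" by (rule Bochner_Integration.integrable_add) simp
    then have "integrable P (\<lambda>z. u (x + z))" by simp
    then have "norm (?A x - u x) = norm (\<integral>z. u (x + z) - u x \<partial>P)" by (simp add: P.prob_space)
    also have "\<dots> \<le> (\<integral>z. norm (u (x + z) - u x) * norm (1::real) \<partial>P)" by (simp only: norm_one mult_1_right integral_norm_bound)
    also have "\<dots> \<le> l2 P (\<lambda>z. u (x + z) - u x) * l2 P (\<lambda>_. 1::real)" by (rule cauchy_schwarz_l2[OF s one])
    also have "l2 P (\<lambda>_. 1::real) = 1" by (simp add: l2_def P.prob_space)
    finally have "(norm (?A x - u x))\<^sup>2 \<le> (l2 P (\<lambda>z. u (x + z) - u x))\<^sup>2" by (intro power_mono) auto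
    also have "\<dots> = (\<integral>z. (norm (u (x + z) - u x))\<^sup>2 \<partial>P)" by (simp add: l2_power2)
    finally have "ennreal ((norm (?A x - u x))\<^sup>2) \<le> ennreal (\<integral>z. (norm (u (x + z) - u x))\<^sup>2 \<partial>P)" by (rule ennreal_leI)
    also have "\<dots> = (\<integral>\<^sup>+z. ennreal ((norm (u (x + z) - u x))\<^sup>2) \<partial>P)"
      using s by (intro nn_integral_eq_integral[symmetric]) (auto simp: sq_int_def)
    finally show ?thesis .
  qed (auto simp: not_less top_unique)
  have "(\<integral>\<^sup>+x. ennreal ((norm (?A x - u x))\<^sup>2) \<partial>lborel) \<le> (\<integral>\<^sup>+x. \<integral>\<^sup>+z. ennreal ((norm (u (x + z) - u x))\<^sup>2) \<partial>P \<partial>lborel)"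
    by (intro nn_integral_mono pt)
  also have "\<dots> = (\<integral>\<^sup>+z. \<integral>\<^sup>+x. ennreal ((norm (u (x + z) - u x))\<^sup>2) \<partial>lborel \<partial>P)"
    by (rule pair.Fubini'[symmetric]) measurable
  also have "\<dots> \<le> (\<integral>\<^sup>+z. ennreal (e\<^sup>2) \<partial>P)"
  proof (rule nn_integral_mono_AE)
    show "AE z in P. (\<integral>\<^sup>+x. ennreal ((norm (u (x + z) - u x))\<^sup>2) \<partial>lborel) \<le> ennreal (e\<^sup>2)"
      using supp
    proof eventually_elim
      case (elim z)
      have "(\<integral>\<^sup>+x. ennreal ((norm (u (x + z) - u x))\<^sup>2) \<partial>lborel) = ennreal ((l2 lborel (\<lambda>x. u (x + z) - u x))\<^sup>2)"
        unfolding l2_power2 using sq_int_diff[OF sq_int_translation[OF u, of "- z"] u]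
        by (intro nn_integral_eq_integral) (auto simp: sq_int_def)
      also have "\<dots> \<le> ennreal (e\<^sup>2)" using d[OF elim] by (intro ennreal_leI power_mono) auto
      finally show ?case .
    qed
  qed
  also have "\<dots> = ennreal (e\<^sup>2)" by (simp add: P.emeasure_space_1)
  finally have fin: "(\<integral>\<^sup>+x. ennreal ((norm (?A x - u x))\<^sup>2) \<partial>lborel) \<le> ennreal (e\<^sup>2)" .
  have s: "sq_int lborel (\<lambda>x. ?A x - u x)"
    unfolding sq_int_def using fin Am
    by (auto simp: integrable_iff_bounded intro: le_less_trans)
  have "ennreal ((l2 lborel (\<lambda>x. ?A x - u x))\<^sup>2) \<le> ennreal (e\<^sup>2)"
    unfolding l2_power2 using fin nn_integral_eq_integral[OF sq_int_integrable[OF s]] by simp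
  then have "(l2 lborel (\<lambda>x. ?A x - u x))\<^sup>2 \<le> e\<^sup>2" by (simp add: ennreal_le_iff)
  then show "l2 lborel (\<lambda>x. ?A x - u x) \<le> e" using e0 by (rule power2_le_imp_le)
  show "sq_int lborel ?A" using sq_int_add[OF s u] by simp
qed

section \<open>Mollification\<close>

lemma l2_dominated:
  assumes w: "sq_int M w" and m: "\<And>n::nat. f n \<in> borel_measurable M"
    and b: "\<And>n. AE x in M. norm (f n x) \<le> norm (w x)"
    and lim: "AE x in M. (\<lambda>n. f n x) \<longlonglongrightarrow> 0"
  shows "(\<lambda>n. l2 M (f n)) \<longlonglongrightarrow> 0"
proof -
  have "(\<lambda>n. \<integral>x. (norm (f n x))\<^sup>2 \<partial>M) \<longlonglongrightarrow> (\<integral>x. 0 \<partial>M)"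
  proof (rule integral_dominated_convergence[where w="\<lambda>x. (norm (w x))\<^sup>2"])
    show "AE x in M. (\<lambda>n. (norm (f n x))\<^sup>2) \<longlonglongrightarrow> 0"
      using lim by eventually_elim (auto intro!: tendsto_eq_intros)
    show "AE x in M. norm ((norm (f n x))\<^sup>2) \<le> (norm (w x))\<^sup>2" for n
      using b[of n] by eventually_elim (simp add: power_mono)
    show "(\<lambda>x. (norm (f n x))\<^sup>2) \<in> borel_measurable M" for n using m[of n] by measurable
  qed (use w in \<open>auto simp: sq_int_def\<close>)
  then have "(\<lambda>n. sqrt (\<integral>x. (norm (f n x))\<^sup>2 \<partial>M)) \<longlonglongrightarrow> sqrt 0"
    by (intro tendsto_real_sqrt) simp
  then show ?thesis by (simp add: l2_def)
qed

lemma sq_int_vec_component: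
  fixes g :: "'a \<Rightarrow> complex ^ 'n"
  assumes "sq_int M g"
  shows "sq_int M (\<lambda>x. g x $ i)"
proof (rule sq_int_bound(1)[OF assms, of _ 1])
  show "(\<lambda>x. g x $ i) \<in> borel_measurable M"
    by (rule measurable_compose[OF sq_int_measurable[OF assms]])
       (intro borel_measurable_continuous_onI continuous_intros)
qed (auto intro!: AE_I2 Finite_Cartesian_Product.norm_nth_le)

text \<open>
  The notion of \<open>has_weak_gradient\<close> for \<open>lborel\<close>: the product of two Lebesgue measures is not
  complete, so Tonelli's theorem is applied to Borel functions.
\<close>

definition weak_grad :: "(real ^ 'n::finite \<Rightarrow> complex) \<Rightarrow> (real ^ 'n \<Rightarrow> complex ^ 'n) \<Rightarrow> bool" where
  "weak_grad u g \<longleftrightarrow> sq_int lborel u \<and> sq_int lborel g \<and>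
    (\<forall>i f. test_function f \<longrightarrow>
      (\<integral>x. u x * partial_derivative i f x \<partial>lborel) = - (\<integral>x. g x $ i * f x \<partial>lborel))"

definition c1_compact :: "(real ^ 'n::finite \<Rightarrow> complex) \<Rightarrow> (real ^ 'n \<Rightarrow> complex ^ 'n) \<Rightarrow> bool" where
  "c1_compact v Dv \<longleftrightarrow>
     (\<forall>x. (v has_derivative (\<lambda>h. \<Sum>i\<in>UNIV. of_real (h $ i) * Dv x $ i)) (at x)) \<and>
     continuous_on UNIV Dv \<and> (\<exists>R. \<forall>x. norm x \<ge> R \<longrightarrow> v x = 0)"

lemma vec_scaleR_axis_sum: "(\<Sum>i\<in>UNIV. (h $ i) *\<^sub>R axis i 1) = (h :: real ^ 'n)"
  using basis_expansion[of h] by (simp add: scalar_mult_eq_scaleR)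

definition kernel_mass :: "'a::euclidean_space itself \<Rightarrow> real \<Rightarrow> real" where
  "kernel_mass _ \<epsilon> = (\<integral>z. flat_exp 0 (\<epsilon>\<^sup>2 - (norm (z::'a))\<^sup>2) \<partial>lborel)"

lemma flat_exp_kernel_measurable [measurable]:
  "(\<lambda>y::'a::euclidean_space. flat_exp k (\<rho> - (norm (y - x))\<^sup>2)) \<in> borel_measurable borel"
  by (intro borel_measurable_continuous_onI continuous_on_compose2[OF flat_exp_continuous[of UNIV]] continuous_intros) auto

lemma flat_exp_kernel_eq_0: "norm z \<ge> \<epsilon> \<Longrightarrow> \<epsilon> > 0 \<Longrightarrow> flat_exp k (\<epsilon>\<^sup>2 - (norm z)\<^sup>2) = 0"
proof -
  assume "norm z \<ge> \<epsilon>" "\<epsilon> > 0"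
  then have "\<epsilon>\<^sup>2 \<le> (norm z)\<^sup>2" by (intro power_mono) auto
  then show ?thesis by (simp add: flat_exp_def)
qed

lemma integrable_flat_kernel: 
  assumes "\<epsilon> > 0"
  shows "integrable lborel (\<lambda>z::'a::euclidean_space. flat_exp 0 (\<epsilon>\<^sup>2 - (norm (z - x))\<^sup>2))"
proof (rule Bochner_Integration.integrable_bound)
  show "integrable lborel (indicator (cball x \<epsilon>) :: 'a \<Rightarrow> real)"
    by (simp add: integrable_indicator_iff emeasure_bounded_finite[OF bounded_cball, simplified])
  show "AE z in lborel. norm (flat_exp 0 (\<epsilon>\<^sup>2 - (norm (z - x))\<^sup>2)) \<le> norm (indicator (cball x \<epsilon>) z :: real)"
  proof (rule AE_I2)
    fix z
    show "norm (flat_exp 0 (\<epsilon>\<^sup>2 - (norm (z - x))\<^sup>2)) \<le> norm (indicator (cball x \<epsilon>) z :: real)"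
      using flat_exp_kernel_eq_0[OF _ assms, of "z - x" 0]
      by (cases "norm (z - x) \<ge> \<epsilon>") (simp_all add: flat_exp_nonneg flat_exp_0_le dist_norm norm_minus_commute)
  qed
qed measurable

lemma kernel_mass_pos:
  assumes "\<epsilon> > 0"
  shows "kernel_mass TYPE('a::euclidean_space) \<epsilon> > 0"
proof -
  have i: "integrable lborel (\<lambda>z::'a. flat_exp 0 (\<epsilon>\<^sup>2 - (norm z)\<^sup>2))"
    using integrable_flat_kernel[OF assms, of 0] by simp
  have "kernel_mass TYPE('a) \<epsilon> \<noteq> 0"
  proof
    assume "kernel_mass TYPE('a) \<epsilon> = 0"
    then have "AE z::'a in lborel. flat_exp 0 (\<epsilon>\<^sup>2 - (norm z)\<^sup>2) = 0"
      unfolding kernel_mass_def using i by (subst (asm) integral_nonneg_eq_0_iff_AE) (auto simp: flat_exp_nonneg)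
    then have "AE z::'a in lborel. z \<notin> ball 0 \<epsilon>"
      by eventually_elim (auto simp: flat_exp_def power_strict_mono split: if_splits)
    then have "ball (0::'a) \<epsilon> \<in> null_sets lborel"
      by (subst AE_iff_null_sets) auto
    then have "measure lborel (ball (0::'a) \<epsilon>) = 0" by (auto simp: null_sets_def measure_def)
    then show False using content_ball_pos[OF assms, of "0::'a"] by simp
  qed
  moreover have "kernel_mass TYPE('a) \<epsilon> \<ge> 0"
    unfolding kernel_mass_def by (simp add: flat_exp_nonneg)
  ultimately show ?thesis by simp
qed

text \<open>
  The kernel is an even function of \<open>y - x\<close>; as a function of \<open>y\<close> it belongs to \<open>smooth_algebra\<close>.
\<close>

definition mollify :: "real \<Rightarrow> ('a::euclidean_space \<Rightarrow> complex) \<Rightarrow> 'a \<Rightarrow> complex" where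
  "mollify \<epsilon> U x = (\<integral>y. of_real (flat_exp 0 (\<epsilon>\<^sup>2 - (norm (y - x))\<^sup>2)) * U y \<partial>lborel) / of_real (kernel_mass TYPE('a) \<epsilon>)"

text \<open>
  Mollification is an average of translates, so that continuity of translations gives its
  convergence in \<open>L\<^sup>2\<close>.
\<close>

lemma mollify_average:
  fixes U :: "'a::euclidean_space \<Rightarrow> complex"
  assumes \<epsilon>: "\<epsilon> > 0" and U: "U \<in> borel_measurable borel"
  obtains P where "prob_space P" "sets P = sets (borel :: 'a measure)" "AE z in P. norm z < \<epsilon>"
    "\<And>x. mollify \<epsilon> U x = (\<integral>z. U (x + z) \<partial>P)"
proof -
  let ?m = "kernel_mass TYPE('a) \<epsilon>"
  let ?k = "\<lambda>z::'a. flat_exp 0 (\<epsilon>\<^sup>2 - (norm z)\<^sup>2) / ?m"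
  note m = kernel_mass_pos[OF \<epsilon>, where 'a='a]
  have km[measurable]: "(\<lambda>z::'a. flat_exp 0 (\<epsilon>\<^sup>2 - (norm z)\<^sup>2)) \<in> borel_measurable borel"
    using flat_exp_kernel_measurable[of 0 "\<epsilon>\<^sup>2" 0] by simp
  note U[measurable]
  define P where "P = density lborel (\<lambda>z. ennreal (?k z))"
  have "prob_space P"
  proof
    have "emeasure P (space P) = (\<integral>\<^sup>+z. ennreal (?k z) \<partial>lborel)"
      by (simp add: P_def emeasure_density)
    also have "\<dots> = ennreal (\<integral>z. ?k z \<partial>lborel)"
      using integrable_flat_kernel[OF \<epsilon>, of "0::'a"] m by (intro nn_integral_eq_integral) (auto simp: flat_exp_nonneg)
    also have "(\<integral>z. ?k z \<partial>lborel) = 1" using m by (simp add: kernel_mass_def)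
    finally show "emeasure P (space P) = 1" by simp
  qed
  moreover have "sets P = sets borel" by (simp add: P_def)
  moreover have "AE z in P. norm z < \<epsilon>"
    unfolding P_def
  proof (subst AE_density)
    have kz: "norm z < \<epsilon>" if "0 < ?k z" for z
      using that flat_exp_kernel_eq_0[OF _ \<epsilon>, of z 0] by (cases "norm z < \<epsilon>") auto
    then show "AE z in lborel. 0 < ennreal (?k z) \<longrightarrow> norm z < \<epsilon>" by (auto intro!: AE_I2 kz)
  qed measurable
  moreover have "mollify \<epsilon> U x = (\<integral>z. U (x + z) \<partial>P)" for x
  proof -
    have "(\<integral>z. U (x + z) \<partial>P) = (\<integral>z. ?k z *\<^sub>R U (x + z) \<partial>lborel)"
      unfolding P_def using m by (intro integral_density) (auto simp: flat_exp_nonneg)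
    also have "\<dots> = (\<integral>z. (\<lambda>y. ?k (y - x) *\<^sub>R U y) (z + x) \<partial>lborel)" by (simp add: add.commute)
    also have "\<dots> = (\<integral>y. ?k (y - x) *\<^sub>R U y \<partial>lborel)"
      by (rule integral_translation_lborel(2)) measurable
    also have "\<dots> = (\<integral>y. of_real (flat_exp 0 (\<epsilon>\<^sup>2 - (norm (y - x))\<^sup>2)) * U y / of_real ?m \<partial>lborel)"
      by (simp add: scaleR_conv_of_real)
    also have "\<dots> = mollify \<epsilon> U x" by (simp add: mollify_def)
    finally show ?thesis by simp
  qed
  ultimately show thesis by (rule that)
qed

lemma mollify_l2_tendsto:
  fixes U :: "'a::euclidean_space \<Rightarrow> complex"
  assumes U: "sq_int lborel U"
  shows "\<And>\<epsilon>. \<epsilon> > 0 \<Longrightarrow> sq_int lborel (mollify \<epsilon> U)"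
    and "\<And>e. e > 0 \<Longrightarrow> \<exists>d>0. \<forall>\<epsilon>. 0 < \<epsilon> \<and> \<epsilon> < d \<longrightarrow> l2 lborel (\<lambda>x. mollify \<epsilon> U x - U x) \<le> e"
proof -
  have Um: "U \<in> borel_measurable borel" using sq_int_measurable[OF U] by simp
  show "sq_int lborel (mollify \<epsilon> U)" if \<epsilon>: "\<epsilon> > 0" for \<epsilon>
  proof -
    obtain P where P: "prob_space P" "sets P = sets (borel :: 'a measure)" "AE z in P. norm z < \<epsilon>"
      "\<And>x. mollify \<epsilon> U x = (\<integral>z. U (x + z) \<partial>P)" using mollify_average[OF \<epsilon> Um] by blast
    have "l2 lborel (\<lambda>x. U (x + z) - U x) \<le> 2 * l2 lborel U" for z
    proof -
      have "l2 lborel (\<lambda>x. U (x + z)) = l2 lborel U"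
        unfolding l2_def using integral_translation_lborel(2)[of "\<lambda>x. (norm (U x))\<^sup>2" z] Um by simp
      then show ?thesis
        using l2_triangle[OF sq_int_translation[OF U, of "- z"] sq_int_scaleR[OF U, of "-1"]]
        by (simp add: l2_scaleR[of lborel "-1" U, simplified])
    qed
    from l2_average_translation(1)[OF U P(1-3) this]
    show ?thesis by (simp add: P(4)[abs_def])
  qed
  show "\<exists>d>0. \<forall>\<epsilon>. 0 < \<epsilon> \<and> \<epsilon> < d \<longrightarrow> l2 lborel (\<lambda>x. mollify \<epsilon> U x - U x) \<le> e" if e: "e > 0" for e
  proof -
    obtain d where d: "d > 0" "\<And>h. norm h < d \<Longrightarrow> l2 lborel (\<lambda>x. U (x - h) - U x) < e"
      using l2_translation[OF U] e unfolding l2_continuous_translation_def by blast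
    have "l2 lborel (\<lambda>x. mollify \<epsilon> U x - U x) \<le> e" if \<epsilon>: "0 < \<epsilon>" "\<epsilon> < d" for \<epsilon>
    proof -
      obtain P where P: "prob_space P" "sets P = sets (borel :: 'a measure)" "AE z in P. norm z < \<epsilon>"
        "\<And>x. mollify \<epsilon> U x = (\<integral>z. U (x + z) \<partial>P)" using mollify_average[OF \<epsilon>(1) Um] by blast
      have "l2 lborel (\<lambda>x. U (x + z) - U x) \<le> e" if "norm z < \<epsilon>" for z
        using d(2)[of "- z"] that \<epsilon>(2) by simp
      from l2_average_translation(2)[OF U P(1-3) this] show ?thesis by (simp add: P(4))
    qed
    then show ?thesis using d(1) by blast
  qed
qed

lemma sq_int_compact_integrable:
  fixes U :: "'a::euclidean_space \<Rightarrow> complex"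
  assumes U: "sq_int lborel U" and supp: "\<And>x. norm x \<ge> R \<Longrightarrow> U x = 0"
  shows "integrable lborel U"
proof -
  note [measurable] = sq_int_measurable[OF U]
  have "sq_int lborel (indicator (cball 0 R) :: 'a \<Rightarrow> real)"
    using emeasure_bounded_finite[OF bounded_cball, of "0::'a" R]
    by (auto simp: sq_int_def integrable_indicator_iff power2_eq_square simp flip: indicator_inter_arith intro!: borel_measurable_indicator)
  from sq_int_prod_integrable[OF U this]
  have "integrable lborel (\<lambda>x. norm (U x) * norm (indicator (cball 0 R) x :: real))" .
  moreover have "(\<lambda>x. norm (U x) * norm (indicator (cball 0 R) x :: real)) = (\<lambda>x. norm (U x))"
    using supp by (auto simp: indicator_def fun_eq_iff)
  ultimately have "integrable lborel (\<lambda>x. norm (U x))" by (simp only:)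
  then show ?thesis by (simp add: integrable_norm_iff)
qed

lemma bump_grad_bound:
  fixes z :: "'a::real_inner"
  assumes "\<epsilon> > 0"
  shows "norm (bump_grad 0 (\<epsilon>\<^sup>2) z) \<le> 4 * \<epsilon>" "norm (bump_grad 0 (\<epsilon>\<^sup>2) z) \<le> 4 * norm z"
proof -
  have eq: "norm (bump_grad 0 (\<epsilon>\<^sup>2) z) = 2 * flat_exp 2 (\<epsilon>\<^sup>2 - (norm z)\<^sup>2) * norm z"
    by (simp add: bump_grad_def abs_mult flat_exp_nonneg numeral_2_eq_2)
  show *: "norm (bump_grad 0 (\<epsilon>\<^sup>2) z) \<le> 4 * norm z"
    unfolding eq using flat_exp_2_le[of "\<epsilon>\<^sup>2 - (norm z)\<^sup>2"] by (intro mult_right_mono) auto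
  show "norm (bump_grad 0 (\<epsilon>\<^sup>2) z) \<le> 4 * \<epsilon>"
  proof (cases "norm z \<ge> \<epsilon>")
    case True
    then show ?thesis unfolding eq using flat_exp_kernel_eq_0[OF True assms, of 2] assms by simp
  next
    case False
    then show ?thesis using * by simp
  qed
qed

lemma bump_grad_measurable [measurable]:
  "(\<lambda>y::'a::euclidean_space. bump_grad k \<rho> (y - x)) \<in> borel_measurable borel"
  unfolding bump_grad_def by measurable

lemma mollify_has_derivative:
  fixes U :: "'a::euclidean_space \<Rightarrow> complex"
  assumes \<epsilon>: "\<epsilon> > 0" and U: "integrable lborel U"
  shows "(mollify \<epsilon> U has_derivative
     (\<lambda>h. - (\<integral>y. of_real (bump_grad 0 (\<epsilon>\<^sup>2) (y - x) \<bullet> h) * U y \<partial>lborel) / of_real (kernel_mass TYPE('a) \<epsilon>))) (at x)"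
proof -
  note [measurable] = borel_measurable_integrable[OF U]
  have "((\<lambda>x. \<integral>y. of_real (flat_exp 0 (\<epsilon>\<^sup>2 - (norm (y - x))\<^sup>2)) * U y \<partial>lborel) has_derivative
     (\<lambda>h. \<integral>y. of_real (- (bump_grad 0 (\<epsilon>\<^sup>2) (y - x) \<bullet> h)) * U y \<partial>lborel)) (at x)"
  proof (rule has_derivative_integral_dominated[where r=1 and B="\<lambda>y. 4 * \<epsilon> * norm (U y)"])
    fix p y h :: 'a
    show "integrable lborel (\<lambda>y. of_real (flat_exp 0 (\<epsilon>\<^sup>2 - (norm (y - p))\<^sup>2)) * U y)"
      by (rule Bochner_Integration.integrable_bound[OF U])
         (auto simp: norm_mult flat_exp_nonneg intro!: AE_I2 mult_left_le_one_le flat_exp_0_le)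
    have "((\<lambda>p. flat_exp 0 (\<epsilon>\<^sup>2 - (norm (p - y))\<^sup>2)) has_derivative (\<lambda>h. bump_grad 0 (\<epsilon>\<^sup>2) (p - y) \<bullet> h)) (at p)"
      by (rule bump_has_derivative)
    then have "((\<lambda>p. flat_exp 0 (\<epsilon>\<^sup>2 - (norm (y - p))\<^sup>2)) has_derivative (\<lambda>h. - (bump_grad 0 (\<epsilon>\<^sup>2) (y - p) \<bullet> h))) (at p)"
      by (simp add: norm_minus_commute bump_grad_def inner_simps algebra_simps)
    then show "((\<lambda>p. of_real (flat_exp 0 (\<epsilon>\<^sup>2 - (norm (y - p))\<^sup>2)) * U y) has_derivative (\<lambda>h. of_real (- (bump_grad 0 (\<epsilon>\<^sup>2) (y - p) \<bullet> h)) * U y)) (at p)"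
      by (intro has_derivative_mult_left has_derivative_of_real)
    have "\<bar>bump_grad 0 (\<epsilon>\<^sup>2) (y - p) \<bullet> h\<bar> \<le> norm (bump_grad 0 (\<epsilon>\<^sup>2) (y - p)) * norm h" by (rule Cauchy_Schwarz_ineq2)
    also have "\<dots> \<le> 4 * \<epsilon> * norm h" by (intro mult_right_mono bump_grad_bound(1) \<epsilon>) auto
    finally have "\<bar>bump_grad 0 (\<epsilon>\<^sup>2) (y - p) \<bullet> h\<bar> * norm (U y) \<le> (4 * \<epsilon> * norm h) * norm (U y)" by (intro mult_right_mono) auto
    then show "norm (of_real (- (bump_grad 0 (\<epsilon>\<^sup>2) (y - p) \<bullet> h)) * U y) \<le> 4 * \<epsilon> * norm (U y) * norm h"
      by (simp add: norm_mult mult_ac del: of_real_minus)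
  qed (use U \<epsilon> in auto)
  then have "((\<lambda>x. (\<integral>y. of_real (flat_exp 0 (\<epsilon>\<^sup>2 - (norm (y - x))\<^sup>2)) * U y \<partial>lborel) / of_real (kernel_mass TYPE('a) \<epsilon>)) has_derivative
     (\<lambda>h. (\<integral>y. of_real (- (bump_grad 0 (\<epsilon>\<^sup>2) (y - x) \<bullet> h)) * U y \<partial>lborel) / of_real (kernel_mass TYPE('a) \<epsilon>))) (at x)"
    unfolding divide_inverse by (rule has_derivative_mult_left)
  then show ?thesis by (simp add: mollify_def[abs_def])
qed


section \<open>Density of smooth functions\<close>

lemma flat_exp_0_at_top: "(flat_exp 0 \<longlongrightarrow> 1) at_top"
proof -
  have "((\<lambda>s::real. exp (- inverse s)) \<longlongrightarrow> exp (- 0)) at_top"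
    by (intro tendsto_intros tendsto_inverse_0_at_top filterlim_ident)
  moreover have "\<forall>\<^sub>F s in at_top. exp (- inverse s) = flat_exp 0 (s::real)"
    using eventually_gt_at_top[of "0::real"] by eventually_elim (simp add: flat_exp_def)
  ultimately show ?thesis by (auto intro: Lim_transform_eventually)
qed

lemma flat_exp_Suc_at_top: "(flat_exp (Suc k) \<longlongrightarrow> 0) at_top"
proof -
  have "((\<lambda>s::real. exp (- inverse s) * inverse s ^ Suc k) \<longlongrightarrow> exp (- 0) * 0 ^ Suc k) at_top"
    by (intro tendsto_intros tendsto_inverse_0_at_top filterlim_ident)
  moreover have "\<forall>\<^sub>F s in at_top. exp (- inverse s) * inverse s ^ Suc k = flat_exp (Suc k) (s::real)"
    using eventually_gt_at_top[of "0::real"] by eventually_elim (simp add: flat_exp_def)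
  ultimately show ?thesis by (auto intro: Lim_transform_eventually)
qed

lemma filterlim_square_minus_const: "filterlim (\<lambda>n. (real (Suc n))\<^sup>2 - c) at_top sequentially"
  by real_asymp

text \<open>
  The cutoff tends to \<open>1\<close> as \<open>R\<close> grows, and its gradient is bounded by \<open>4 |y|\<close> for all \<open>R\<close>. The error
  that it causes in the gradient of \<open>u\<close> is therefore dominated by \<open>4 |y| |u(y)|\<close>, which is square
  integrable for \<open>u\<close> in \<open>\<Sigma>\<close>.
\<close>

definition cut_function :: "real \<Rightarrow> (real ^ 'n::finite \<Rightarrow> complex) \<Rightarrow> real ^ 'n \<Rightarrow> complex" where
  "cut_function R u y = of_real (flat_exp 0 (R\<^sup>2 - (norm y)\<^sup>2)) * u y"

text \<open>
  The product rule for \<open>cut_function R u\<close>.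
\<close>

definition cut_gradient :: "real \<Rightarrow> (real ^ 'n::finite \<Rightarrow> complex) \<Rightarrow> (real ^ 'n \<Rightarrow> complex ^ 'n) \<Rightarrow> 'n \<Rightarrow> real ^ 'n \<Rightarrow> complex" where
  "cut_gradient R u g i y = of_real (flat_exp 0 (R\<^sup>2 - (norm y)\<^sup>2)) * (g y $ i) + of_real (bump_grad 0 (R\<^sup>2) y $ i) * u y"

lemma flat_exp_measurable0 [measurable]:
  "(\<lambda>y::'a::euclidean_space. flat_exp k (\<rho> - (norm y)\<^sup>2)) \<in> borel_measurable borel"
  using flat_exp_kernel_measurable[of k \<rho> 0] by simp

lemma vec_nth_measurable [measurable]: "(\<lambda>y::real^'n::finite. y $ i) \<in> borel_measurable borel"
  by (intro borel_measurable_continuous_onI continuous_intros)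

lemma vec_nth_measurable_complex [measurable]: "(\<lambda>y::complex^'n::finite. y $ i) \<in> borel_measurable borel"
  by (intro borel_measurable_continuous_onI continuous_intros)

lemma bump_grad_measurable0 [measurable]:
  "(\<lambda>y::'a::euclidean_space. bump_grad k \<rho> y) \<in> borel_measurable borel"
  using bump_grad_measurable[of k \<rho> 0] by simp

lemma sq_int_cut:
  assumes "weak_grad u g" "R > 0"
  shows "sq_int lborel (cut_function R u)" "sq_int lborel (cut_gradient R u g i)"
    "norm y \<ge> R \<Longrightarrow> cut_function R u y = 0" "norm y \<ge> R \<Longrightarrow> cut_gradient R u g i y = 0"
proof -
  have u: "sq_int lborel u" and g: "sq_int lborel (\<lambda>x. g x $ i)"
    using assms by (auto simp: weak_grad_def intro: sq_int_vec_component)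
  have [measurable]: "u \<in> borel_measurable borel" "(\<lambda>x. g x $ i) \<in> borel_measurable borel"
    using sq_int_measurable[OF u] sq_int_measurable[OF g] by simp_all
  have c: "norm (of_real (flat_exp 0 t) * z :: complex) \<le> 1 * norm z" for t z
    unfolding norm_mult by (intro mult_right_mono) (auto simp: flat_exp_nonneg flat_exp_0_le)
  have b: "norm (of_real (bump_grad 0 (R\<^sup>2) y $ i) * z :: complex) \<le> (4 * R) * norm z" for y :: "real^'a" and z
    unfolding norm_mult using order_trans[OF component_le_norm_cart bump_grad_bound(1)[OF assms(2), of y]]
    by (intro mult_right_mono) (auto simp: real_norm_def inner_axis)
  show "sq_int lborel (cut_function R u)" unfolding cut_function_def
    by (rule sq_int_bound(1)[OF u, of _ 1]) (use c in \<open>auto intro!: AE_I2\<close>)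
  show "sq_int lborel (cut_gradient R u g i)" unfolding cut_gradient_def
  proof (rule sq_int_add)
    show "sq_int lborel (\<lambda>y. of_real (flat_exp 0 (R\<^sup>2 - (norm y)\<^sup>2)) * (g y $ i))"
      by (rule sq_int_bound(1)[OF g, of _ 1]) (use c in \<open>auto intro!: AE_I2\<close>)
    show "sq_int lborel (\<lambda>y. of_real (bump_grad 0 (R\<^sup>2) y $ i) * u y)"
      by (rule sq_int_bound(1)[OF u, of _ "4 * R"]) (use b in \<open>auto intro!: AE_I2\<close>)
  qed
  show "norm y \<ge> R \<Longrightarrow> cut_function R u y = 0"
    using flat_exp_kernel_eq_0[OF _ assms(2), of y] by (simp add: cut_function_def)
  show "norm y \<ge> R \<Longrightarrow> cut_gradient R u g i y = 0"
    using flat_exp_kernel_eq_0[OF _ assms(2), of y] by (simp add: cut_gradient_def bump_grad_def)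
qed

text \<open>
  The product of cutoff and kernel is a test function. The definition of the weak gradient, applied
  to it, moves the derivative from the kernel to \<open>u\<close>: the gradient of the mollified function is the
  mollification of the weak gradient.
\<close>

lemma weak_grad_against_kernel:
  fixes u :: "real ^ 'n::finite \<Rightarrow> complex"
  assumes wg: "weak_grad u g" and R: "R > 0" and \<epsilon>: "\<epsilon> > 0"
  shows "(\<integral>y. of_real (bump_grad 0 (\<epsilon>\<^sup>2) (y - x) \<bullet> axis i 1) * cut_function R u y \<partial>lborel)
       = - (\<integral>y. of_real (flat_exp 0 (\<epsilon>\<^sup>2 - (norm (y - x))\<^sup>2)) * cut_gradient R u g i y \<partial>lborel)"
proof -
  define \<xi> where "\<xi> y = (of_real (flat_exp 0 (R\<^sup>2 - (norm (y - 0))\<^sup>2)) :: complex)" for y :: "real^'n"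
  define \<eta> where "\<eta> y = (of_real (flat_exp 0 (\<epsilon>\<^sup>2 - (norm (y - x))\<^sup>2)) :: complex)" for y
  define d where "d y = (of_real (bump_grad 0 (R\<^sup>2) (y - 0) \<bullet> axis i 1) :: complex)" for y :: "real^'n"
  define e where "e y = (of_real (bump_grad 0 (\<epsilon>\<^sup>2) (y - x) \<bullet> axis i 1) :: complex)" for y
  have test: "test_function (\<lambda>y. \<xi> y * \<eta> y)"
  proof (rule smooth_algebra_test_function)
    show "(\<lambda>y. \<xi> y * \<eta> y) \<in> smooth_algebra"
      unfolding \<xi>_def \<eta>_def by (intro smooth_algebra.mult smooth_algebra.bump)
    have "norm y \<le> R" if "\<xi> y \<noteq> 0" for y
      using that flat_exp_kernel_eq_0[OF _ R, of y 0] by (cases "norm y \<le> R") (auto simp: \<xi>_def)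
    then have "{y. \<xi> y * \<eta> y \<noteq> 0} \<subseteq> cball 0 R" by auto
    then show "bounded {y. \<xi> y * \<eta> y \<noteq> 0}" using bounded_subset bounded_cball by blast
  qed
  have pd: "partial_derivative i (\<lambda>y. \<xi> y * \<eta> y) y = \<xi> y * e y + d y * \<eta> y" for y
    unfolding \<xi>_def \<eta>_def d_def e_def
    by (rule partial_derivative_eq) (rule has_derivative_mult has_derivative_of_real bump_has_derivative)+
  have U: "sq_int lborel (cut_function R u)" and G: "sq_int lborel (cut_gradient R u g i)"
    by (rule sq_int_cut[OF wg R])+
  have Ui: "integrable lborel (cut_function R u)" and Gi: "integrable lborel (cut_gradient R u g i)"
    using sq_int_compact_integrable[OF U] sq_int_compact_integrable[OF G] sq_int_cut(3,4)[OF wg R] by blast+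
  have um: "sq_int lborel u" and gm: "sq_int lborel (\<lambda>x. g x $ i)" using wg by (auto simp: weak_grad_def intro: sq_int_vec_component)
  have [measurable]: "u \<in> borel_measurable borel" "(\<lambda>x. g x $ i) \<in> borel_measurable borel"
    using sq_int_measurable[OF um] sq_int_measurable[OF gm] by simp_all
  have \<eta>m[measurable]: "\<eta> \<in> borel_measurable borel" and em[measurable]: "e \<in> borel_measurable borel"
    unfolding \<eta>_def e_def by measurable
  have \<eta>b: "norm (\<eta> y) \<le> 1" for y by (simp add: \<eta>_def flat_exp_nonneg flat_exp_0_le)
  have eb: "norm (e y) \<le> 4 * \<epsilon>" for y
    using order_trans[OF component_le_norm_cart bump_grad_bound(1)[OF \<epsilon>, of "y - x"]] by (simp add: e_def inner_axis real_norm_def)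
  have i1: "integrable lborel (\<lambda>y. e y * cut_function R u y)"
    by (rule Bochner_Integration.integrable_bound[OF integrable_mult_right[OF Ui, of "of_real (4 * \<epsilon>)"]])
       (use eb \<epsilon> Ui in \<open>auto simp: norm_mult intro!: AE_I2 mult_right_mono\<close>)
  have i2: "integrable lborel (\<lambda>y. \<eta> y * cut_gradient R u g i y)"
    by (rule Bochner_Integration.integrable_bound[OF Gi])
       (use \<eta>b Gi in \<open>auto simp: norm_mult intro!: AE_I2 mult_left_le_one_le\<close>)
  have gi: "integrable lborel (\<lambda>y. g y $ i * (\<xi> y * \<eta> y))"
  proof (rule sq_int_compact_integrable[where R=R])
    have "norm (\<xi> y * \<eta> y) \<le> 1" for y using \<eta>b by (auto simp: norm_mult \<xi>_def flat_exp_nonneg flat_exp_0_le intro!: mult_le_one)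
    then show "sq_int lborel (\<lambda>y. g y $ i * (\<xi> y * \<eta> y))"
      by (intro sq_int_bound(1)[OF gm, of _ 1]) (auto simp: norm_mult[of "g _ $ i"] \<xi>_def intro!: AE_I2 mult_left_le)
    show "norm y \<ge> R \<Longrightarrow> g y $ i * (\<xi> y * \<eta> y) = 0" for y
      using flat_exp_kernel_eq_0[OF _ R, of y 0] by (simp add: \<xi>_def)
  qed
  have "(\<integral>y. u y * partial_derivative i (\<lambda>y. \<xi> y * \<eta> y) y \<partial>lborel) = - (\<integral>y. g y $ i * (\<xi> y * \<eta> y) \<partial>lborel)"
    using wg test by (simp add: weak_grad_def)
  moreover have "u y * partial_derivative i (\<lambda>y. \<xi> y * \<eta> y) y = e y * cut_function R u y + (\<eta> y * cut_gradient R u g i y - g y $ i * (\<xi> y * \<eta> y))" for y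
    unfolding pd by (simp add: cut_function_def cut_gradient_def \<xi>_def d_def inner_axis algebra_simps)
  ultimately have "(\<integral>y. e y * cut_function R u y \<partial>lborel) + ((\<integral>y. \<eta> y * cut_gradient R u g i y \<partial>lborel) - (\<integral>y. g y $ i * (\<xi> y * \<eta> y) \<partial>lborel)) = - (\<integral>y. g y $ i * (\<xi> y * \<eta> y) \<partial>lborel)"
    using i1 i2 gi by simp
  then show ?thesis by (simp add: e_def \<eta>_def eq_neg_iff_add_eq_0)
qed

lemma c1_compact_mollify_cut:
  fixes u :: "real ^ 'n::finite \<Rightarrow> complex"
  assumes wg: "weak_grad u g" and R: "R > 0" and \<epsilon>: "\<epsilon> > 0"
  shows "c1_compact (mollify \<epsilon> (cut_function R u)) (\<lambda>x. \<chi> i. mollify \<epsilon> (cut_gradient R u g i) x)"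
    and "norm x \<ge> R + \<epsilon> \<Longrightarrow> mollify \<epsilon> (cut_function R u) x = 0"
proof -
  let ?U = "cut_function R u" and ?G = "cut_gradient R u g"
  let ?m = "kernel_mass TYPE(real^'n) \<epsilon>"
  have U: "sq_int lborel ?U" and G: "sq_int lborel (?G i)" for i
    by (rule sq_int_cut[OF wg R])+
  have Ui: "integrable lborel ?U" and Gi: "integrable lborel (?G i)" for i
    using sq_int_compact_integrable[OF U] sq_int_compact_integrable[OF G] sq_int_cut(3,4)[OF wg R] by blast+
  have supp: "mollify \<epsilon> ?U x = 0" if "norm x \<ge> R + \<epsilon>" for x
  proof -
    have "of_real (flat_exp 0 (\<epsilon>\<^sup>2 - (norm (y - x))\<^sup>2)) * ?U y = 0" for y
    proof (cases "norm y \<ge> R")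
      case False
      then have "norm (y - x) \<ge> \<epsilon>" using that norm_triangle_ineq2[of x y] by (simp add: norm_minus_commute)
      then show ?thesis using flat_exp_kernel_eq_0[OF _ \<epsilon>, of "y - x"] by simp
    qed (simp add: sq_int_cut(3)[OF wg R])
    then have "(\<lambda>y. of_real (flat_exp 0 (\<epsilon>\<^sup>2 - (norm (y - x))\<^sup>2)) * ?U y) = (\<lambda>y. 0)" by (simp only:)
    then show ?thesis by (simp only: mollify_def) simp
  qed
  then show "norm x \<ge> R + \<epsilon> \<Longrightarrow> mollify \<epsilon> ?U x = 0" by blast
  have "(mollify \<epsilon> ?U has_derivative (\<lambda>h. \<Sum>i\<in>UNIV. of_real (h $ i) * mollify \<epsilon> (?G i) x)) (at x)" for x
  proof -
    let ?L = "\<lambda>h. - (\<integral>y. of_real (bump_grad 0 (\<epsilon>\<^sup>2) (y - x) \<bullet> h) * ?U y \<partial>lborel) / of_real ?m"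
    have L: "(mollify \<epsilon> ?U has_derivative ?L) (at x)" by (rule mollify_has_derivative[OF \<epsilon> Ui])
    then have lin: "linear ?L" by (rule has_derivative_linear)
    have ax: "?L (axis i 1) = mollify \<epsilon> (?G i) x" for i
      unfolding weak_grad_against_kernel[OF wg R \<epsilon>] by (simp add: mollify_def)
    have "?L h = (\<Sum>i\<in>UNIV. of_real (h $ i) * mollify \<epsilon> (?G i) x)" for h
    proof -
      have "?L h = ?L (\<Sum>i\<in>UNIV. (h $ i) *\<^sub>R axis i 1)" by (simp only: vec_scaleR_axis_sum)
      also have "\<dots> = (\<Sum>i\<in>UNIV. (h $ i) *\<^sub>R ?L (axis i 1))"
        by (simp only: linear_sum[OF lin] linear_scale[OF lin])
      also have "\<dots> = (\<Sum>i\<in>UNIV. of_real (h $ i) * mollify \<epsilon> (?G i) x)"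
        by (simp only: ax scaleR_conv_of_real)
      finally show ?thesis .
    qed
    with L show ?thesis by (simp only:)
  qed
  moreover have "continuous_on UNIV (\<lambda>x. \<chi> i. mollify \<epsilon> (?G i) x)"
  proof (rule continuous_on_vec_lambda)
    show "continuous_on UNIV (mollify \<epsilon> (?G i))" for i
      by (intro continuous_at_imp_continuous_on ballI has_derivative_continuous[OF mollify_has_derivative[OF \<epsilon> Gi]])
  qed
  ultimately show "c1_compact (mollify \<epsilon> ?U) (\<lambda>x. \<chi> i. mollify \<epsilon> (?G i) x)"
    using supp by (auto simp: c1_compact_def intro!: exI[of _ "R + \<epsilon>"])
qed

lemma cut_tendsto:
  fixes u :: "real ^ 'n::finite \<Rightarrow> complex"
  assumes wg: "weak_grad u g" and xu: "sq_int lborel (\<lambda>x. norm x *\<^sub>R u x)"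
  shows "(\<lambda>n. l2 lborel (\<lambda>x. cut_function (real (Suc n)) u x - u x)) \<longlonglongrightarrow> 0"
    and "(\<lambda>n. l2 lborel (\<lambda>x. norm x *\<^sub>R (cut_function (real (Suc n)) u x - u x))) \<longlonglongrightarrow> 0"
    and "(\<lambda>n. l2 lborel (\<lambda>x. cut_gradient (real (Suc n)) u g i x - g x $ i)) \<longlonglongrightarrow> 0"
proof -
  have u: "sq_int lborel u" and gi: "sq_int lborel (\<lambda>x. g x $ i)" using wg by (auto simp: weak_grad_def intro: sq_int_vec_component)
  have [measurable]: "u \<in> borel_measurable borel" "(\<lambda>x. g x $ i) \<in> borel_measurable borel"
    using sq_int_measurable[OF u] sq_int_measurable[OF gi] by simp_all
  let ?t = "\<lambda>n x. (real (Suc n))\<^sup>2 - (norm x)\<^sup>2"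
  have b: "norm (of_real (flat_exp 0 t) * z - z :: complex) \<le> norm z" for t z
  proof -
    have "of_real (flat_exp 0 t) * z - z = of_real (flat_exp 0 t - 1) * z" by (simp add: algebra_simps)
    then show ?thesis using flat_exp_0_le[of t] flat_exp_nonneg[of 0 t] by (simp add: norm_mult mult_left_le_one_le del: of_real_diff)
  qed
  have p: "(\<lambda>n. of_real (flat_exp 0 (?t n x)) * z - z :: complex) \<longlonglongrightarrow> 0" for x :: "real^'n" and z
  proof -
    have "(\<lambda>n. flat_exp 0 (?t n x)) \<longlonglongrightarrow> 1"
      by (rule filterlim_compose[OF flat_exp_0_at_top filterlim_square_minus_const])
    then have "(\<lambda>n. of_real (flat_exp 0 (?t n x)) * z - z :: complex) \<longlonglongrightarrow> of_real 1 * z - z"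
      by (intro tendsto_intros)
    then show ?thesis by simp
  qed
  have q: "(\<lambda>n. of_real (bump_grad 0 ((real (Suc n))\<^sup>2) x $ i) * z :: complex) \<longlonglongrightarrow> 0" for x :: "real^'n" and z
  proof -
    have "(\<lambda>n. flat_exp 2 (?t n x)) \<longlonglongrightarrow> 0"
      using filterlim_compose[OF flat_exp_Suc_at_top[of 1] filterlim_square_minus_const] by (simp add: numeral_2_eq_2)
    then have "(\<lambda>n. of_real (- 2 * flat_exp 2 (?t n x) * x $ i) * z :: complex) \<longlonglongrightarrow> of_real (- 2 * 0 * x $ i) * z"
      by (intro tendsto_intros)
    then show ?thesis by (simp add: bump_grad_def numeral_2_eq_2)
  qed
  show "(\<lambda>n. l2 lborel (\<lambda>x. cut_function (real (Suc n)) u x - u x)) \<longlonglongrightarrow> 0"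
    unfolding cut_function_def by (rule l2_dominated[OF u]) (use b p in \<open>auto intro!: AE_I2\<close>)
  show "(\<lambda>n. l2 lborel (\<lambda>x. norm x *\<^sub>R (cut_function (real (Suc n)) u x - u x))) \<longlonglongrightarrow> 0"
    unfolding cut_function_def
  proof (rule l2_dominated[OF xu])
    show "AE x in lborel. (\<lambda>n. norm x *\<^sub>R (of_real (flat_exp 0 (?t n x)) * u x - u x)) \<longlonglongrightarrow> 0"
      using tendsto_scaleR[OF tendsto_const p] by (intro AE_I2) simp
  qed (use b in \<open>auto intro!: AE_I2 mult_left_mono\<close>)
  have A: "(\<lambda>n. l2 lborel (\<lambda>x. of_real (flat_exp 0 (?t n x)) * (g x $ i) - g x $ i)) \<longlonglongrightarrow> 0"
    by (rule l2_dominated[OF gi]) (use b p in \<open>auto intro!: AE_I2\<close>)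
  have bg: "norm (of_real (bump_grad 0 ((real (Suc n))\<^sup>2) x $ i) * u x) \<le> norm (4 *\<^sub>R (norm x *\<^sub>R u x))" for n x
  proof -
    have "\<bar>bump_grad 0 ((real (Suc n))\<^sup>2) x $ i\<bar> \<le> 4 * norm x"
      using order_trans[OF component_le_norm_cart bump_grad_bound(2)[of "real (Suc n)" x]] by (simp add: real_norm_def)
    then show ?thesis by (simp add: norm_mult mult.assoc[symmetric] mult_right_mono)
  qed
  have B: "(\<lambda>n. l2 lborel (\<lambda>x. of_real (bump_grad 0 ((real (Suc n))\<^sup>2) x $ i) * u x)) \<longlonglongrightarrow> 0"
    by (rule l2_dominated[OF sq_int_scaleR[OF xu, of 4]]) (use bg q in \<open>auto intro!: AE_I2\<close>)
  have "l2 lborel (\<lambda>x. cut_gradient (real (Suc n)) u g i x - g x $ i)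
     \<le> l2 lborel (\<lambda>x. of_real (flat_exp 0 (?t n x)) * (g x $ i) - g x $ i) + l2 lborel (\<lambda>x. of_real (bump_grad 0 ((real (Suc n))\<^sup>2) x $ i) * u x)" for n
  proof -
    have s1: "sq_int lborel (\<lambda>x. of_real (flat_exp 0 (?t n x)) * (g x $ i) - g x $ i)"
      by (rule sq_int_bound(1)[OF gi, of _ 1]) (use b in \<open>auto intro!: AE_I2\<close>)
    have s2: "sq_int lborel (\<lambda>x. of_real (bump_grad 0 ((real (Suc n))\<^sup>2) x $ i) * u x)"
      by (rule sq_int_bound(1)[OF sq_int_scaleR[OF xu, of 4], of _ 1]) (use bg in \<open>auto intro!: AE_I2\<close>)
    show ?thesis using l2_triangle[OF s1 s2] by (simp add: cut_gradient_def algebra_simps)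
  qed
  then show "(\<lambda>n. l2 lborel (\<lambda>x. cut_gradient (real (Suc n)) u g i x - g x $ i)) \<longlonglongrightarrow> 0"
    by (intro Lim_null_comparison[OF _ tendsto_add_zero[OF A B]]) simp
qed


text \<open>
  Cut off at radius \<open>n + 1\<close> and mollify finely enough. The last clause, that the construction sends
  zero to zero, serves to prove the uniqueness of weak gradients.
\<close>

theorem c1_compact_dense:
  fixes u :: "real ^ 'n::finite \<Rightarrow> complex"
  assumes wg: "weak_grad u g" and xu: "sq_int lborel (\<lambda>x. norm x *\<^sub>R u x)"
  obtains v Dv where "\<And>n::nat. c1_compact (v n) (Dv n)"
    "(\<lambda>n. l2 lborel (\<lambda>x. v n x - u x)) \<longlonglongrightarrow> 0"
    "(\<lambda>n. l2 lborel (\<lambda>x. norm x *\<^sub>R (v n x - u x))) \<longlonglongrightarrow> 0"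
    "\<And>i. (\<lambda>n. l2 lborel (\<lambda>x. Dv n x $ i - g x $ i)) \<longlonglongrightarrow> 0"
    "\<And>n. (\<And>x. u x = 0) \<Longrightarrow> v n = (\<lambda>x. 0)"
proof -
  let ?U = "\<lambda>n. cut_function (real (Suc n)) u" and ?G = "\<lambda>n. cut_gradient (real (Suc n)) u g"
  have R: "real (Suc n) > 0" for n by simp
  have U: "sq_int lborel (?U n)" and G: "sq_int lborel (?G n i)" for n i by (rule sq_int_cut[OF wg R])+
  have u: "sq_int lborel u" and gi: "sq_int lborel (\<lambda>x. g x $ i)" for i using wg by (auto simp: weak_grad_def intro: sq_int_vec_component)
  \<comment> \<open>The second factor compensates the weight \<open>|x|\<close>, which is at most \<open>n + 2\<close> on the supports.\<close>
  define c where "c n = inverse (real (Suc n)) / (real (Suc n) + 1)" for n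
  have c0: "c n > 0" and c1: "c n \<le> inverse (real (Suc n))" for n
  proof -
    show "c n > 0" by (simp add: c_def)
    have "inverse a / (a + 1) \<le> inverse a" if "a > 0" for a :: real using that by (simp add: divide_simps)
    then show "c n \<le> inverse (real (Suc n))" unfolding c_def using R by blast
  qed
  define good where "good n \<epsilon> \<longleftrightarrow> \<epsilon> > 0 \<and> \<epsilon> < 1 \<and> l2 lborel (\<lambda>x. mollify \<epsilon> (?U n) x - ?U n x) \<le> c n
    \<and> (\<forall>i. l2 lborel (\<lambda>x. mollify \<epsilon> (?G n i) x - ?G n i x) \<le> c n)" for n \<epsilon>
  have "\<exists>\<epsilon>. good n \<epsilon>" for n
  proof -
    obtain d0 where d0: "d0 > 0" "\<And>\<epsilon>. 0 < \<epsilon> \<Longrightarrow> \<epsilon> < d0 \<Longrightarrow> l2 lborel (\<lambda>x. mollify \<epsilon> (?U n) x - ?U n x) \<le> c n"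
      using mollify_l2_tendsto(2)[OF U c0] by blast
    have "\<forall>i. \<exists>d>0. \<forall>\<epsilon>. 0 < \<epsilon> \<and> \<epsilon> < d \<longrightarrow> l2 lborel (\<lambda>x. mollify \<epsilon> (?G n i) x - ?G n i x) \<le> c n"
      using mollify_l2_tendsto(2)[OF G c0] by blast
    then obtain d where d: "\<And>i. d i > 0" "\<And>i \<epsilon>. 0 < \<epsilon> \<Longrightarrow> \<epsilon> < d i \<Longrightarrow> l2 lborel (\<lambda>x. mollify \<epsilon> (?G n i) x - ?G n i x) \<le> c n"
      by metis
    define D where "D = Min (insert 1 (insert d0 (range d)))"
    have fin: "finite (insert 1 (insert d0 (range d)))" by simp
    have le: "D \<le> t" if "t \<in> insert 1 (insert d0 (range d))" for t
      unfolding D_def by (rule Min_le[OF fin that])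
    have "D > 0" unfolding D_def using d0(1) d(1) by (subst Min_gr_iff[OF fin]) auto
    then have D: "D > 0" "D \<le> 1" "D \<le> d0" "D \<le> d i" for i
      by (auto intro: le)
    show ?thesis unfolding good_def
    proof (intro exI[of _ "D / 2"] conjI allI)
      show "D / 2 > 0" "D / 2 < 1" using D by auto
      show "l2 lborel (\<lambda>x. mollify (D / 2) (?U n) x - ?U n x) \<le> c n" using D by (intro d0(2)) auto
      show "l2 lborel (\<lambda>x. mollify (D / 2) (?G n i) x - ?G n i x) \<le> c n" for i using D(1) D(4)[of i] by (intro d(2)) auto
    qed
  qed
  then obtain \<epsilon> where "\<And>n. good n (\<epsilon> n)" by metis
  then have \<epsilon>: "\<And>n. \<epsilon> n > 0" "\<And>n. \<epsilon> n < 1"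
    "\<And>n. l2 lborel (\<lambda>x. mollify (\<epsilon> n) (?U n) x - ?U n x) \<le> c n"
    "\<And>n i. l2 lborel (\<lambda>x. mollify (\<epsilon> n) (?G n i) x - ?G n i x) \<le> c n"
    unfolding good_def by simp_all
  define v where "v n = mollify (\<epsilon> n) (?U n)" for n
  define Dv where "Dv n = (\<lambda>x. \<chi> i. mollify (\<epsilon> n) (?G n i) x)" for n
  have v: "sq_int lborel (v n)" for n unfolding v_def by (rule mollify_l2_tendsto(1)[OF U \<epsilon>(1)])
  have inv0: "(\<lambda>n. inverse (real (Suc n))) \<longlonglongrightarrow> 0" by (rule LIMSEQ_inverse_real_of_nat)
  show thesis
  proof (rule that[of v Dv])
    show "c1_compact (v n) (Dv n)" for n
      unfolding v_def Dv_def by (rule c1_compact_mollify_cut(1)[OF wg R \<epsilon>(1)])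
    show "(\<lambda>n. l2 lborel (\<lambda>x. v n x - u x)) \<longlonglongrightarrow> 0"
    proof (rule Lim_null_comparison[OF _ tendsto_add_zero[OF inv0 cut_tendsto(1)[OF wg xu]]], intro always_eventually allI)
      show "norm (l2 lborel (\<lambda>x. v n x - u x)) \<le> inverse (real (Suc n)) + l2 lborel (\<lambda>x. ?U n x - u x)" for n
        using l2_triangle_diff[OF v[of n] U[of n] u] \<epsilon>(3)[of n] c1[of n] by (simp add: v_def)
    qed
    show "(\<lambda>n. l2 lborel (\<lambda>x. norm x *\<^sub>R (v n x - u x))) \<longlonglongrightarrow> 0"
    proof (rule Lim_null_comparison[OF _ tendsto_add_zero[OF inv0 cut_tendsto(2)[OF wg xu]]], intro always_eventually allI)
      fix n
      have vU: "sq_int lborel (\<lambda>x. v n x - ?U n x)" by (intro sq_int_diff v U)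
      have [measurable]: "(\<lambda>x. v n x - ?U n x) \<in> borel_measurable borel" using sq_int_measurable[OF vU] by simp
      have b: "norm (norm x *\<^sub>R (v n x - ?U n x)) \<le> (real (Suc n) + 1) * norm (v n x - ?U n x)" for x
      proof (cases "norm x \<ge> real (Suc n) + 1")
        case True
        then have "v n x = 0" "?U n x = 0"
          using c1_compact_mollify_cut(2)[OF wg R \<epsilon>(1), of n n x] \<epsilon>(2)[of n] sq_int_cut(3)[OF wg R, of n x] by (auto simp: v_def)
        then show ?thesis by simp
      next
        case False
        then show ?thesis by (simp add: mult_right_mono)
      qed
      have m: "(\<lambda>x. norm x *\<^sub>R (v n x - ?U n x)) \<in> borel_measurable lborel"
        using sq_int_measurable[OF vU] by (intro borel_measurable_scaleR) auto
      have ae: "AE x in lborel. norm (norm x *\<^sub>R (v n x - ?U n x)) \<le> (real (Suc n) + 1) * norm (v n x - ?U n x)"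
        by (intro AE_I2 b)
      note s1 = sq_int_bound(1)[OF vU m ae] and n1 = sq_int_bound(2)[OF vU m ae]
      have [measurable]: "?U n \<in> borel_measurable borel" "u \<in> borel_measurable borel"
        using sq_int_measurable[OF U[of n]] sq_int_measurable[OF u] by simp_all
      have s2: "sq_int lborel (\<lambda>x. norm x *\<^sub>R (?U n x - u x))"
      proof (rule sq_int_bound(1)[OF xu, of _ 1])
        have "norm (?U n x - u x) \<le> norm (u x)" for x
        proof -
          have "?U n x - u x = of_real (flat_exp 0 ((real (Suc n))\<^sup>2 - (norm x)\<^sup>2) - 1) * u x" by (simp add: cut_function_def algebra_simps)
          then show ?thesis using flat_exp_0_le flat_exp_nonneg by (simp add: norm_mult mult_left_le_one_le abs_le_iff del: of_real_diff)
        qed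
        then show "AE x in lborel. norm (norm x *\<^sub>R (?U n x - u x)) \<le> 1 * norm (norm x *\<^sub>R u x)"
          by (auto intro!: AE_I2 mult_left_mono)
      qed measurable
      have "l2 lborel (\<lambda>x. norm x *\<^sub>R (v n x - u x)) \<le> l2 lborel (\<lambda>x. norm x *\<^sub>R (v n x - ?U n x)) + l2 lborel (\<lambda>x. norm x *\<^sub>R (?U n x - u x))"
        using l2_triangle[OF s1 s2] by (simp add: scaleR_diff_right)
      also have "l2 lborel (\<lambda>x. norm x *\<^sub>R (v n x - ?U n x)) \<le> (real (Suc n) + 1) * c n"
        using n1 \<epsilon>(3)[of n] by (intro order_trans[OF n1]) (auto simp: v_def intro!: mult_left_mono)
      also have "\<dots> = inverse (real (Suc n))" by (simp add: c_def)
      finally show "norm (l2 lborel (\<lambda>x. norm x *\<^sub>R (v n x - u x))) \<le> inverse (real (Suc n)) + l2 lborel (\<lambda>x. norm x *\<^sub>R (?U n x - u x))" by simp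
    qed
    show "(\<lambda>n. l2 lborel (\<lambda>x. Dv n x $ i - g x $ i)) \<longlonglongrightarrow> 0" for i
    proof (rule Lim_null_comparison[OF _ tendsto_add_zero[OF inv0 cut_tendsto(3)[OF wg xu]]], intro always_eventually allI)
      show "norm (l2 lborel (\<lambda>x. Dv n x $ i - g x $ i)) \<le> inverse (real (Suc n)) + l2 lborel (\<lambda>x. ?G n i x - g x $ i)" for n
      proof -
        have "l2 lborel (\<lambda>x. mollify (\<epsilon> n) (?G n i) x - g x $ i)
            \<le> l2 lborel (\<lambda>x. mollify (\<epsilon> n) (?G n i) x - ?G n i x) + l2 lborel (\<lambda>x. ?G n i x - g x $ i)"
          by (rule l2_triangle_diff[OF mollify_l2_tendsto(1)[OF G \<epsilon>(1)] G gi])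
        also have "\<dots> \<le> inverse (real (Suc n)) + l2 lborel (\<lambda>x. ?G n i x - g x $ i)"
          using \<epsilon>(4)[of n i] c1[of n] by linarith
        finally show ?thesis by (simp only: Dv_def vec_lambda_beta real_norm_def abs_of_nonneg[OF l2_nonneg])
      qed
    qed
    show "v n = (\<lambda>x. 0)" if "\<And>x. u x = 0" for n
      using that by (simp add: v_def mollify_def cut_function_def fun_eq_iff)
  qed
qed

section \<open>Inequalities for smooth functions with compact support\<close>

lemma sum_axis_nth: "(\<Sum>j\<in>UNIV. of_real ((axis i 1 :: real ^ 'n::finite) $ j) * (z $ j)) = (z $ i :: complex)"
proof -
  have "(\<Sum>j\<in>UNIV. of_real ((axis i 1 :: real ^ 'n) $ j) * (z $ j)) = (\<Sum>j\<in>UNIV. if j = i then z $ j else 0)"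
    by (rule sum.cong) (auto simp: axis_def)
  then show ?thesis by simp
qed

lemma c1_compactE:
  assumes "c1_compact v Dv"
  obtains R where "R > 0" "\<And>x. norm x \<ge> R \<Longrightarrow> v x = 0" "\<And>x. norm x \<ge> R \<Longrightarrow> Dv x = 0"
proof -
  obtain R0 where R0: "\<And>x. norm x \<ge> R0 \<Longrightarrow> v x = 0" using assms by (auto simp: c1_compact_def)
  have "Dv x = 0" if "norm x > R0" for x
  proof -
    have "open {x::real^'a. norm x > R0}" by (intro open_Collect_less continuous_intros)
    then have "(v has_derivative (\<lambda>h. 0)) (at x)"
      using that R0 by (intro has_derivative_transform_within_open[where f="\<lambda>_. 0" and s="{x. norm x > R0}", OF has_derivative_const]) auto
    moreover have "(v has_derivative (\<lambda>h. \<Sum>i\<in>UNIV. of_real (h $ i) * Dv x $ i)) (at x)"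
      using assms by (simp add: c1_compact_def)
    ultimately have "(\<lambda>h. \<Sum>i\<in>UNIV. of_real (h $ i) * Dv x $ i) = (\<lambda>h. 0)" by (rule has_derivative_unique[symmetric])
    from fun_cong[OF this] have "Dv x $ i = 0" for i using sum_axis_nth[of i "Dv x"] by metis
    then show ?thesis by (simp add: vec_eq_iff)
  qed
  with R0 show thesis by (intro that[of "\<bar>R0\<bar> + 1"]) auto
qed

lemma c1_compact_continuous:
  assumes "c1_compact v Dv"
  shows "continuous_on UNIV v" "continuous_on UNIV Dv"
proof -
  show "continuous_on UNIV v"
    using assms by (intro continuous_at_imp_continuous_on ballI has_derivative_continuous) (auto simp: c1_compact_def)
  show "continuous_on UNIV Dv" using assms by (simp add: c1_compact_def)
qed

lemma continuous_compact_bounded: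
  fixes F :: "'a::euclidean_space \<Rightarrow> 'b::real_normed_vector"
  assumes "continuous_on UNIV F" "\<And>x. norm x \<ge> R \<Longrightarrow> F x = 0"
  obtains C where "C > 0" "\<And>x. norm (F x) \<le> C"
proof -
  have "compact (F ` cball 0 R)"
    using assms(1) by (intro compact_continuous_image compact_cball) (auto intro: continuous_on_subset)
  then have "bounded (F ` cball 0 R)" by (rule compact_imp_bounded)
  then obtain C where "C > 0" "\<forall>y\<in>F ` cball 0 R. norm y \<le> C" by (auto simp: bounded_pos)
  then have C: "C > 0" "\<And>x. x \<in> cball 0 R \<Longrightarrow> norm (F x) \<le> C" by blast+
  have "norm (F x) \<le> C" for x
    using C(2)[of x] assms(2)[of x] C(1) by (cases "norm x \<ge> R") auto
  with C(1) show thesis using that by blast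
qed

lemma continuous_compact_integrable:
  fixes F :: "'a::euclidean_space \<Rightarrow> 'b::euclidean_space"
  assumes "continuous_on UNIV F" "\<And>x. norm x \<ge> R \<Longrightarrow> F x = 0"
  shows "integrable lborel F"
proof -
  have "integrable lborel (\<lambda>x. indicator (cball 0 R) x *\<^sub>R F x)"
    using assms(1) by (intro borel_integrable_compact compact_cball) (auto intro: continuous_on_subset)
  moreover have "(\<lambda>x. indicator (cball 0 R) x *\<^sub>R F x) = F"
    using assms(2) by (auto simp: fun_eq_iff indicator_def)
  ultimately show ?thesis by simp
qed

lemma continuous_compact_sq_int:
  fixes F :: "'a::euclidean_space \<Rightarrow> 'b::euclidean_space"
  assumes "continuous_on UNIV F" "\<And>x. norm x \<ge> R \<Longrightarrow> F x = 0"
  shows "sq_int lborel F"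
  unfolding sq_int_def
proof
  show "F \<in> borel_measurable lborel" using borel_measurable_continuous_onI[OF assms(1)] by simp
  show "integrable lborel (\<lambda>x. (norm (F x))\<^sup>2)"
    by (rule continuous_compact_integrable[where R=R]) (use assms in \<open>auto intro!: continuous_intros\<close>)
qed

text \<open>
  The components of \<open>\<nabla>u + \<gamma>xu = \<phi> \<nabla>(u/\<phi>)\<close>, where \<open>\<phi>(x) = exp(- \<gamma>|x|\<^sup>2/2)\<close>.
\<close>

definition twisted_gradient :: "real \<Rightarrow> (real ^ 'n::finite \<Rightarrow> complex) \<Rightarrow> (real ^ 'n \<Rightarrow> complex ^ 'n) \<Rightarrow> 'n \<Rightarrow> real ^ 'n \<Rightarrow> complex" where
  "twisted_gradient \<gamma> u g i x = g x $ i + of_real (\<gamma> * x $ i) * u x"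

lemma c1_compact_twisted:
  assumes c: "c1_compact v Dv"
  shows "continuous_on UNIV (twisted_gradient \<gamma> v Dv i)"
    "\<And>x. v x = 0 \<Longrightarrow> Dv x = 0 \<Longrightarrow> twisted_gradient \<gamma> v Dv i x = 0"
    "sq_int lborel (twisted_gradient \<gamma> v Dv i)"
proof -
  show cont: "continuous_on UNIV (twisted_gradient \<gamma> v Dv i)"
    unfolding twisted_gradient_def[abs_def] using c1_compact_continuous[OF c] by (intro continuous_intros) auto
  show z: "\<And>x. v x = 0 \<Longrightarrow> Dv x = 0 \<Longrightarrow> twisted_gradient \<gamma> v Dv i x = 0" by (simp add: twisted_gradient_def)
  obtain R where R: "R > 0" "\<And>x. norm x \<ge> R \<Longrightarrow> v x = 0" "\<And>x. norm x \<ge> R \<Longrightarrow> Dv x = 0" by (rule c1_compactE[OF c]) blast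
  show "sq_int lborel (twisted_gradient \<gamma> v Dv i)"
    using R(2,3) z by (intro continuous_compact_sq_int[OF cont, of R]) auto
qed

lemma c1_compact_derivative:
  "c1_compact v Dv \<Longrightarrow> (v has_derivative (\<lambda>h. \<Sum>i\<in>UNIV. of_real (h $ i) * Dv x $ i)) (at x)"
  by (simp add: c1_compact_def)

lemma integral_partial_compact_eq_0:
  fixes F :: "real ^ 'n::finite \<Rightarrow> 'b::euclidean_space"
  assumes cont: "continuous_on UNIV F" "continuous_on UNIV F'"
    and supp: "\<And>x. norm x \<ge> R \<Longrightarrow> F x = 0" "\<And>x. norm x \<ge> R \<Longrightarrow> F' x = 0"
    and der: "\<And>x. ((\<lambda>t. F (x + t *\<^sub>R axis i 1)) has_vector_derivative F' x) (at 0)"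
  shows "(\<integral>x. F' x \<partial>lborel) = 0"
proof -
  obtain C where C: "C > 0" "\<And>x. norm (F' x) \<le> C" using continuous_compact_bounded[OF cont(2) supp(2)] by blast
  show ?thesis
  proof (rule integral_directional_derivative_eq_0(2)[where F=F and v="axis i 1" and r=1 and B="\<lambda>x. C * indicator (cball 0 (R + 1)) x"])
    show "integrable lborel F" by (rule continuous_compact_integrable[OF cont(1) supp(1)])
    show "F' \<in> borel_measurable borel" using cont(2) by (rule borel_measurable_continuous_onI)
    show "norm (F' (x + t *\<^sub>R axis i 1)) \<le> C * indicator (cball 0 (R + 1)) x" if "\<bar>t\<bar> < 1" for x t
    proof (cases "norm x \<le> R + 1")
      case True
      then show ?thesis using C(2) by simp
    next
      case False
      have "norm (t *\<^sub>R (axis i 1 :: real ^ 'n)) \<le> 1" using that by (simp add: norm_axis_1)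
      then have "norm (x + t *\<^sub>R axis i 1) \<ge> R" using False norm_triangle_ineq4[of "x + t *\<^sub>R axis i 1" "t *\<^sub>R axis i 1"] by simp
      then show ?thesis using supp(2) C(1) by (simp add: indicator_def)
    qed
    show "integrable lborel (\<lambda>x::real^'n. C * indicator (cball 0 (R + 1)) x)"
      using emeasure_bounded_finite[OF bounded_cball, of "0::real^'n" "R + 1"] by (simp add: integrable_indicator_iff)
  qed (use der in auto)
qed

text \<open>
  The partial derivative of \<open>x\<^sub>i |v|\<^sup>2\<close> in \<open>x\<^sub>i\<close> has integral zero.
\<close>

lemma c1_compact_virial:
  fixes v :: "real ^ 'n::finite \<Rightarrow> complex"
  assumes c: "c1_compact v Dv"
  shows "integrable lborel (\<lambda>x. x $ i * (v x \<bullet> Dv x $ i))"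
    and "2 * (\<integral>x. x $ i * (v x \<bullet> Dv x $ i) \<partial>lborel) = - (l2 lborel v)\<^sup>2"
proof -
  obtain R where R: "R > 0" "\<And>x. norm x \<ge> R \<Longrightarrow> v x = 0" "\<And>x. norm x \<ge> R \<Longrightarrow> Dv x = 0" by (rule c1_compactE[OF c]) blast
  note cont = c1_compact_continuous[OF c]
  define F where "F x = x $ i * (v x \<bullet> v x)" for x
  define F' where "F' x = v x \<bullet> v x + 2 * (x $ i * (v x \<bullet> Dv x $ i))" for x
  have cF: "continuous_on UNIV F" and cF': "continuous_on UNIV F'"
    unfolding F_def F'_def using cont by (auto intro!: continuous_intros)
  have F0: "norm x \<ge> R \<Longrightarrow> F x = 0" "norm x \<ge> R \<Longrightarrow> F' x = 0" for x using R(2,3) by (auto simp: F_def F'_def)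
  have "(\<integral>x. F' x \<partial>lborel) = 0"
  proof (rule integral_partial_compact_eq_0[OF cF cF' F0])
    show "((\<lambda>t. F (x + t *\<^sub>R axis i 1)) has_vector_derivative F' x) (at 0)" for x
    proof -
      have l: "((\<lambda>t::real. x + t *\<^sub>R axis i 1) has_derivative (\<lambda>t. t *\<^sub>R axis i 1)) (at 0)"
        by (auto intro!: derivative_eq_intros)
      have "((\<lambda>t. v (x + t *\<^sub>R axis i 1)) has_derivative (\<lambda>t. \<Sum>j\<in>UNIV. of_real ((t *\<^sub>R axis i 1 :: real ^ 'n) $ j) * Dv x $ j)) (at 0)"
      proof -
        have "(v has_derivative (\<lambda>h. \<Sum>j\<in>UNIV. of_real (h $ j) * Dv x $ j)) (at (x + 0 *\<^sub>R axis i 1))"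
          using c1_compact_derivative[OF c, of x] by simp
        from has_derivative_compose[OF l this] show ?thesis .
      qed
      moreover have "(\<Sum>j\<in>UNIV. of_real ((t *\<^sub>R axis i 1 :: real ^ 'n) $ j) * Dv x $ j) = t *\<^sub>R Dv x $ i" for t
      proof -
        have "(\<Sum>j\<in>UNIV. of_real ((t *\<^sub>R axis i 1 :: real ^ 'n) $ j) * Dv x $ j) = of_real t * (\<Sum>j\<in>UNIV. of_real ((axis i 1 :: real ^ 'n) $ j) * Dv x $ j)"
          by (simp add: sum_distrib_left mult.assoc)
        then show ?thesis by (simp only: sum_axis_nth scaleR_conv_of_real)
      qed
      ultimately have V: "((\<lambda>t. v (x + t *\<^sub>R axis i 1)) has_derivative (\<lambda>t. t *\<^sub>R Dv x $ i)) (at 0)" by simp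
      have X: "((\<lambda>t. (x + t *\<^sub>R axis i 1) $ i) has_derivative (\<lambda>t. t)) (at 0)"
        by (auto intro!: derivative_eq_intros simp: axis_def)
      show ?thesis
        unfolding F_def has_vector_derivative_def
        by (rule has_derivative_eq_rhs[OF has_derivative_mult[OF X has_derivative_inner[OF V V]]])
           (simp add: F'_def fun_eq_iff inner_commute algebra_simps)
    qed
  qed
  moreover show i: "integrable lborel (\<lambda>x. x $ i * (v x \<bullet> Dv x $ i))"
    by (rule continuous_compact_integrable[where R=R]) (use cont R in \<open>auto intro!: continuous_intros\<close>)
  moreover have "integrable lborel (\<lambda>x. v x \<bullet> v x)"
    by (rule continuous_compact_integrable[where R=R]) (use cont R in \<open>auto intro!: continuous_intros\<close>)
  ultimately show "2 * (\<integral>x. x $ i * (v x \<bullet> Dv x $ i) \<partial>lborel) = - (l2 lborel v)\<^sup>2"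
    by (simp add: F'_def l2_power2 power2_norm_eq_inner)
qed

lemma vec_norm_power2: "(norm (y :: real ^ 'n::finite))\<^sup>2 = (\<Sum>i\<in>UNIV. (y $ i)\<^sup>2)"
  by (simp add: norm_vec_def L2_set_def sum_nonneg)

lemma norm_add_scaleR_power2:
  fixes a b :: "'a::real_inner"
  shows "(norm (a + t *\<^sub>R b))\<^sup>2 = (norm a)\<^sup>2 + t\<^sup>2 * (norm b)\<^sup>2 + 2 * t * (b \<bullet> a)"
  unfolding power2_norm_eq_inner inner_add_left inner_add_right inner_scaleR_left inner_scaleR_right
  by (simp add: inner_commute[of a b] power2_eq_square algebra_simps)

text \<open>
  The cross terms in the expanded squares are evaluated by the virial identity.
\<close>

lemma c1_compact_uncertainty:
  fixes v :: "real ^ 'n::finite \<Rightarrow> complex"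
  assumes c: "c1_compact v Dv"
  shows "(\<Sum>i\<in>UNIV. (l2 lborel (twisted_gradient \<gamma> v Dv i))\<^sup>2)
    = (\<Sum>i\<in>UNIV. (l2 lborel (\<lambda>x. Dv x $ i))\<^sup>2) + \<gamma>\<^sup>2 * (l2 lborel (\<lambda>x. norm x *\<^sub>R v x))\<^sup>2 - \<gamma> * real CARD('n) * (l2 lborel v)\<^sup>2"
proof -
  obtain R where R: "R > 0" "\<And>x. norm x \<ge> R \<Longrightarrow> v x = 0" "\<And>x. norm x \<ge> R \<Longrightarrow> Dv x = 0" by (rule c1_compactE[OF c]) blast
  note cont = c1_compact_continuous[OF c]
  have i1: "integrable lborel (\<lambda>x. (norm (Dv x $ i))\<^sup>2)" for i
    by (rule continuous_compact_integrable[where R=R]) (use cont R in \<open>auto intro!: continuous_intros\<close>)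
  have i2: "integrable lborel (\<lambda>x. (x $ i)\<^sup>2 * (norm (v x))\<^sup>2)" for i
    by (rule continuous_compact_integrable[where R=R]) (use cont R in \<open>auto intro!: continuous_intros\<close>)
  have "(l2 lborel (twisted_gradient \<gamma> v Dv i))\<^sup>2
     = (l2 lborel (\<lambda>x. Dv x $ i))\<^sup>2 + \<gamma>\<^sup>2 * (\<integral>x. (x $ i)\<^sup>2 * (norm (v x))\<^sup>2 \<partial>lborel) - \<gamma> * (l2 lborel v)\<^sup>2" for i
  proof -
    have "(norm (twisted_gradient \<gamma> v Dv i x))\<^sup>2 = (norm (Dv x $ i))\<^sup>2 + \<gamma>\<^sup>2 * ((x $ i)\<^sup>2 * (norm (v x))\<^sup>2) + 2 * \<gamma> * (x $ i * (v x \<bullet> Dv x $ i))" for x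
    proof -
      have "twisted_gradient \<gamma> v Dv i x = Dv x $ i + (\<gamma> * x $ i) *\<^sub>R v x" by (simp add: twisted_gradient_def scaleR_conv_of_real)
      then show ?thesis by (simp only: norm_add_scaleR_power2) (simp add: power_mult_distrib)
    qed
    then have "(l2 lborel (twisted_gradient \<gamma> v Dv i))\<^sup>2 = (l2 lborel (\<lambda>x. Dv x $ i))\<^sup>2
        + \<gamma>\<^sup>2 * (\<integral>x. (x $ i)\<^sup>2 * (norm (v x))\<^sup>2 \<partial>lborel) + \<gamma> * (2 * (\<integral>x. x $ i * (v x \<bullet> Dv x $ i) \<partial>lborel))"
      using i1 i2 c1_compact_virial(1)[OF c, of i] by (simp add: l2_power2)
    then show ?thesis by (simp add: c1_compact_virial(2)[OF c])
  qed
  moreover have "(\<Sum>i\<in>UNIV. (\<integral>x. (x $ i)\<^sup>2 * (norm (v x))\<^sup>2 \<partial>lborel)) = (l2 lborel (\<lambda>x. norm x *\<^sub>R v x))\<^sup>2"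
  proof -
    have "(norm (norm x *\<^sub>R v x))\<^sup>2 = (\<Sum>i\<in>UNIV. (x $ i)\<^sup>2 * (norm (v x))\<^sup>2)" for x
      by (simp add: power_mult_distrib sum_distrib_right[symmetric] norm_vec_def L2_set_def sum_nonneg)
    then show ?thesis using i2 by (simp add: l2_power2)
  qed
  ultimately show ?thesis
    by (simp add: sum.distrib sum_subtractf sum_distrib_left[symmetric])
qed

lemma gaussian_integral_dressed:
  fixes F :: "real ^ 'n::finite \<Rightarrow> 'b::{banach, second_countable_topology}"
  assumes \<gamma>: "\<gamma> > 0" and F: "F \<in> borel_measurable borel"
  shows "(\<integral>x. exp (\<gamma> * (norm x)\<^sup>2) *\<^sub>R F x \<partial>gaussian \<gamma>) = (\<integral>x. F x \<partial>lborel) /\<^sub>R gauss_mass TYPE(real^'n) \<gamma>"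
    and "integrable (gaussian \<gamma>) (\<lambda>x. exp (\<gamma> * (norm x)\<^sup>2) *\<^sub>R F x) \<longleftrightarrow> integrable lborel F"
proof -
  note [measurable] = F
  have m: "(\<lambda>x. exp (\<gamma> * (norm x)\<^sup>2) *\<^sub>R F x) \<in> borel_measurable borel" by measurable
  have e: "exp (- \<gamma> * (norm x)\<^sup>2) *\<^sub>R (exp (\<gamma> * (norm x)\<^sup>2) *\<^sub>R F x) = F x" for x
    by (simp add: exp_minus)
  show "(\<integral>x. exp (\<gamma> * (norm x)\<^sup>2) *\<^sub>R F x \<partial>gaussian \<gamma>) = (\<integral>x. F x \<partial>lborel) /\<^sub>R gauss_mass TYPE(real^'n) \<gamma>"
    by (simp only: integral_gaussian(1)[OF \<gamma> m] e)
  show "integrable (gaussian \<gamma>) (\<lambda>x. exp (\<gamma> * (norm x)\<^sup>2) *\<^sub>R F x) \<longleftrightarrow> integrable lborel F"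
    by (simp only: integral_gaussian(2)[OF \<gamma> m] e)
qed

text \<open>
  The entropy inequality for \<open>\<Psi>(t) = t ln t\<close> and the function \<open>|w|\<^sup>2 + \<epsilon>\<close>, where \<open>w = v/\<phi>\<close>; the
  constant \<open>\<epsilon>\<close> keeps its values away from the singularity of \<open>\<Psi>\<close>. The gradient of \<open>|w|\<^sup>2\<close> has norm at
  most \<open>2 |w| |\<nabla>w|\<close>, which cancels the denominator in \<open>\<Psi>''(t) = 1/t\<close>, and the weights cancel in
  \<open>\<phi>\<^sup>2 |\<nabla>w|\<^sup>2 = |\<nabla>v + \<gamma>xv|\<^sup>2\<close>.
\<close>

lemma c1_compact_log_sobolev:
  fixes v :: "real ^ 'n::finite \<Rightarrow> complex"
  assumes \<gamma>: "\<gamma> > 0" and c: "c1_compact v Dv" and \<epsilon>: "\<epsilon> > 0"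
  defines "Z \<equiv> gauss_mass TYPE(real^'n) \<gamma>"
    and "f \<equiv> (\<lambda>x. exp (\<gamma> * (norm x)\<^sup>2) * (norm (v x))\<^sup>2 + \<epsilon>)"
  shows "integrable (gaussian \<gamma>) (\<lambda>x. f x * ln (f x))"
    and "(\<integral>x. f x * ln (f x) \<partial>gaussian \<gamma>) \<le> ((l2 lborel v)\<^sup>2 / Z + \<epsilon>) * ln ((l2 lborel v)\<^sup>2 / Z + \<epsilon>)
      + (\<Sum>i\<in>UNIV. (l2 lborel (twisted_gradient \<gamma> v Dv i))\<^sup>2) / (\<gamma> * Z)"
proof -
  obtain R where R: "R > 0" "\<And>x. norm x \<ge> R \<Longrightarrow> v x = 0" "\<And>x. norm x \<ge> R \<Longrightarrow> Dv x = 0" by (rule c1_compactE[OF c]) blast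
  note cont = c1_compact_continuous[OF c]
  let ?W = "twisted_gradient \<gamma> v Dv"
  note W = c1_compact_twisted[OF c, where \<gamma>=\<gamma>]
  define D where "D x = (\<chi> i. 2 * exp (\<gamma> * (norm x)\<^sup>2) * (v x \<bullet> ?W i x))" for x
  have f_eq: "f = (\<lambda>x. exp (\<gamma> * (x \<bullet> x)) * (v x \<bullet> v x) + \<epsilon>)" by (simp add: f_def power2_norm_eq_inner)
  have f_der: "(f has_derivative (\<lambda>h. D x \<bullet> h)) (at x)" for x
  proof -
    have 1: "((\<lambda>x. exp (\<gamma> * (x \<bullet> x))) has_derivative (\<lambda>h. exp (\<gamma> * (x \<bullet> x)) * (2 * \<gamma> * (x \<bullet> h)))) (at x)"
      by (auto intro!: derivative_eq_intros simp: inner_commute algebra_simps)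
    note 2 = has_derivative_inner[OF c1_compact_derivative[OF c, of x] c1_compact_derivative[OF c, of x]]
    have eq: "v x \<bullet> (\<Sum>i\<in>UNIV. of_real (h $ i) * Dv x $ i) = (\<Sum>i\<in>UNIV. h $ i * (v x \<bullet> Dv x $ i))" for h
      by (simp add: inner_sum_right scaleR_conv_of_real[symmetric])
    have "D x \<bullet> h = exp (\<gamma> * (x \<bullet> x)) * (v x \<bullet> (\<Sum>i\<in>UNIV. of_real (h $ i) * Dv x $ i) + (\<Sum>i\<in>UNIV. of_real (h $ i) * Dv x $ i) \<bullet> v x)
        + exp (\<gamma> * (x \<bullet> x)) * (2 * \<gamma> * (x \<bullet> h)) * (v x \<bullet> v x)" for h
    proof -
      have "v x \<bullet> ?W i x = v x \<bullet> Dv x $ i + \<gamma> * x $ i * (v x \<bullet> v x)" for i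
        by (simp add: twisted_gradient_def inner_add_right scaleR_conv_of_real[symmetric] del: of_real_mult)
      then have "D x \<bullet> h = (\<Sum>i\<in>UNIV. 2 * exp (\<gamma> * (x \<bullet> x)) * (h $ i * (v x \<bullet> Dv x $ i)) + 2 * exp (\<gamma> * (x \<bullet> x)) * \<gamma> * (v x \<bullet> v x) * (x $ i * h $ i))"
        unfolding inner_vec_def[of "D x"] by (intro sum.cong) (auto simp: D_def power2_norm_eq_inner algebra_simps)
      also have "\<dots> = 2 * exp (\<gamma> * (x \<bullet> x)) * (\<Sum>i\<in>UNIV. h $ i * (v x \<bullet> Dv x $ i)) + 2 * exp (\<gamma> * (x \<bullet> x)) * \<gamma> * (v x \<bullet> v x) * (x \<bullet> h)"
        by (simp add: sum.distrib sum_distrib_left inner_vec_def[of x])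
      moreover have "(\<Sum>i\<in>UNIV. of_real (h $ i) * Dv x $ i) \<bullet> v x = (\<Sum>i\<in>UNIV. h $ i * (v x \<bullet> Dv x $ i))"
        by (simp only: eq inner_commute[of "\<Sum>i\<in>UNIV. of_real (h $ i) * Dv x $ i" "v x"])
      ultimately show ?thesis
        by (simp only: eq) (simp add: algebra_simps)
    qed
    then show ?thesis
      unfolding f_eq by (intro has_derivative_eq_rhs[OF has_derivative_add[OF has_derivative_mult[OF 1 2] has_derivative_const]]) (auto simp: fun_eq_iff)
  qed
  have D_cont: "continuous_on UNIV D"
    unfolding D_def using cont W(1) by (intro continuous_on_vec_lambda continuous_intros) auto
  have D0: "norm x \<ge> R \<Longrightarrow> D x = 0" for x using R(2) by (simp add: D_def vec_eq_iff)
  obtain L where L: "L > 0" "\<And>x. norm (D x) \<le> L" using continuous_compact_bounded[OF D_cont D0] by blast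
  have f_cont: "continuous_on UNIV (\<lambda>x. f x - \<epsilon>)" unfolding f_def using cont by (auto intro!: continuous_intros)
  have f0: "norm x \<ge> R \<Longrightarrow> f x - \<epsilon> = 0" for x using R(2) by (simp add: f_def)
  obtain C where C: "C > 0" "\<And>x. norm (f x - \<epsilon>) \<le> C" using continuous_compact_bounded[OF f_cont f0] by blast
  have f_range: "f x \<in> {\<epsilon>..C + \<epsilon>}" for x using C(2)[of x] by (auto simp: f_def)
  interpret G: gaussian_interpolation \<gamma> f D "\<lambda>t. t * ln t" "\<lambda>t. ln t + 1" "\<lambda>t. 1 / t" \<epsilon> "C + \<epsilon>" L
  proof
    show "((\<lambda>t. t * ln t) has_real_derivative ln t + 1) (at t)" "((\<lambda>t. ln t + 1) has_real_derivative 1 / t) (at t)" if "t \<in> {\<epsilon>..C + \<epsilon>}" for t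
      using that \<epsilon> by (auto intro!: derivative_eq_intros)
    show "continuous_on {\<epsilon>..C + \<epsilon>} (\<lambda>t. 1 / t)" using \<epsilon> by (auto intro!: continuous_intros)
  qed (use \<gamma> f_der D_cont L f_range in auto)
  have phi: "(\<integral>x. f x * ln (f x) \<partial>gaussian \<gamma>) - (\<integral>x. f x \<partial>gaussian \<gamma>) * ln (\<integral>x. f x \<partial>gaussian \<gamma>)
      \<le> (\<integral>x. 1 / f x * (norm (D x))\<^sup>2 \<partial>gaussian \<gamma>) / (4 * \<gamma>)"
  proof (rule G.phi_entropy)
    fix m0 and v0 :: "real ^ 'n" assume m0: "m0 \<in> {\<epsilon>..C + \<epsilon>}"
    have "1 / m0 * (norm v0)\<^sup>2 + (2 / m0) *\<^sub>R v0 \<bullet> (w - v0) + (- (norm v0)\<^sup>2 / m0\<^sup>2) * (m - m0) \<le> 1 / m * (norm w)\<^sup>2"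
      if m: "m \<in> {\<epsilon>..C + \<epsilon>}" for m w
    proof -
      have pos: "m > 0" "m0 > 0" using m m0 \<epsilon> by auto
      \<comment> \<open>This square is the gap between \<open>|w|\<^sup>2 / m\<close> and its affine minorant at \<open>(m0, v0)\<close>.\<close>
      have "0 \<le> (norm (w - (m / m0) *\<^sub>R v0))\<^sup>2 / m" using pos by simp
      also have "\<dots> = 1 / m * (norm w)\<^sup>2 - (1 / m0 * (norm v0)\<^sup>2 + (2 / m0) *\<^sub>R v0 \<bullet> (w - v0) + (- (norm v0)\<^sup>2 / m0\<^sup>2) * (m - m0))"
      proof -
        have alg: "(A + (- (m / m0))\<^sup>2 * B + 2 * (- (m / m0)) * p) / m = 1 / m * A - (1 / m0 * B + (2 / m0) * (p - B) + (- B / m0\<^sup>2) * (m - m0))" for A B p :: real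
          using pos by (simp add: field_simps power2_eq_square)
        have e1: "(2 / m0) *\<^sub>R v0 \<bullet> (w - v0) = (2 / m0) * (v0 \<bullet> w - (norm v0)\<^sup>2)"
          by (simp add: power2_norm_eq_inner inner_diff_right right_diff_distrib diff_divide_distrib)
        show ?thesis
          unfolding e1 using norm_add_scaleR_power2[of w "- (m / m0)" v0] alg[of "(norm w)\<^sup>2" "(norm v0)\<^sup>2" "v0 \<bullet> w"] by simp
      qed
      finally show ?thesis by simp
    qed
    then show "\<exists>d k. \<forall>m\<in>{\<epsilon>..C + \<epsilon>}. \<forall>w. 1 / m0 * (norm v0)\<^sup>2 + d \<bullet> (w - v0) + k * (m - m0) \<le> 1 / m * (norm w)\<^sup>2" by blast
  qed
  have v2m: "(\<lambda>x. (norm (v x))\<^sup>2) \<in> borel_measurable borel" and W2m: "(\<lambda>x. \<Sum>i\<in>UNIV. (norm (?W i x))\<^sup>2) \<in> borel_measurable borel"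
    by (intro borel_measurable_continuous_onI continuous_intros cont W(1))+
  have v2i: "integrable lborel (\<lambda>x. (norm (v x))\<^sup>2)"
    by (rule continuous_compact_integrable[where R=R]) (use cont R in \<open>auto intro!: continuous_intros\<close>)
  have W2i: "integrable lborel (\<lambda>x. (norm (?W i x))\<^sup>2)" for i using W(3) by (simp add: sq_int_def)
  have If: "(\<integral>x. f x \<partial>gaussian \<gamma>) = (l2 lborel v)\<^sup>2 / Z + \<epsilon>"
    unfolding f_def Z_def using gaussian_integral_dressed[OF \<gamma> v2m] v2i
    by (simp add: l2_power2 divide_inverse mult.commute)
  have "(\<integral>x. 1 / f x * (norm (D x))\<^sup>2 \<partial>gaussian \<gamma>) \<le> (\<integral>x. 4 * (exp (\<gamma> * (norm x)\<^sup>2) *\<^sub>R (\<Sum>i\<in>UNIV. (norm (?W i x))\<^sup>2)) \<partial>gaussian \<gamma>)"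
  proof (rule integral_mono)
    show "integrable (gaussian \<gamma>) (\<lambda>x. 4 * (exp (\<gamma> * (norm x)\<^sup>2) *\<^sub>R (\<Sum>i\<in>UNIV. (norm (?W i x))\<^sup>2)))"
      using gaussian_integral_dressed(2)[OF \<gamma> W2m] W2i by simp
    show "integrable (gaussian \<gamma>) (\<lambda>x. 1 / f x * (norm (D x))\<^sup>2)"
    proof (rule G.integrable_const_bound[where B="1 / \<epsilon> * L\<^sup>2"])
      have "1 / f x * (norm (D x))\<^sup>2 \<le> 1 / \<epsilon> * L\<^sup>2" for x
        using f_range[of x] \<epsilon> L by (intro mult_mono power_mono) (auto intro!: divide_left_mono mult_pos_pos)
      moreover have "0 \<le> 1 / f x * (norm (D x))\<^sup>2" for x using f_range[of x] \<epsilon> by simp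
      ultimately show "AE x in gaussian \<gamma>. norm (1 / f x * (norm (D x))\<^sup>2) \<le> 1 / \<epsilon> * L\<^sup>2" by (intro AE_I2) (metis abs_of_nonneg real_norm_def)
    qed measurable
    fix x
    have fx: "f x > 0" "exp (\<gamma> * (norm x)\<^sup>2) * (norm (v x))\<^sup>2 \<le> f x"
      using f_range[of x] \<epsilon> by (auto simp: f_def add_nonneg_pos)
    have "(norm (D x))\<^sup>2 = (\<Sum>i\<in>UNIV. (2 * exp (\<gamma> * (norm x)\<^sup>2) * (v x \<bullet> ?W i x))\<^sup>2)"
      by (simp add: norm_vec_def L2_set_def D_def sum_nonneg)
    also have "\<dots> \<le> (\<Sum>i\<in>UNIV. 4 * exp (\<gamma> * (norm x)\<^sup>2) * (norm (?W i x))\<^sup>2 * f x)"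
    proof (rule sum_mono)
      fix i
      have "(v x \<bullet> ?W i x)\<^sup>2 \<le> (norm (v x))\<^sup>2 * (norm (?W i x))\<^sup>2"
        using Cauchy_Schwarz_ineq[of "v x" "?W i x"] by (simp add: power2_norm_eq_inner)
      then have "(2 * exp (\<gamma> * (norm x)\<^sup>2) * (v x \<bullet> ?W i x))\<^sup>2 \<le> 4 * (exp (\<gamma> * (norm x)\<^sup>2))\<^sup>2 * ((norm (v x))\<^sup>2 * (norm (?W i x))\<^sup>2)"
        by (simp add: power_mult_distrib mult_left_mono)
      also have "\<dots> = 4 * exp (\<gamma> * (norm x)\<^sup>2) * (norm (?W i x))\<^sup>2 * (exp (\<gamma> * (norm x)\<^sup>2) * (norm (v x))\<^sup>2)"
        by (simp add: power2_eq_square)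
      also have "\<dots> \<le> 4 * exp (\<gamma> * (norm x)\<^sup>2) * (norm (?W i x))\<^sup>2 * f x"
        using fx by (intro mult_left_mono) auto
      finally show "(2 * exp (\<gamma> * (norm x)\<^sup>2) * (v x \<bullet> ?W i x))\<^sup>2 \<le> 4 * exp (\<gamma> * (norm x)\<^sup>2) * (norm (?W i x))\<^sup>2 * f x" .
    qed
    also have "\<dots> = 4 * (exp (\<gamma> * (norm x)\<^sup>2) *\<^sub>R (\<Sum>i\<in>UNIV. (norm (?W i x))\<^sup>2)) * f x"
      by (simp add: sum_distrib_left sum_distrib_right mult.assoc)
    finally show "1 / f x * (norm (D x))\<^sup>2 \<le> 4 * (exp (\<gamma> * (norm x)\<^sup>2) *\<^sub>R (\<Sum>i\<in>UNIV. (norm (?W i x))\<^sup>2))"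
      using fx(1) by (simp add: divide_le_eq)
  qed
  also have "\<dots> = 4 * ((\<Sum>i\<in>UNIV. (l2 lborel (?W i))\<^sup>2) / Z)"
    unfolding Z_def integral_mult_right_zero gaussian_integral_dressed(1)[OF \<gamma> W2m]
    using W2i by (simp add: l2_power2 divide_inverse mult.commute)
  finally have "(\<integral>x. 1 / f x * (norm (D x))\<^sup>2 \<partial>gaussian \<gamma>) / (4 * \<gamma>) \<le> (\<Sum>i\<in>UNIV. (l2 lborel (?W i))\<^sup>2) / (\<gamma> * Z)"
    using \<gamma> by (simp add: field_simps)
  with phi show "(\<integral>x. f x * ln (f x) \<partial>gaussian \<gamma>) \<le> ((l2 lborel v)\<^sup>2 / Z + \<epsilon>) * ln ((l2 lborel v)\<^sup>2 / Z + \<epsilon>)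
      + (\<Sum>i\<in>UNIV. (l2 lborel (?W i))\<^sup>2) / (\<gamma> * Z)"
    unfolding If by linarith
  obtain B where B: "B > 0" "\<And>t. t \<in> {\<epsilon>..C + \<epsilon>} \<Longrightarrow> \<bar>t * ln t\<bar> \<le> B" by (rule G.comp_bd[OF G.\<Psi>_cont]) blast
  show "integrable (gaussian \<gamma>) (\<lambda>x. f x * ln (f x))"
    by (rule G.integrable_const_bound[where B=B]) (use B(2) f_range in \<open>auto intro!: AE_I2\<close>)
qed

text \<open>
  The entropy inequality for \<open>\<Psi>(t) = t\<^sup>2\<close> is the Poincare inequality. It is applied to a real
  component of \<open>v/\<phi>\<close>; the choices \<open>a = 1\<close> and \<open>a = \<i>\<close> give the real and the imaginary part.
\<close>

lemma c1_compact_poincare_component: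
  fixes v :: "real ^ 'n::finite \<Rightarrow> complex"
  assumes \<gamma>: "\<gamma> > 0" and c: "c1_compact v Dv"
  defines "Z \<equiv> gauss_mass TYPE(real^'n) \<gamma>"
  shows "(\<integral>x. (v x \<bullet> a)\<^sup>2 \<partial>lborel) - (\<integral>x. exp (- (\<gamma>/2) * (norm x)\<^sup>2) * (v x \<bullet> a) \<partial>lborel)\<^sup>2 / Z
     \<le> (\<Sum>i\<in>UNIV. (\<integral>x. (twisted_gradient \<gamma> v Dv i x \<bullet> a)\<^sup>2 \<partial>lborel)) / (2 * \<gamma>)"
proof -
  obtain R where R: "R > 0" "\<And>x. norm x \<ge> R \<Longrightarrow> v x = 0" "\<And>x. norm x \<ge> R \<Longrightarrow> Dv x = 0" by (rule c1_compactE[OF c]) blast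
  note cont = c1_compact_continuous[OF c]
  let ?W = "twisted_gradient \<gamma> v Dv"
  note W = c1_compact_twisted[OF c, where \<gamma>=\<gamma>]
  define f where "f x = exp ((\<gamma>/2) * (norm x)\<^sup>2) * (v x \<bullet> a)" for x
  define D where "D x = (\<chi> i. exp ((\<gamma>/2) * (norm x)\<^sup>2) * (?W i x \<bullet> a))" for x
  have f_eq: "f = (\<lambda>x. exp ((\<gamma>/2) * (x \<bullet> x)) * (v x \<bullet> a))" by (simp add: f_def power2_norm_eq_inner fun_eq_iff)
  have f_der: "(f has_derivative (\<lambda>h. D x \<bullet> h)) (at x)" for x
  proof -
    have 1: "((\<lambda>x. exp ((\<gamma>/2) * (x \<bullet> x))) has_derivative (\<lambda>h. exp ((\<gamma>/2) * (x \<bullet> x)) * (\<gamma> * (x \<bullet> h)))) (at x)"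
      by (auto intro!: derivative_eq_intros simp: inner_commute algebra_simps)
    note 2 = has_derivative_inner_left[OF c1_compact_derivative[OF c, of x], of a]
    have "D x \<bullet> h = exp ((\<gamma>/2) * (x \<bullet> x)) * ((\<Sum>i\<in>UNIV. of_real (h $ i) * Dv x $ i) \<bullet> a) + exp ((\<gamma>/2) * (x \<bullet> x)) * (\<gamma> * (x \<bullet> h)) * (v x \<bullet> a)" for h
    proof -
      have eq: "(\<Sum>i\<in>UNIV. of_real (h $ i) * Dv x $ i) \<bullet> a = (\<Sum>i\<in>UNIV. h $ i * (Dv x $ i \<bullet> a))"
        by (simp add: inner_sum_left scaleR_conv_of_real[symmetric])
      have "?W i x \<bullet> a = Dv x $ i \<bullet> a + \<gamma> * x $ i * (v x \<bullet> a)" for i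
        by (simp add: twisted_gradient_def inner_add_left scaleR_conv_of_real[symmetric] del: of_real_mult)
      then have "D x \<bullet> h = (\<Sum>i\<in>UNIV. exp ((\<gamma>/2) * (x \<bullet> x)) * (h $ i * (Dv x $ i \<bullet> a)) + exp ((\<gamma>/2) * (x \<bullet> x)) * \<gamma> * (v x \<bullet> a) * (x $ i * h $ i))"
        unfolding inner_vec_def[of "D x"] by (intro sum.cong) (auto simp: D_def power2_norm_eq_inner algebra_simps)
      also have "\<dots> = exp ((\<gamma>/2) * (x \<bullet> x)) * (\<Sum>i\<in>UNIV. h $ i * (Dv x $ i \<bullet> a)) + exp ((\<gamma>/2) * (x \<bullet> x)) * \<gamma> * (v x \<bullet> a) * (x \<bullet> h)"
        by (simp add: sum.distrib sum_distrib_left inner_vec_def[of x])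
      finally show ?thesis by (simp only: eq) (simp add: algebra_simps)
    qed
    then show ?thesis
      unfolding f_eq by (intro has_derivative_eq_rhs[OF has_derivative_mult[OF 1 2]]) (auto simp: fun_eq_iff)
  qed
  have D_cont: "continuous_on UNIV D"
    unfolding D_def using cont W(1) by (intro continuous_on_vec_lambda continuous_intros) auto
  have D0: "norm x \<ge> R \<Longrightarrow> D x = 0" for x using R(2,3) W(2) by (simp add: D_def vec_eq_iff)
  obtain L where L: "L > 0" "\<And>x. norm (D x) \<le> L" using continuous_compact_bounded[OF D_cont D0] by blast
  have f_cont: "continuous_on UNIV f" unfolding f_def using cont by (auto intro!: continuous_intros)
  have f0: "norm x \<ge> R \<Longrightarrow> f x = 0" for x using R(2) by (simp add: f_def)
  obtain C where C: "C > 0" "\<And>x. norm (f x) \<le> C" using continuous_compact_bounded[OF f_cont f0] by blast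
  have f_range: "f x \<in> {- C..C}" for x using C(2)[of x] by auto
  interpret G: gaussian_interpolation \<gamma> f D "\<lambda>t. t\<^sup>2" "\<lambda>t. 2 * t" "\<lambda>t. 2" "- C" C L
  proof
    show "((\<lambda>t. t\<^sup>2) has_real_derivative 2 * t) (at t)" "((\<lambda>t. 2 * t) has_real_derivative 2) (at t)" for t :: real
      by (auto intro!: derivative_eq_intros)
  qed (use \<gamma> f_der D_cont L f_range in auto)
  have phi: "(\<integral>x. (f x)\<^sup>2 \<partial>gaussian \<gamma>) - (\<integral>x. f x \<partial>gaussian \<gamma>)\<^sup>2 \<le> (\<integral>x. 2 * (norm (D x))\<^sup>2 \<partial>gaussian \<gamma>) / (4 * \<gamma>)"
  proof (rule G.phi_entropy)
    fix m0 and v0 :: "real ^ 'n"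
    have "2 * (norm v0)\<^sup>2 + (4 *\<^sub>R v0) \<bullet> (w - v0) + 0 * (m - m0) \<le> 2 * (norm w)\<^sup>2" for m w
    proof -
      have "0 \<le> 2 * (norm (w - v0))\<^sup>2" by simp
      also have "\<dots> = 2 * (norm w)\<^sup>2 - (2 * (norm v0)\<^sup>2 + (4 *\<^sub>R v0) \<bullet> (w - v0))"
        unfolding power2_norm_eq_inner by (simp add: inner_diff_left inner_diff_right inner_commute algebra_simps)
      finally show ?thesis by simp
    qed
    then show "\<exists>d k. \<forall>m\<in>{- C..C}. \<forall>w. 2 * (norm v0)\<^sup>2 + d \<bullet> (w - v0) + k * (m - m0) \<le> 2 * (norm w)\<^sup>2" by blast
  qed
  have e2: "(exp ((\<gamma>/2) * (norm x)\<^sup>2) * t)\<^sup>2 = exp (\<gamma> * (norm x)\<^sup>2) *\<^sub>R t\<^sup>2" for x :: "real^'n" and t :: real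
    by (simp add: power_mult_distrib exp_double[symmetric])
  have m1: "(\<lambda>x. (v x \<bullet> a)\<^sup>2) \<in> borel_measurable borel" "(\<lambda>x. \<Sum>i\<in>UNIV. (?W i x \<bullet> a)\<^sup>2) \<in> borel_measurable borel"
    "(\<lambda>x. exp (- (\<gamma>/2) * (norm x)\<^sup>2) * (v x \<bullet> a)) \<in> borel_measurable borel"
    by (intro borel_measurable_continuous_onI continuous_intros cont W(1))+
  have I1: "(\<integral>x. (f x)\<^sup>2 \<partial>gaussian \<gamma>) = (\<integral>x. (v x \<bullet> a)\<^sup>2 \<partial>lborel) / Z"
    unfolding f_def e2 gaussian_integral_dressed(1)[OF \<gamma> m1(1)] Z_def by (simp add: divide_inverse mult.commute)
  have D2: "(norm (D x))\<^sup>2 = exp (\<gamma> * (norm x)\<^sup>2) *\<^sub>R (\<Sum>i\<in>UNIV. (?W i x \<bullet> a)\<^sup>2)" for x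
    unfolding vec_norm_power2[of "D x"] by (simp only: D_def vec_lambda_beta e2 scaleR_sum_right)
  have W2i: "integrable lborel (\<lambda>x. (?W i x \<bullet> a)\<^sup>2)" for i
    by (rule continuous_compact_integrable[where R=R]) (use W(1,2) R in \<open>auto intro!: continuous_intros\<close>)
  have I2: "(\<integral>x. 2 * (norm (D x))\<^sup>2 \<partial>gaussian \<gamma>) = 2 * ((\<Sum>i\<in>UNIV. (\<integral>x. (?W i x \<bullet> a)\<^sup>2 \<partial>lborel)) / Z)"
    unfolding D2 integral_mult_right_zero gaussian_integral_dressed(1)[OF \<gamma> m1(2)] Z_def
    using W2i by (simp add: divide_inverse mult.commute)
  have fe: "f x = exp (\<gamma> * (norm x)\<^sup>2) *\<^sub>R (exp (- (\<gamma>/2) * (norm x)\<^sup>2) * (v x \<bullet> a))" for x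
  proof -
    have "exp ((\<gamma>/2) * (norm x)\<^sup>2) = exp (\<gamma> * (norm x)\<^sup>2) * exp (- (\<gamma>/2) * (norm x)\<^sup>2)"
      unfolding exp_add[symmetric] by simp
    then show ?thesis by (simp only: f_def mult.assoc real_scaleR_def)
  qed
  have I3: "(\<integral>x. f x \<partial>gaussian \<gamma>) = (\<integral>x. exp (- (\<gamma>/2) * (norm x)\<^sup>2) * (v x \<bullet> a) \<partial>lborel) / Z"
    unfolding fe gaussian_integral_dressed(1)[OF \<gamma> m1(3)] Z_def
    by (simp only: real_scaleR_def divide_inverse mult.commute)
  have Z: "Z > 0" unfolding Z_def by (rule gauss_mass_pos[OF \<gamma>])
  have alg: "A - B\<^sup>2 / Z \<le> S / (2 * \<gamma>)" if "A / Z - (B / Z)\<^sup>2 \<le> 2 * (S / Z) / (4 * \<gamma>)" for A B S :: real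
  proof -
    have "(A / Z - (B / Z)\<^sup>2) * Z \<le> 2 * (S / Z) / (4 * \<gamma>) * Z" using that Z by (intro mult_right_mono) auto
    moreover have "(A / Z - (B / Z)\<^sup>2) * Z = A - B\<^sup>2 / Z" using Z by (simp add: power2_eq_square left_diff_distrib)
    moreover have "2 * (S / Z) / (4 * \<gamma>) * Z = S / (2 * \<gamma>)" using Z \<gamma> by simp
    ultimately show ?thesis by simp
  qed
  show ?thesis by (rule alg[OF phi[unfolded I1 I2 I3]])
qed

section \<open>Inequalities for weakly differentiable functions\<close>

lemma sq_int_nth_mult:
  fixes u :: "real ^ 'n::finite \<Rightarrow> complex"
  assumes u: "sq_int lborel u" and xu: "sq_int lborel (\<lambda>x. norm x *\<^sub>R u x)"
  shows "sq_int lborel (\<lambda>x. of_real (\<gamma> * x $ i) * u x)"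
    and "l2 lborel (\<lambda>x. of_real (\<gamma> * x $ i) * u x) \<le> \<bar>\<gamma>\<bar> * l2 lborel (\<lambda>x. norm x *\<^sub>R u x)"
proof -
  have [measurable]: "u \<in> borel_measurable borel" using sq_int_measurable[OF u] by simp
  have m: "(\<lambda>x. of_real (\<gamma> * x $ i) * u x) \<in> borel_measurable lborel" by measurable
  have b: "AE x in lborel. norm (of_real (\<gamma> * x $ i) * u x) \<le> \<bar>\<gamma>\<bar> * norm (norm x *\<^sub>R u x)"
  proof (rule AE_I2)
    fix x :: "real ^ 'n"
    have "\<bar>\<gamma>\<bar> * \<bar>x $ i\<bar> * norm (u x) \<le> \<bar>\<gamma>\<bar> * norm x * norm (u x)"
      by (intro mult_right_mono mult_left_mono component_le_norm_cart) auto
    then show "norm (of_real (\<gamma> * x $ i) * u x) \<le> \<bar>\<gamma>\<bar> * norm (norm x *\<^sub>R u x)"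
      by (simp add: norm_mult abs_mult mult.assoc)
  qed
  show "sq_int lborel (\<lambda>x. of_real (\<gamma> * x $ i) * u x)" by (rule sq_int_bound(1)[OF xu m b])
  show "l2 lborel (\<lambda>x. of_real (\<gamma> * x $ i) * u x) \<le> \<bar>\<gamma>\<bar> * l2 lborel (\<lambda>x. norm x *\<^sub>R u x)"
    using sq_int_bound(2)[OF xu m b] by simp
qed

lemma sq_int_twisted:
  assumes wg: "weak_grad u g" and xu: "sq_int lborel (\<lambda>x. norm x *\<^sub>R u x)"
  shows "sq_int lborel (twisted_gradient \<gamma> u g i)"
  unfolding twisted_gradient_def[abs_def] using wg
  by (intro sq_int_add sq_int_nth_mult(1) xu) (auto simp: weak_grad_def intro: sq_int_vec_component)

lemma c1_compact_sq_int:
  assumes "c1_compact v Dv"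
  shows "sq_int lborel v" "sq_int lborel (\<lambda>x. Dv x $ i)" "sq_int lborel (\<lambda>x. norm x *\<^sub>R v x)"
proof -
  obtain R where R: "R > 0" "\<And>x. norm x \<ge> R \<Longrightarrow> v x = 0" "\<And>x. norm x \<ge> R \<Longrightarrow> Dv x = 0" by (rule c1_compactE[OF assms]) blast
  note cont = c1_compact_continuous[OF assms]
  show "sq_int lborel v" "sq_int lborel (\<lambda>x. Dv x $ i)" "sq_int lborel (\<lambda>x. norm x *\<^sub>R v x)"
    by (rule continuous_compact_sq_int[where R=R]; use cont R in \<open>auto intro!: continuous_intros\<close>)+
qed

text \<open>
  The limits through which the inequalities for smooth functions pass to \<open>u\<close>.
\<close>

lemma c1_compact_approximation:
  fixes u :: "real ^ 'n::finite \<Rightarrow> complex"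
  assumes wg: "weak_grad u g" and xu: "sq_int lborel (\<lambda>x. norm x *\<^sub>R u x)"
  obtains v Dv where "\<And>n::nat. c1_compact (v n) (Dv n)"
    "(\<lambda>n. l2 lborel (\<lambda>x. v n x - u x)) \<longlonglongrightarrow> 0"
    "(\<lambda>n. l2 lborel (v n)) \<longlonglongrightarrow> l2 lborel u"
    "(\<lambda>n. l2 lborel (\<lambda>x. norm x *\<^sub>R v n x)) \<longlonglongrightarrow> l2 lborel (\<lambda>x. norm x *\<^sub>R u x)"
    "\<And>i. (\<lambda>n. l2 lborel (\<lambda>x. Dv n x $ i)) \<longlonglongrightarrow> l2 lborel (\<lambda>x. g x $ i)"
    "\<And>i \<gamma>. (\<lambda>n. l2 lborel (twisted_gradient \<gamma> (v n) (Dv n) i)) \<longlonglongrightarrow> l2 lborel (twisted_gradient \<gamma> u g i)"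
proof -
  obtain v Dv where v: "\<And>n::nat. c1_compact (v n) (Dv n)"
    and lim: "(\<lambda>n. l2 lborel (\<lambda>x. v n x - u x)) \<longlonglongrightarrow> 0"
    "(\<lambda>n. l2 lborel (\<lambda>x. norm x *\<^sub>R (v n x - u x))) \<longlonglongrightarrow> 0"
    "\<And>i. (\<lambda>n. l2 lborel (\<lambda>x. Dv n x $ i - g x $ i)) \<longlonglongrightarrow> 0"
    by (rule c1_compact_dense[OF wg xu]) blast
  note s = c1_compact_sq_int[OF v]
  have u: "sq_int lborel u" and gi: "sq_int lborel (\<lambda>x. g x $ i)" for i using wg by (auto simp: weak_grad_def intro: sq_int_vec_component)
  show thesis
  proof (rule that[OF v lim(1)])
    show "(\<lambda>n. l2 lborel (v n)) \<longlonglongrightarrow> l2 lborel u" by (rule l2_tendsto[OF s(1) u lim(1)])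
    show "(\<lambda>n. l2 lborel (\<lambda>x. norm x *\<^sub>R v n x)) \<longlonglongrightarrow> l2 lborel (\<lambda>x. norm x *\<^sub>R u x)"
      using lim(2) by (intro l2_tendsto[OF s(3) xu]) (simp add: scaleR_diff_right)
    show "(\<lambda>n. l2 lborel (\<lambda>x. Dv n x $ i)) \<longlonglongrightarrow> l2 lborel (\<lambda>x. g x $ i)" for i by (rule l2_tendsto[OF s(2) gi lim(3)])
    show "(\<lambda>n. l2 lborel (twisted_gradient \<gamma> (v n) (Dv n) i)) \<longlonglongrightarrow> l2 lborel (twisted_gradient \<gamma> u g i)" for i \<gamma>
    proof (rule l2_tendsto[OF c1_compact_twisted(3)[OF v] sq_int_twisted[OF wg xu]])
      have "(\<lambda>n. l2 lborel (\<lambda>x. Dv n x $ i - g x $ i) + \<bar>\<gamma>\<bar> * l2 lborel (\<lambda>x. norm x *\<^sub>R (v n x - u x))) \<longlonglongrightarrow> 0 + \<bar>\<gamma>\<bar> * 0"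
        by (intro tendsto_intros lim)
      then have "(\<lambda>n. l2 lborel (\<lambda>x. Dv n x $ i - g x $ i) + \<bar>\<gamma>\<bar> * l2 lborel (\<lambda>x. norm x *\<^sub>R (v n x - u x))) \<longlonglongrightarrow> 0" by simp
      then show "(\<lambda>n. l2 lborel (\<lambda>x. twisted_gradient \<gamma> (v n) (Dv n) i x - twisted_gradient \<gamma> u g i x)) \<longlonglongrightarrow> 0"
      proof (rule Lim_null_comparison[rotated], intro always_eventually allI)
        fix n
        have d: "sq_int lborel (\<lambda>x. v n x - u x)" and xd: "sq_int lborel (\<lambda>x. norm x *\<^sub>R (v n x - u x))"
          using sq_int_diff[OF s(1) u] sq_int_diff[OF s(3) xu] by (simp_all add: scaleR_diff_right)
        have "l2 lborel (\<lambda>x. (Dv n x $ i - g x $ i) + of_real (\<gamma> * x $ i) * (v n x - u x))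
            \<le> l2 lborel (\<lambda>x. Dv n x $ i - g x $ i) + l2 lborel (\<lambda>x. of_real (\<gamma> * x $ i) * (v n x - u x))"
          by (rule l2_triangle[OF sq_int_diff[OF s(2) gi] sq_int_nth_mult(1)[OF d xd]])
        also have "(\<lambda>x. (Dv n x $ i - g x $ i) + of_real (\<gamma> * x $ i) * (v n x - u x)) = (\<lambda>x. twisted_gradient \<gamma> (v n) (Dv n) i x - twisted_gradient \<gamma> u g i x)"
          by (simp add: twisted_gradient_def algebra_simps fun_eq_iff)
        finally show "norm (l2 lborel (\<lambda>x. twisted_gradient \<gamma> (v n) (Dv n) i x - twisted_gradient \<gamma> u g i x))
            \<le> l2 lborel (\<lambda>x. Dv n x $ i - g x $ i) + \<bar>\<gamma>\<bar> * l2 lborel (\<lambda>x. norm x *\<^sub>R (v n x - u x))"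
          using sq_int_nth_mult(2)[OF d xd, of \<gamma> i] by simp
      qed
    qed
  qed
qed

definition twisted_energy :: "real \<Rightarrow> (real ^ 'n::finite \<Rightarrow> complex) \<Rightarrow> (real ^ 'n \<Rightarrow> complex ^ 'n) \<Rightarrow> real" where
  "twisted_energy \<gamma> u g = (\<Sum>i\<in>UNIV. (l2 lborel (twisted_gradient \<gamma> u g i))\<^sup>2)"

theorem weak_grad_uncertainty:
  fixes u :: "real ^ 'n::finite \<Rightarrow> complex"
  assumes wg: "weak_grad u g" and xu: "sq_int lborel (\<lambda>x. norm x *\<^sub>R u x)"
  shows "twisted_energy \<gamma> u g
    = (\<Sum>i\<in>UNIV. (l2 lborel (\<lambda>x. g x $ i))\<^sup>2) + \<gamma>\<^sup>2 * (l2 lborel (\<lambda>x. norm x *\<^sub>R u x))\<^sup>2 - \<gamma> * real CARD('n) * (l2 lborel u)\<^sup>2"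
proof -
  obtain v Dv where v: "\<And>n::nat. c1_compact (v n) (Dv n)"
    and lim: "(\<lambda>n. l2 lborel (v n)) \<longlonglongrightarrow> l2 lborel u"
    "(\<lambda>n. l2 lborel (\<lambda>x. norm x *\<^sub>R v n x)) \<longlonglongrightarrow> l2 lborel (\<lambda>x. norm x *\<^sub>R u x)"
    "\<And>i. (\<lambda>n. l2 lborel (\<lambda>x. Dv n x $ i)) \<longlonglongrightarrow> l2 lborel (\<lambda>x. g x $ i)"
    "\<And>i \<gamma>. (\<lambda>n. l2 lborel (twisted_gradient \<gamma> (v n) (Dv n) i)) \<longlonglongrightarrow> l2 lborel (twisted_gradient \<gamma> u g i)"
    by (rule c1_compact_approximation[OF wg xu]) blast
  have "(\<lambda>n. (\<Sum>i\<in>UNIV. (l2 lborel (twisted_gradient \<gamma> (v n) (Dv n) i))\<^sup>2)) \<longlonglongrightarrow> twisted_energy \<gamma> u g"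
    unfolding twisted_energy_def by (intro tendsto_intros lim)
  moreover have "(\<lambda>n. (\<Sum>i\<in>UNIV. (l2 lborel (twisted_gradient \<gamma> (v n) (Dv n) i))\<^sup>2)) \<longlonglongrightarrow>
      (\<Sum>i\<in>UNIV. (l2 lborel (\<lambda>x. g x $ i))\<^sup>2) + \<gamma>\<^sup>2 * (l2 lborel (\<lambda>x. norm x *\<^sub>R u x))\<^sup>2 - \<gamma> * real CARD('n) * (l2 lborel u)\<^sup>2"
    unfolding c1_compact_uncertainty[OF v] by (intro tendsto_intros lim)
  ultimately show ?thesis by (rule LIMSEQ_unique)
qed

lemma sq_int_gauss:
  assumes "\<gamma> > 0"
  shows "sq_int lborel (\<lambda>x::'a::euclidean_space. exp (- (\<gamma>/2) * (norm x)\<^sup>2))"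
    and "(l2 lborel (\<lambda>x::'a. exp (- (\<gamma>/2) * (norm x)\<^sup>2)))\<^sup>2 = gauss_mass TYPE('a) \<gamma>"
proof -
  have e: "(norm (exp (- (\<gamma>/2) * (norm x)\<^sup>2)))\<^sup>2 = exp (- \<gamma> * (norm x)\<^sup>2)" for x :: 'a
    by (simp add: exp_double[symmetric])
  show "sq_int lborel (\<lambda>x::'a. exp (- (\<gamma>/2) * (norm x)\<^sup>2))"
    unfolding sq_int_def e using integrable_gauss[OF assms] by simp
  show "(l2 lborel (\<lambda>x::'a. exp (- (\<gamma>/2) * (norm x)\<^sup>2)))\<^sup>2 = gauss_mass TYPE('a) \<gamma>"
    unfolding l2_power2 e ..
qed

lemma sq_int_scaleR_integrable:
  fixes u :: "'a \<Rightarrow> complex" and p :: "'a \<Rightarrow> real"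
  assumes p: "sq_int M p" and u: "sq_int M u"
  shows "integrable M (\<lambda>x. p x *\<^sub>R u x)" "norm (\<integral>x. p x *\<^sub>R u x \<partial>M) \<le> l2 M p * l2 M u"
proof -
  have m: "(\<lambda>x. p x *\<^sub>R u x) \<in> borel_measurable M"
    using sq_int_measurable[OF p] sq_int_measurable[OF u] by (rule borel_measurable_scaleR)
  have "integrable M (\<lambda>x. norm (p x *\<^sub>R u x))" using sq_int_prod_integrable[OF p u] by simp
  with m show "integrable M (\<lambda>x. p x *\<^sub>R u x)" by (simp only: integrable_norm_iff)
  have "norm (\<integral>x. p x *\<^sub>R u x \<partial>M) \<le> (\<integral>x. norm (p x *\<^sub>R u x) \<partial>M)" by (rule integral_norm_bound)
  also have "\<dots> \<le> l2 M p * l2 M u" using cauchy_schwarz_l2[OF p u] by simp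
  finally show "norm (\<integral>x. p x *\<^sub>R u x \<partial>M) \<le> l2 M p * l2 M u" .
qed

lemma c1_compact_poincare:
  fixes v :: "real ^ 'n::finite \<Rightarrow> complex"
  assumes \<gamma>: "\<gamma> > 0" and c: "c1_compact v Dv"
  shows "(l2 lborel v)\<^sup>2 - (norm (\<integral>x. exp (- (\<gamma>/2) * (norm x)\<^sup>2) *\<^sub>R v x \<partial>lborel))\<^sup>2 / gauss_mass TYPE(real^'n) \<gamma>
     \<le> twisted_energy \<gamma> v Dv / (2 * \<gamma>)"
proof -
  let ?Z = "gauss_mass TYPE(real^'n) \<gamma>"
  let ?p = "\<lambda>x::real^'n. exp (- (\<gamma>/2) * (norm x)\<^sup>2)"
  have split: "(l2 lborel w)\<^sup>2 = (\<integral>x. (w x \<bullet> 1)\<^sup>2 \<partial>lborel) + (\<integral>x. (w x \<bullet> \<i>)\<^sup>2 \<partial>lborel)"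
    if "sq_int lborel w" for w :: "real ^ 'n \<Rightarrow> complex"
  proof -
    note m = sq_int_measurable[OF that]
    have c2: "(norm z)\<^sup>2 = (z \<bullet> 1)\<^sup>2 + (z \<bullet> \<i>)\<^sup>2" for z :: complex by (simp add: cmod_power2 inner_complex_def)
    have i: "integrable lborel (\<lambda>x. (norm (w x))\<^sup>2)" using that by (simp add: sq_int_def)
    have "integrable lborel (\<lambda>x. (w x \<bullet> 1)\<^sup>2)" "integrable lborel (\<lambda>x. (w x \<bullet> \<i>)\<^sup>2)"
      by (rule Bochner_Integration.integrable_bound[OF i]; use m in \<open>auto simp: c2 intro!: AE_I2\<close>)+
    then show ?thesis by (simp add: l2_power2 c2)
  qed
  have pv: "integrable lborel (\<lambda>x. ?p x *\<^sub>R v x)"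
    by (rule sq_int_scaleR_integrable(1)[OF sq_int_gauss(1)[OF \<gamma>] c1_compact_sq_int(1)[OF c]])
  have P: "(norm (\<integral>x. ?p x *\<^sub>R v x \<partial>lborel))\<^sup>2 = (\<integral>x. ?p x * (v x \<bullet> 1) \<partial>lborel)\<^sup>2 + (\<integral>x. ?p x * (v x \<bullet> \<i>) \<partial>lborel)\<^sup>2"
    using pv by (simp add: cmod_power2 inner_complex_def integral_Re[symmetric] integral_Im[symmetric] del: integral_Re integral_Im)
  have "(l2 lborel v)\<^sup>2 - (norm (\<integral>x. ?p x *\<^sub>R v x \<partial>lborel))\<^sup>2 / ?Z
     = ((\<integral>x. (v x \<bullet> 1)\<^sup>2 \<partial>lborel) - (\<integral>x. ?p x * (v x \<bullet> 1) \<partial>lborel)\<^sup>2 / ?Z)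
     + ((\<integral>x. (v x \<bullet> \<i>)\<^sup>2 \<partial>lborel) - (\<integral>x. ?p x * (v x \<bullet> \<i>) \<partial>lborel)\<^sup>2 / ?Z)"
    unfolding split[OF c1_compact_sq_int(1)[OF c]] P by (simp add: add_divide_distrib)
  also have "\<dots> \<le> (\<Sum>i\<in>UNIV. (\<integral>x. (twisted_gradient \<gamma> v Dv i x \<bullet> 1)\<^sup>2 \<partial>lborel)) / (2 * \<gamma>) + (\<Sum>i\<in>UNIV. (\<integral>x. (twisted_gradient \<gamma> v Dv i x \<bullet> \<i>)\<^sup>2 \<partial>lborel)) / (2 * \<gamma>)"
    by (intro add_mono c1_compact_poincare_component[OF \<gamma> c])
  also have "\<dots> = twisted_energy \<gamma> v Dv / (2 * \<gamma>)"
    unfolding twisted_energy_def split[OF c1_compact_twisted(3)[OF c]] by (simp add: sum.distrib add_divide_distrib)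
  finally show ?thesis .
qed

theorem weak_grad_poincare:
  fixes u :: "real ^ 'n::finite \<Rightarrow> complex"
  assumes \<gamma>: "\<gamma> > 0" and wg: "weak_grad u g" and xu: "sq_int lborel (\<lambda>x. norm x *\<^sub>R u x)"
  shows "(l2 lborel u)\<^sup>2 - (norm (\<integral>x. exp (- (\<gamma>/2) * (norm x)\<^sup>2) *\<^sub>R u x \<partial>lborel))\<^sup>2 / gauss_mass TYPE(real^'n) \<gamma>
     \<le> twisted_energy \<gamma> u g / (2 * \<gamma>)"
proof -
  let ?Z = "gauss_mass TYPE(real^'n) \<gamma>"
  let ?p = "\<lambda>x::real^'n. exp (- (\<gamma>/2) * (norm x)\<^sup>2)"
  obtain v Dv where v: "\<And>n::nat. c1_compact (v n) (Dv n)"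
    and lim: "(\<lambda>n. l2 lborel (\<lambda>x. v n x - u x)) \<longlonglongrightarrow> 0" "(\<lambda>n. l2 lborel (v n)) \<longlonglongrightarrow> l2 lborel u"
    "\<And>i \<gamma>. (\<lambda>n. l2 lborel (twisted_gradient \<gamma> (v n) (Dv n) i)) \<longlonglongrightarrow> l2 lborel (twisted_gradient \<gamma> u g i)"
    by (rule c1_compact_approximation[OF wg xu]) blast
  have u: "sq_int lborel u" using wg by (simp add: weak_grad_def)
  note p = sq_int_gauss(1)[OF \<gamma>, where 'a="real^'n"]
  have I: "(\<lambda>n. \<integral>x. ?p x *\<^sub>R v n x \<partial>lborel) \<longlonglongrightarrow> (\<integral>x. ?p x *\<^sub>R u x \<partial>lborel)"
  proof (rule LIM_zero_cancel, rule Lim_null_comparison)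
    show "(\<lambda>n. l2 lborel ?p * l2 lborel (\<lambda>x. v n x - u x)) \<longlonglongrightarrow> 0"
      using tendsto_mult[OF tendsto_const lim(1), of "l2 lborel ?p"] by simp
    have "(\<integral>x. ?p x *\<^sub>R v n x \<partial>lborel) - (\<integral>x. ?p x *\<^sub>R u x \<partial>lborel) = (\<integral>x. ?p x *\<^sub>R (v n x - u x) \<partial>lborel)" for n
      using sq_int_scaleR_integrable(1)[OF p c1_compact_sq_int(1)[OF v]] sq_int_scaleR_integrable(1)[OF p u]
      by (simp add: scaleR_diff_right)
    then show "\<forall>\<^sub>F n in sequentially. norm ((\<integral>x. ?p x *\<^sub>R v n x \<partial>lborel) - (\<integral>x. ?p x *\<^sub>R u x \<partial>lborel)) \<le> l2 lborel ?p * l2 lborel (\<lambda>x. v n x - u x)"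
      using sq_int_scaleR_integrable(2)[OF p sq_int_diff[OF c1_compact_sq_int(1)[OF v] u]] by simp
  qed
  have "(\<lambda>n. twisted_energy \<gamma> (v n) (Dv n) / (2 * \<gamma>)) \<longlonglongrightarrow> twisted_energy \<gamma> u g / (2 * \<gamma>)"
    unfolding twisted_energy_def using \<gamma> by (intro tendsto_intros lim) auto
  moreover have "(\<lambda>n. (l2 lborel (v n))\<^sup>2 - (norm (\<integral>x. ?p x *\<^sub>R v n x \<partial>lborel))\<^sup>2 / ?Z) \<longlonglongrightarrow> (l2 lborel u)\<^sup>2 - (norm (\<integral>x. ?p x *\<^sub>R u x \<partial>lborel))\<^sup>2 / ?Z"
    using gauss_mass_pos[OF \<gamma>, where 'a="real^'n"] by (intro tendsto_intros lim I) auto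
  ultimately show ?thesis
    by (rule tendsto_le[OF sequentially_bot]) (intro always_eventually allI c1_compact_poincare[OF \<gamma> v])
qed

lemma continuous_mult_ln: "continuous_on {0..} (\<lambda>t::real. t * ln t)"
  unfolding continuous_on_eq_continuous_within
proof
  fix t :: real assume t: "t \<in> {0..}"
  show "continuous (at t within {0..}) (\<lambda>t. t * ln t)"
  proof (cases "t = 0")
    case True
    have "((\<lambda>t::real. t * ln t) \<longlongrightarrow> 0) (at_right 0)" by real_asymp
    then show ?thesis using True by (simp add: continuous_within at_within_Ici_at_right)
  next
    case False
    then show ?thesis by (intro continuous_intros) auto
  qed
qed

lemma mult_ln_ge: "t * ln t \<ge> - 1" if "t \<ge> 0" for t :: real
proof (cases "t = 0")
  case False
  then have "t > 0" using that by simp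
  then have "ln (1 / t) \<le> 1 / t" using ln_le_minus_one[of "1 / t"] by simp
  then have "t * (- ln t) \<le> t * (1 / t)" using \<open>t > 0\<close> by (intro mult_left_mono) (auto simp: ln_div)
  then show ?thesis using \<open>t > 0\<close> by simp
qed simp

text \<open>
  Along an almost everywhere convergent subsequence of smooth approximations, Fatou's lemma
  transfers the upper bound for the entropy, because \<open>t ln t \<ge> - 1\<close> and the Gaussian measure
  is finite. A finite entropy means that the logarithmic term is integrable.
\<close>

theorem weak_grad_log_sobolev:
  fixes u :: "real ^ 'n::finite \<Rightarrow> complex"
  assumes \<gamma>: "\<gamma> > 0" and wg: "weak_grad u g" and xu: "sq_int lborel (\<lambda>x. norm x *\<^sub>R u x)"
  shows "integrable lborel (\<lambda>x. (norm (u x))\<^sup>2 * ln ((norm (u x))\<^sup>2))"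
    and "(\<integral>x. (norm (u x))\<^sup>2 * ln ((norm (u x))\<^sup>2) \<partial>lborel) + \<gamma> * (l2 lborel (\<lambda>x. norm x *\<^sub>R u x))\<^sup>2
      \<le> (l2 lborel u)\<^sup>2 * ln ((l2 lborel u)\<^sup>2 / gauss_mass TYPE(real^'n) \<gamma>) + twisted_energy \<gamma> u g / \<gamma>"
proof -
  define Z where "Z = gauss_mass TYPE(real^'n) \<gamma>"
  have Z: "Z > 0" unfolding Z_def by (rule gauss_mass_pos[OF \<gamma>])
  obtain v Dv where v: "\<And>n::nat. c1_compact (v n) (Dv n)"
    and lim: "(\<lambda>n. l2 lborel (\<lambda>x. v n x - u x)) \<longlonglongrightarrow> 0" "(\<lambda>n. l2 lborel (v n)) \<longlonglongrightarrow> l2 lborel u"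
    "\<And>i \<gamma>. (\<lambda>n. l2 lborel (twisted_gradient \<gamma> (v n) (Dv n) i)) \<longlonglongrightarrow> l2 lborel (twisted_gradient \<gamma> u g i)"
    by (rule c1_compact_approximation[OF wg xu]) blast
  have u: "sq_int lborel u" using wg by (simp add: weak_grad_def)
  note sv = c1_compact_sq_int(1)[OF v]
  have [measurable]: "u \<in> borel_measurable borel" "\<And>n. v n \<in> borel_measurable borel"
    using sq_int_measurable[OF u] sq_int_measurable[OF sv] by simp_all
  have d: "integrable lborel (\<lambda>x. (norm (v n x - u x))\<^sup>2)" for n using sq_int_diff[OF sv u] by (simp add: sq_int_def)
  have "(\<lambda>n. (\<integral>x. norm ((norm (v n x - u x))\<^sup>2) \<partial>lborel)) \<longlonglongrightarrow> 0"
    using tendsto_power[OF lim(1), of 2] by (simp add: l2_power2)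
  then obtain r where r: "strict_mono r" and ae: "AE x in lborel. (\<lambda>n. (norm (v (r n) x - u x))\<^sup>2) \<longlonglongrightarrow> 0"
    using tendsto_L1_AE_subseq[where u="\<lambda>n x. (norm (v n x - u x))\<^sup>2", OF d] by blast
  let ?e = "\<lambda>n. inverse (real (Suc (r n)))"
  have e0: "?e \<longlonglongrightarrow> 0" using LIMSEQ_subseq_LIMSEQ[OF LIMSEQ_inverse_real_of_nat r] by (simp add: comp_def)
  define f where "f n x = exp (\<gamma> * (norm x)\<^sup>2) * (norm (v (r n) x))\<^sup>2 + ?e n" for n x
  define f0 where "f0 x = exp (\<gamma> * (norm x)\<^sup>2) * (norm (u x))\<^sup>2" for x
  have fm[measurable]: "f n \<in> borel_measurable borel" "f0 \<in> borel_measurable borel" for n unfolding f_def f0_def by measurable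
  have fnn: "f n x \<ge> 0" "f0 x \<ge> 0" for n x by (auto simp: f_def f0_def)
  have "AE x in lborel. (\<lambda>n. f n x * ln (f n x)) \<longlonglongrightarrow> f0 x * ln (f0 x)"
    using ae
  proof eventually_elim
    case (elim x)
    then have "(\<lambda>n. sqrt ((norm (v (r n) x - u x))\<^sup>2)) \<longlonglongrightarrow> sqrt 0" by (intro tendsto_real_sqrt)
    then have "(\<lambda>n. v (r n) x - u x) \<longlonglongrightarrow> 0" by (simp add: tendsto_norm_zero_iff)
    then have "(\<lambda>n. v (r n) x) \<longlonglongrightarrow> u x" by (rule LIM_zero_cancel)
    then have "(\<lambda>n. f n x) \<longlonglongrightarrow> exp (\<gamma> * (norm x)\<^sup>2) * (norm (u x))\<^sup>2 + 0" unfolding f_def by (intro tendsto_intros e0)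
    then have "(\<lambda>n. f n x) \<longlonglongrightarrow> f0 x" by (simp add: f0_def)
    from continuous_on_tendsto_compose[OF continuous_mult_ln this] show ?case using fnn by simp
  qed
  then have ptw: "AE x in gaussian \<gamma>. (\<lambda>n. f n x * ln (f n x)) \<longlonglongrightarrow> f0 x * ln (f0 x)"
    unfolding gaussian_def by (subst AE_density) auto
  interpret prob_space "gaussian \<gamma> :: (real^'n) measure" by (rule prob_space_gaussian[OF \<gamma>])
  define b where "b n = ((l2 lborel (v (r n)))\<^sup>2 / Z + ?e n) * ln ((l2 lborel (v (r n)))\<^sup>2 / Z + ?e n) + twisted_energy \<gamma> (v (r n)) (Dv (r n)) / (\<gamma> * Z)" for n
  define b0 where "b0 = ((l2 lborel u)\<^sup>2 / Z) * ln ((l2 lborel u)\<^sup>2 / Z) + twisted_energy \<gamma> u g / (\<gamma> * Z)"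
  have bl: "b \<longlonglongrightarrow> b0"
    unfolding b_def b0_def twisted_energy_def
  proof (intro tendsto_add)
    have "(\<lambda>n. (l2 lborel (v (r n)))\<^sup>2 / Z + ?e n) \<longlonglongrightarrow> (l2 lborel u)\<^sup>2 / Z + 0"
      using Z by (intro tendsto_intros e0 LIMSEQ_subseq_LIMSEQ[OF lim(2) r, unfolded comp_def]) auto
    then have "(\<lambda>n. (l2 lborel (v (r n)))\<^sup>2 / Z + ?e n) \<longlonglongrightarrow> (l2 lborel u)\<^sup>2 / Z" by simp
    from continuous_on_tendsto_compose[OF continuous_mult_ln this]
    show "(\<lambda>n. ((l2 lborel (v (r n)))\<^sup>2 / Z + ?e n) * ln ((l2 lborel (v (r n)))\<^sup>2 / Z + ?e n)) \<longlonglongrightarrow> ((l2 lborel u)\<^sup>2 / Z) * ln ((l2 lborel u)\<^sup>2 / Z)"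
      using Z by simp
    show "(\<lambda>n. (\<Sum>i\<in>UNIV. (l2 lborel (twisted_gradient \<gamma> (v (r n)) (Dv (r n)) i))\<^sup>2) / (\<gamma> * Z)) \<longlonglongrightarrow> (\<Sum>i\<in>UNIV. (l2 lborel (twisted_gradient \<gamma> u g i))\<^sup>2) / (\<gamma> * Z)"
      using Z \<gamma> by (intro tendsto_intros LIMSEQ_subseq_LIMSEQ[OF lim(3) r, unfolded comp_def]) auto
  qed
  have LS: "integrable (gaussian \<gamma>) (\<lambda>x. f n x * ln (f n x))" "(\<integral>x. f n x * ln (f n x) \<partial>gaussian \<gamma>) \<le> b n" for n
    using c1_compact_log_sobolev[OF \<gamma> v[of "r n"], of "?e n"] unfolding f_def b_def Z_def twisted_energy_def by auto
  have nonneg: "0 \<le> f n x * ln (f n x) + 1" "0 \<le> f0 x * ln (f0 x) + 1" for n x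
    using mult_ln_ge[OF fnn(1)[of n x]] mult_ln_ge[OF fnn(2)[of x]] by linarith+
  have bn: "b n + 1 \<ge> 0" for n
  proof -
    have "0 \<le> (\<integral>x. f n x * ln (f n x) + 1 \<partial>gaussian \<gamma>)" using nonneg by (intro integral_nonneg_AE) auto
    also have "\<dots> \<le> b n + 1" using LS[of n] prob_space by simp
    finally show ?thesis .
  qed
  then have b0: "b0 + 1 \<ge> 0" by (intro LIMSEQ_le_const[OF tendsto_add[OF bl tendsto_const]]) auto
  have fin: "(\<integral>\<^sup>+x. ennreal (f0 x * ln (f0 x) + 1) \<partial>gaussian \<gamma>) \<le> ennreal (b0 + 1)"
  proof -
    have "(\<integral>\<^sup>+x. ennreal (f0 x * ln (f0 x) + 1) \<partial>gaussian \<gamma>) \<le> (\<integral>\<^sup>+x. liminf (\<lambda>n. ennreal (f n x * ln (f n x) + 1)) \<partial>gaussian \<gamma>)"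
    proof (rule nn_integral_mono_AE)
      show "AE x in gaussian \<gamma>. ennreal (f0 x * ln (f0 x) + 1) \<le> liminf (\<lambda>n. ennreal (f n x * ln (f n x) + 1))"
        using ptw
      proof eventually_elim
        case (elim x)
        then have "(\<lambda>n. ennreal (f n x * ln (f n x) + 1)) \<longlonglongrightarrow> ennreal (f0 x * ln (f0 x) + 1)"
          by (intro tendsto_ennrealI tendsto_add[OF _ tendsto_const])
        then show ?case by (simp add: lim_imp_Liminf)
      qed
    qed
    also have "\<dots> \<le> liminf (\<lambda>n. \<integral>\<^sup>+x. ennreal (f n x * ln (f n x) + 1) \<partial>gaussian \<gamma>)"
      by (rule nn_integral_liminf) measurable
    also have "\<dots> \<le> liminf (\<lambda>n. ennreal (b n + 1))"
    proof (intro Liminf_mono always_eventually allI)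
      fix n
      have "(\<integral>\<^sup>+x. ennreal (f n x * ln (f n x) + 1) \<partial>gaussian \<gamma>) = ennreal (\<integral>x. f n x * ln (f n x) + 1 \<partial>gaussian \<gamma>)"
        using LS(1)[of n] nonneg by (intro nn_integral_eq_integral) auto
      also have "\<dots> \<le> ennreal (b n + 1)" using LS[of n] prob_space by (intro ennreal_leI) simp
      finally show "(\<integral>\<^sup>+x. ennreal (f n x * ln (f n x) + 1) \<partial>gaussian \<gamma>) \<le> ennreal (b n + 1)" .
    qed
    also have "\<dots> = ennreal (b0 + 1)"
      by (intro lim_imp_Liminf tendsto_ennrealI tendsto_add[OF bl tendsto_const]) simp
    finally show ?thesis .
  qed
  have int1: "integrable (gaussian \<gamma>) (\<lambda>x. f0 x * ln (f0 x) + 1)"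
    using fin nonneg by (intro integrableI_nonneg) (auto intro: le_less_trans)
  have int0: "integrable (gaussian \<gamma>) (\<lambda>x. f0 x * ln (f0 x))"
    using Bochner_Integration.integrable_diff[OF int1, of "\<lambda>_. 1"] by simp
  have "ennreal (\<integral>x. f0 x * ln (f0 x) + 1 \<partial>gaussian \<gamma>) \<le> ennreal (b0 + 1)"
    using fin nn_integral_eq_integral[OF int1] nonneg by simp
  then have "(\<integral>x. f0 x * ln (f0 x) + 1 \<partial>gaussian \<gamma>) \<le> b0 + 1" using b0 by (simp add: ennreal_le_iff)
  then have le: "(\<integral>x. f0 x * ln (f0 x) \<partial>gaussian \<gamma>) \<le> b0" using int0 prob_space by simp
  define F where "F x = (norm (u x))\<^sup>2 * ln ((norm (u x))\<^sup>2) + \<gamma> * ((norm x)\<^sup>2 * (norm (u x))\<^sup>2)" for x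
  have Fm: "F \<in> borel_measurable borel" unfolding F_def by measurable
  have "f0 x * ln (f0 x) = exp (\<gamma> * (norm x)\<^sup>2) *\<^sub>R F x" for x
    by (cases "u x = 0") (simp_all add: f0_def F_def ln_mult algebra_simps)
  then have Fi: "integrable lborel F" and FI: "(\<integral>x. F x \<partial>lborel) / Z \<le> b0"
    using int0 le gaussian_integral_dressed[OF \<gamma> Fm] by (simp_all add: Z_def divide_inverse mult.commute)
  have xi: "integrable lborel (\<lambda>x. (norm x)\<^sup>2 * (norm (u x))\<^sup>2)" using xu by (simp add: sq_int_def power_mult_distrib)
  have "integrable lborel (\<lambda>x. F x - \<gamma> * ((norm x)\<^sup>2 * (norm (u x))\<^sup>2))" using Fi xi by simp
  then show i: "integrable lborel (\<lambda>x. (norm (u x))\<^sup>2 * ln ((norm (u x))\<^sup>2))" by (simp add: F_def)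
  have "(\<integral>x. F x \<partial>lborel) = (\<integral>x. (norm (u x))\<^sup>2 * ln ((norm (u x))\<^sup>2) \<partial>lborel) + \<gamma> * (l2 lborel (\<lambda>x. norm x *\<^sub>R u x))\<^sup>2"
    using i xi by (simp add: F_def l2_power2 power_mult_distrib)
  moreover have "(\<integral>x. F x \<partial>lborel) \<le> (l2 lborel u)\<^sup>2 * ln ((l2 lborel u)\<^sup>2 / Z) + twisted_energy \<gamma> u g / \<gamma>"
  proof -
    have "(\<integral>x. F x \<partial>lborel) \<le> b0 * Z" using FI Z by (simp add: pos_divide_le_eq)
    also have "\<dots> = (l2 lborel u)\<^sup>2 * ln ((l2 lborel u)\<^sup>2 / Z) + twisted_energy \<gamma> u g / \<gamma>"
      using Z \<gamma> by (simp add: b0_def distrib_right)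
    finally show ?thesis .
  qed
  ultimately show "(\<integral>x. (norm (u x))\<^sup>2 * ln ((norm (u x))\<^sup>2) \<partial>lborel) + \<gamma> * (l2 lborel (\<lambda>x. norm x *\<^sub>R u x))\<^sup>2
      \<le> (l2 lborel u)\<^sup>2 * ln ((l2 lborel u)\<^sup>2 / gauss_mass TYPE(real^'n) \<gamma>) + twisted_energy \<gamma> u g / \<gamma>"
    by (simp add: Z_def)
qed

section \<open>Uniqueness of the weak gradient\<close>

lemma test_function_support:
  fixes f :: "real ^ 'n::finite \<Rightarrow> complex"
  assumes "test_function f"
  obtains R where "R > 0" "\<And>x. norm x \<ge> R \<Longrightarrow> f x = 0" "\<And>x i. norm x \<ge> R \<Longrightarrow> partial_derivative i f x = 0"
proof -
  obtain R0 where R0: "R0 > 0" "\<And>x. norm x \<ge> R0 \<Longrightarrow> f x = 0" using test_function_props(4)[OF assms] by blast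
  have "partial_derivative i f x = 0" if "norm x > R0" for x i
  proof -
    have "open {x::real^'n. norm x > R0}" by (intro open_Collect_less continuous_intros)
    then have "(f has_derivative (\<lambda>h. 0)) (at x)"
      using that R0 by (intro has_derivative_transform_within_open[where f="\<lambda>_. 0" and s="{x. norm x > R0}", OF has_derivative_const]) auto
    then show ?thesis by (rule partial_derivative_eq)
  qed
  with R0 show thesis by (intro that[of "R0 + 1"]) auto
qed

lemma test_function_sq_int:
  fixes f :: "real ^ 'n::finite \<Rightarrow> complex"
  assumes "test_function f"
  shows "sq_int lborel f" "sq_int lborel (partial_derivative i f)"
proof -
  obtain R where "R > 0" "\<And>x. norm x \<ge> R \<Longrightarrow> f x = 0" "\<And>x i. norm x \<ge> R \<Longrightarrow> partial_derivative i f x = 0"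
    by (rule test_function_support[OF assms]) blast
  then show "sq_int lborel f" "sq_int lborel (partial_derivative i f)"
    using test_function_props(2,3)[OF assms] by (auto intro!: continuous_compact_sq_int[where R=R])
qed

lemma sq_int_mult_integrable:
  fixes u f :: "'a \<Rightarrow> complex"
  assumes "sq_int M u" "sq_int M f"
  shows "integrable M (\<lambda>x. u x * f x)"
proof -
  have m: "(\<lambda>x. u x * f x) \<in> borel_measurable M"
    using assms[THEN sq_int_measurable] by (intro borel_measurable_times)
  have "integrable M (\<lambda>x. norm (u x * f x))" using sq_int_prod_integrable[OF assms] by (simp add: norm_mult)
  with m show ?thesis by (simp only: integrable_norm_iff)
qed

lemma vec_norm_power2_complex: "(norm (y :: complex ^ 'n::finite))\<^sup>2 = (\<Sum>i\<in>UNIV. (norm (y $ i))\<^sup>2)"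
  by (simp add: norm_vec_def L2_set_def sum_nonneg)

lemma sq_int_vecI:
  fixes g :: "'a \<Rightarrow> complex ^ 'n::finite"
  assumes "\<And>i. sq_int M (\<lambda>x. g x $ i)"
  shows "sq_int M g" "(l2 M g)\<^sup>2 = (\<Sum>i\<in>UNIV. (l2 M (\<lambda>x. g x $ i))\<^sup>2)"
proof -
  have "g \<in> borel_measurable M"
  proof (rule borel_measurable_euclidean_space[THEN iffD2], intro ballI)
    fix b :: "complex ^ 'n" assume "b \<in> Basis"
    then obtain i c where b: "b = axis i c" by (auto simp: Basis_vec_def)
    show "(\<lambda>x. g x \<bullet> b) \<in> borel_measurable M"
      unfolding b inner_axis using sq_int_measurable[OF assms] by (intro borel_measurable_inner) auto
  qed
  then show "sq_int M g" using assms by (simp add: sq_int_def vec_norm_power2_complex)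
  show "(l2 M g)\<^sup>2 = (\<Sum>i\<in>UNIV. (l2 M (\<lambda>x. g x $ i))\<^sup>2)"
    using assms by (simp add: l2_power2 vec_norm_power2_complex sq_int_def)
qed

lemma weak_gradD:
  assumes "weak_grad u g"
  shows "sq_int lborel u" "sq_int lborel g" "sq_int lborel (\<lambda>x. g x $ i)"
    "test_function f \<Longrightarrow> (\<integral>x. u x * partial_derivative i f x \<partial>lborel) = - (\<integral>x. g x $ i * f x \<partial>lborel)"
  using assms by (auto simp: weak_grad_def intro: sq_int_vec_component)

lemma weak_grad_sub:
  assumes ug: "weak_grad u g" and wk: "weak_grad w k"
  shows "weak_grad (\<lambda>x. u x - c * w x) (\<lambda>x. \<chi> i. g x $ i - c * k x $ i)"
  unfolding weak_grad_def
proof (intro conjI allI impI)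
  note u = weak_gradD[OF ug] and w = weak_gradD[OF wk]
  show "sq_int lborel (\<lambda>x. u x - c * w x)" by (intro sq_int_diff sq_int_mult u w)
  show "sq_int lborel (\<lambda>x. \<chi> i. g x $ i - c * k x $ i)"
    by (rule sq_int_vecI(1)) (simp, intro sq_int_diff sq_int_mult u w)
  fix i and f :: "real ^ 'a \<Rightarrow> complex" assume f: "test_function f"
  note tf = test_function_sq_int[OF f]
  note i1 = sq_int_mult_integrable[OF u(1) tf(2)] sq_int_mult_integrable[OF w(1) tf(2)]
    sq_int_mult_integrable[OF u(3) tf(1)] sq_int_mult_integrable[OF w(3) tf(1)]
  have "(\<integral>x. (u x - c * w x) * partial_derivative i f x \<partial>lborel) = (\<integral>x. u x * partial_derivative i f x - c * (w x * partial_derivative i f x) \<partial>lborel)"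
    by (simp add: algebra_simps)
  also have "\<dots> = (\<integral>x. u x * partial_derivative i f x \<partial>lborel) - c * (\<integral>x. w x * partial_derivative i f x \<partial>lborel)"
    using i1 by simp
  also have "\<dots> = - ((\<integral>x. g x $ i * f x \<partial>lborel) - c * (\<integral>x. k x $ i * f x \<partial>lborel))"
    by (simp add: u(4)[OF f] w(4)[OF f])
  also have "\<dots> = - (\<integral>x. g x $ i * f x - c * (k x $ i * f x) \<partial>lborel)"
    using i1 by simp
  also have "\<dots> = - (\<integral>x. (\<chi> i. g x $ i - c * k x $ i) $ i * f x \<partial>lborel)"
    by (simp add: algebra_simps)
  finally show "(\<integral>x. (u x - c * w x) * partial_derivative i f x \<partial>lborel) = - (\<integral>x. (\<chi> i. g x $ i - c * k x $ i) $ i * f x \<partial>lborel)" .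
qed

text \<open>
  The difference is a weak gradient of the zero function. The smooth approximations of the zero
  function vanish, and so do their gradients, which converge to the difference.
\<close>

lemma weak_grad_unique:
  fixes u :: "real ^ 'n::finite \<Rightarrow> complex"
  assumes "weak_grad u g" "weak_grad u g'"
  shows "AE x in lborel. g x = g' x"
proof -
  let ?k = "\<lambda>x. \<chi> i. g x $ i - 1 * g' x $ i"
  have wg: "weak_grad (\<lambda>x. 0) ?k" using weak_grad_sub[OF assms, of 1] by simp
  have z: "sq_int lborel (\<lambda>x::real^'n. norm x *\<^sub>R (0::complex))" by (simp add: sq_int_def)
  obtain v Dv where v: "\<And>n::nat. c1_compact (v n) (Dv n)"
    and lim: "\<And>i. (\<lambda>n. l2 lborel (\<lambda>x. Dv n x $ i - ?k x $ i)) \<longlonglongrightarrow> 0"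
    and v0: "\<And>n. v n = (\<lambda>x. 0)"
    by (rule c1_compact_dense[OF wg z]) blast
  have Dv0: "Dv n x $ i = 0" for n x i
  proof -
    have "((\<lambda>x. 0) has_derivative (\<lambda>h. \<Sum>i\<in>UNIV. of_real (h $ i) * Dv n x $ i)) (at x)"
      using c1_compact_derivative[OF v, of n x] v0 by simp
    then have "(\<lambda>h. \<Sum>i\<in>UNIV. of_real (h $ i) * Dv n x $ i) = (\<lambda>h. 0)"
      using has_derivative_unique has_derivative_const by blast
    from fun_cong[OF this] show ?thesis using sum_axis_nth[of i "Dv n x"] by metis
  qed
  have "AE x in lborel. ?k x $ i = 0" for i
  proof -
    have "l2 lborel (\<lambda>x. 0 - ?k x $ i) = 0" using lim[of i] unfolding Dv0 by (simp add: LIMSEQ_const_iff)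
    then have "l2 lborel (\<lambda>x. ?k x $ i - 0) = 0"
      by (simp only: l2_minus_commute[of lborel "\<lambda>x. ?k x $ i" "\<lambda>x. 0"])
    then have "l2 lborel (\<lambda>x. ?k x $ i) = 0" by (simp only: diff_0_right)
    then show ?thesis using l2_eq_0_iff[OF weak_gradD(3)[OF wg]] by blast
  qed
  then have "AE x in lborel. \<forall>i\<in>UNIV. ?k x $ i = 0" by (intro AE_finite_allI) auto
  then show ?thesis by eventually_elim (simp add: vec_eq_iff)
qed

section \<open>Gaussian functions\<close>

definition gauss_fun :: "real \<Rightarrow> real ^ 'n::finite \<Rightarrow> complex" where
  "gauss_fun \<gamma> x = of_real (exp (- (\<gamma>/2) * (norm x)\<^sup>2))"

definition gauss_grad :: "real \<Rightarrow> real ^ 'n::finite \<Rightarrow> complex ^ 'n" where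
  "gauss_grad \<gamma> x = (\<chi> i. - of_real (\<gamma> * x $ i) * gauss_fun \<gamma> x)"

lemma gauss_fun_continuous: "continuous_on UNIV (gauss_fun \<gamma>)"
  unfolding gauss_fun_def by (intro continuous_intros)

lemma gauss_fun_sq_int:
  assumes \<gamma>: "\<gamma> > 0"
  shows "sq_int lborel (gauss_fun \<gamma> :: real ^ 'n::finite \<Rightarrow> complex)" "sq_int lborel (\<lambda>x::real^'n. norm x *\<^sub>R gauss_fun \<gamma> x)"
    "(l2 lborel (gauss_fun \<gamma> :: real ^ 'n \<Rightarrow> complex))\<^sup>2 = gauss_mass TYPE(real^'n) \<gamma>"
proof -
  have m: "(gauss_fun \<gamma> :: real ^ 'n \<Rightarrow> complex) \<in> borel_measurable borel" by (intro borel_measurable_continuous_onI gauss_fun_continuous)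
  show "sq_int lborel (gauss_fun \<gamma> :: real ^ 'n \<Rightarrow> complex)"
    by (rule sq_int_bound(1)[OF sq_int_gauss(1)[OF \<gamma>], of _ 1]) (use m in \<open>auto simp: gauss_fun_def\<close>)
  show "(l2 lborel (gauss_fun \<gamma> :: real ^ 'n \<Rightarrow> complex))\<^sup>2 = gauss_mass TYPE(real^'n) \<gamma>"
    using sq_int_gauss(2)[OF \<gamma>, where 'a="real^'n"] by (simp add: l2_def gauss_fun_def)
  have g2: "\<gamma> / 2 > 0" using \<gamma> by simp
  show "sq_int lborel (\<lambda>x::real^'n. norm x *\<^sub>R gauss_fun \<gamma> x)"
  proof (rule sq_int_bound(1)[OF sq_int_gauss(1)[OF g2], of _ "1 + 2 / (\<gamma>/2)"])
    show "(\<lambda>x::real^'n. norm x *\<^sub>R gauss_fun \<gamma> x) \<in> borel_measurable lborel" using m by simp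
    show "AE x::real^'n in lborel. norm (norm x *\<^sub>R gauss_fun \<gamma> x) \<le> (1 + 2 / (\<gamma>/2)) * norm (exp (- (\<gamma>/2/2) * (norm x)\<^sup>2))"
      using norm_gauss_bound[OF g2] by (intro AE_I2) (simp add: gauss_fun_def)
  qed
qed

lemma weak_grad_gauss:
  assumes \<gamma>: "\<gamma> > 0"
  shows "weak_grad (gauss_fun \<gamma> :: real ^ 'n::finite \<Rightarrow> complex) (gauss_grad \<gamma>)"
  unfolding weak_grad_def
proof (intro conjI allI impI)
  note s = gauss_fun_sq_int[OF \<gamma>, where 'n='n]
  show "sq_int lborel (gauss_fun \<gamma> :: real ^ 'n \<Rightarrow> complex)" by (rule s(1))
  have gi: "sq_int lborel (\<lambda>x::real^'n. gauss_grad \<gamma> x $ i)" for i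
    using sq_int_scaleR[OF sq_int_nth_mult(1)[OF s(1,2), of \<gamma> i], of "-1"] by (simp add: gauss_grad_def)
  then show "sq_int lborel (gauss_grad \<gamma> :: real ^ 'n \<Rightarrow> complex ^ 'n)" by (rule sq_int_vecI(1))
  fix i and f :: "real ^ 'n \<Rightarrow> complex" assume f: "test_function f"
  obtain R where R: "R > 0" "\<And>x. norm x \<ge> R \<Longrightarrow> f x = 0" "\<And>x i. norm x \<ge> R \<Longrightarrow> partial_derivative i f x = 0"
    by (rule test_function_support[OF f]) blast
  note tf = test_function_props[OF f] and ts = test_function_sq_int[OF f]
  define F' where "F' x = gauss_fun \<gamma> x * partial_derivative i f x + gauss_grad \<gamma> x $ i * f x" for x
  have "(\<integral>x. F' x \<partial>lborel) = 0"
  proof (rule integral_partial_compact_eq_0[where F="\<lambda>x. gauss_fun \<gamma> x * f x" and R=R and i=i])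
    show "continuous_on UNIV (\<lambda>x. gauss_fun \<gamma> x * f x)" by (intro continuous_on_mult gauss_fun_continuous tf)
    have "continuous_on UNIV (\<lambda>x::real^'n. gauss_grad \<gamma> x $ i)"
      unfolding gauss_grad_def by (simp, intro continuous_intros gauss_fun_continuous)
    then show "continuous_on UNIV F'" unfolding F'_def
      by (intro continuous_on_add continuous_on_mult gauss_fun_continuous tf)
    fix x :: "real ^ 'n"
    show "norm x \<ge> R \<Longrightarrow> gauss_fun \<gamma> x * f x = 0" "norm x \<ge> R \<Longrightarrow> F' x = 0" using R by (simp_all add: F'_def)
    have l: "((\<lambda>t::real. x + t *\<^sub>R axis i 1) has_derivative (\<lambda>t. t *\<^sub>R axis i 1)) (at 0)"
      by (auto intro!: derivative_eq_intros)
    have f1: "((\<lambda>t. f (x + t *\<^sub>R axis i 1)) has_derivative (\<lambda>t. t *\<^sub>R partial_derivative i f x)) (at 0)"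
    proof -
      have d: "(f has_derivative frechet_derivative f (at x)) (at (x + 0 *\<^sub>R axis i 1))" using tf(1)[of x] by simp
      from has_derivative_compose[OF l d] show ?thesis
        by (simp add: partial_derivative_def linear_scale[OF has_derivative_linear[OF tf(1)]])
    qed
    have p: "((\<lambda>x::real^'n. exp (- (\<gamma>/2) * (x \<bullet> x))) has_derivative (\<lambda>h. exp (- (\<gamma>/2) * (x \<bullet> x)) * (- \<gamma> * (x \<bullet> h)))) (at (x + 0 *\<^sub>R axis i 1))"
      by (auto intro!: derivative_eq_intros simp: inner_commute algebra_simps)
    have g1: "((\<lambda>t. gauss_fun \<gamma> (x + t *\<^sub>R axis i 1)) has_derivative (\<lambda>t. t *\<^sub>R gauss_grad \<gamma> x $ i)) (at 0)"
      using has_derivative_of_real[OF has_derivative_compose[OF l p], where 'a=complex]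
      unfolding gauss_fun_def gauss_grad_def power2_norm_eq_inner
      by (rule has_derivative_eq_rhs) (simp add: fun_eq_iff inner_axis scaleR_conv_of_real[where 'a=complex])
    show "((\<lambda>t. gauss_fun \<gamma> (x + t *\<^sub>R axis i 1) * f (x + t *\<^sub>R axis i 1)) has_vector_derivative F' x) (at 0)"
      unfolding has_vector_derivative_def
      by (rule has_derivative_eq_rhs[OF has_derivative_mult[OF g1 f1]])
         (simp add: F'_def fun_eq_iff scaleR_conv_of_real algebra_simps)
  qed
  then show "(\<integral>x. gauss_fun \<gamma> x * partial_derivative i f x \<partial>lborel) = - (\<integral>x. gauss_grad \<gamma> x $ i * f x \<partial>lborel)"
    using sq_int_mult_integrable[OF s(1) ts(2)[of i]] sq_int_mult_integrable[OF gi ts(1), of i]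
    by (simp add: F'_def eq_neg_iff_add_eq_0)
qed

text \<open>
  The twisted gradient annihilates the Gaussian.
\<close>

lemma twisted_gradient_sub_gauss:
  "twisted_gradient \<gamma> (\<lambda>x. u x - c * gauss_fun \<gamma> x) (\<lambda>x. \<chi> i. g x $ i - c * gauss_grad \<gamma> x $ i) = twisted_gradient \<gamma> u g"
  by (simp add: twisted_gradient_def gauss_grad_def fun_eq_iff algebra_simps)

lemma l2_sub_gauss:
  fixes u :: "real ^ 'n::finite \<Rightarrow> complex"
  assumes \<gamma>: "\<gamma> > 0" and u: "sq_int lborel u"
  shows "(l2 lborel (\<lambda>x. u x - c * gauss_fun \<gamma> x))\<^sup>2 = (l2 lborel u)\<^sup>2
    + (norm c)\<^sup>2 * gauss_mass TYPE(real^'n) \<gamma> - 2 * ((\<integral>x. exp (- (\<gamma>/2) * (norm x)\<^sup>2) *\<^sub>R u x \<partial>lborel) \<bullet> c)"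
proof -
  let ?p = "\<lambda>x::real^'n. exp (- (\<gamma>/2) * (norm x)\<^sup>2)"
  note s = gauss_fun_sq_int[OF \<gamma>, where 'n='n]
  have pu: "integrable lborel (\<lambda>x. ?p x *\<^sub>R u x)" by (rule sq_int_scaleR_integrable(1)[OF sq_int_gauss(1)[OF \<gamma>] u])
  have "(norm (u x - c * gauss_fun \<gamma> x))\<^sup>2 = (norm (u x))\<^sup>2 + (norm c)\<^sup>2 * (norm (gauss_fun \<gamma> x))\<^sup>2 - 2 * ((?p x *\<^sub>R u x) \<bullet> c)" for x
  proof -
    have "u x - c * gauss_fun \<gamma> x = u x + (- ?p x) *\<^sub>R c" by (simp add: gauss_fun_def scaleR_conv_of_real)
    moreover have "norm (gauss_fun \<gamma> x) = ?p x" by (simp add: gauss_fun_def)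
    ultimately show ?thesis by (simp only: norm_add_scaleR_power2 inner_scaleR_left) (simp add: inner_commute)
  qed
  note pointwise = this
  have i1: "integrable lborel (\<lambda>x. (norm (u x))\<^sup>2)" using u by (simp add: sq_int_def)
  have i2: "integrable lborel (\<lambda>x::real^'n. (norm c)\<^sup>2 * (norm (gauss_fun \<gamma> x))\<^sup>2)"
    using s(1) by (simp add: sq_int_def)
  have i3: "integrable lborel (\<lambda>x. 2 * ((?p x *\<^sub>R u x) \<bullet> c))"
    by (intro integrable_mult_right integrable_inner_left pu)
  have "(l2 lborel (\<lambda>x. u x - c * gauss_fun \<gamma> x))\<^sup>2 = (l2 lborel u)\<^sup>2 + (norm c)\<^sup>2 * (l2 lborel (gauss_fun \<gamma> :: real^'n \<Rightarrow> complex))\<^sup>2 - 2 * (\<integral>x. (?p x *\<^sub>R u x) \<bullet> c \<partial>lborel)"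
    unfolding l2_power2 pointwise
    by (subst Bochner_Integration.integral_diff[OF Bochner_Integration.integrable_add[OF i1 i2] i3],
        subst Bochner_Integration.integral_add[OF i1 i2]) (simp only: integral_mult_right_zero)
  also have "(\<integral>x. (?p x *\<^sub>R u x) \<bullet> c \<partial>lborel) = (\<integral>x. ?p x *\<^sub>R u x \<partial>lborel) \<bullet> c"
    using pu by (rule integral_inner_left)
  finally show ?thesis by (simp only: s(3))
qed

section \<open>Borel representatives\<close>

lemma lebesgue_borel_representative:
  fixes f :: "'a::euclidean_space \<Rightarrow> 'b::euclidean_space"
  assumes "f \<in> borel_measurable lebesgue"
  obtains f' where "f' \<in> borel_measurable borel" "AE x in lborel. f x = f' x"
proof -
  have "\<exists>h. h \<in> borel_measurable borel \<and> (AE x in lborel. f x \<bullet> b = h x)" for b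
  proof -
    have "(\<lambda>x. f x \<bullet> b) \<in> borel_measurable lebesgue" using assms by measurable
    from completion_ex_borel_measurable_real[OF this] show ?thesis by auto
  qed
  then obtain h where h: "\<And>b. h b \<in> borel_measurable borel" "\<And>b. AE x in lborel. f x \<bullet> b = h b x" by metis
  have m: "(\<lambda>x. \<Sum>b\<in>Basis. h b x *\<^sub>R b) \<in> borel_measurable borel" using h(1) by measurable
  have "AE x in lborel. \<forall>b\<in>Basis. f x \<bullet> b = h b x" by (intro AE_finite_allI h(2)) simp
  then have "AE x in lborel. f x = (\<Sum>b\<in>Basis. h b x *\<^sub>R b)"
    by eventually_elim (metis (no_types, lifting) euclidean_representation sum.cong)
  with m show thesis by (rule that)
qed

lemma borel_measurable_lebesgue_AE:
  fixes f f' :: "'a::euclidean_space \<Rightarrow> 'b::euclidean_space"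
  assumes "f' \<in> borel_measurable borel" "AE x in lborel. f x = f' x"
  shows "f \<in> borel_measurable lebesgue"
proof (rule measurableI)
  fix A :: "'b set" assume A: "A \<in> sets borel"
  have ae: "AE x in lebesgue. f x = f' x" using assms(2) by (rule AE_completion)
  show "f -` A \<inter> space lebesgue \<in> sets lebesgue"
  proof (rule completion.in_sets_AE)
    show "AE x in lebesgue. x \<in> f' -` A \<longleftrightarrow> x \<in> f -` A \<inter> space lebesgue" using ae by eventually_elim simp
    show "f' -` A \<in> sets lebesgue" using measurable_sets[OF assms(1) A] by simp
  qed simp
qed simp

lemma integral_lebesgue_eq_lborel:
  fixes F F' :: "'a::euclidean_space \<Rightarrow> 'b::euclidean_space"
  assumes "F' \<in> borel_measurable borel" "AE x in lborel. F x = F' x"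
  shows "(\<integral>x. F x \<partial>lebesgue) = (\<integral>x. F' x \<partial>lborel)" "integrable lebesgue F \<longleftrightarrow> integrable lborel F'"
proof -
  have F: "F \<in> borel_measurable lebesgue" by (rule borel_measurable_lebesgue_AE[OF assms])
  have F': "F' \<in> borel_measurable lebesgue" using assms(1) by (simp add: measurable_completion)
  have ae: "AE x in lebesgue. F x = F' x" using assms(2) by (rule AE_completion)
  show "(\<integral>x. F x \<partial>lebesgue) = (\<integral>x. F' x \<partial>lborel)"
    using integral_cong_AE[OF F F' ae] integral_completion[of F' lborel] assms(1) by simp
  show "integrable lebesgue F \<longleftrightarrow> integrable lborel F'"
    using integrable_cong_AE[OF F F' ae] integrable_completion[of F' lborel] assms(1) by simp
qed

lemma square_integrable_iff_sq_int:
  fixes f :: "real ^ 'n::finite \<Rightarrow> 'b::euclidean_space"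
  assumes f': "f' \<in> borel_measurable borel" and ae: "AE x in lborel. f x = f' x"
  shows "square_integrable f \<longleftrightarrow> sq_int lborel f'" "L2_norm f = l2 lborel f'"
proof -
  have m: "(\<lambda>x. (norm (f' x))\<^sup>2) \<in> borel_measurable borel" using f' by measurable
  have ae2: "AE x in lborel. (norm (f x))\<^sup>2 = (norm (f' x))\<^sup>2" using ae by eventually_elim simp
  show "square_integrable f \<longleftrightarrow> sq_int lborel f'"
    using borel_measurable_lebesgue_AE[OF f' ae] integral_lebesgue_eq_lborel(2)[OF m ae2] f'
    by (simp add: square_integrable_def sq_int_def)
  show "L2_norm f = l2 lborel f'"
    using integral_lebesgue_eq_lborel(1)[OF m ae2] by (simp add: L2_norm_def l2_def)
qed

lemma has_weak_gradient_iff: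
  fixes u :: "real ^ 'n::finite \<Rightarrow> complex"
  assumes u': "sq_int lborel u'" "AE x in lborel. u x = u' x" and g': "g' \<in> borel_measurable borel" "AE x in lborel. g x = g' x"
  shows "has_weak_gradient u g \<longleftrightarrow> weak_grad u' g'"
proof -
  have um: "u' \<in> borel_measurable borel" using sq_int_measurable[OF u'(1)] by simp
  have "(\<integral>x. u x * partial_derivative i f x \<partial>lebesgue) = (\<integral>x. u' x * partial_derivative i f x \<partial>lborel)"
    "(\<integral>x. g x $ i * f x \<partial>lebesgue) = (\<integral>x. g' x $ i * f x \<partial>lborel)" if f: "test_function f" for f i
  proof -
    have fm: "f \<in> borel_measurable borel" "partial_derivative i f \<in> borel_measurable borel"
      using test_function_props(2,3)[OF f] by (auto intro: borel_measurable_continuous_onI)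
    have gm: "(\<lambda>x. g' x $ i) \<in> borel_measurable borel"
      by (rule measurable_compose[OF g'(1)]) (intro borel_measurable_continuous_onI continuous_intros)
    show "(\<integral>x. u x * partial_derivative i f x \<partial>lebesgue) = (\<integral>x. u' x * partial_derivative i f x \<partial>lborel)"
      using um fm u'(2) by (intro integral_lebesgue_eq_lborel(1)) (auto elim: eventually_mono)
    show "(\<integral>x. g x $ i * f x \<partial>lebesgue) = (\<integral>x. g' x $ i * f x \<partial>lborel)"
      using gm fm g'(2) by (intro integral_lebesgue_eq_lborel(1)) (auto elim: eventually_mono)
  qed
  then show ?thesis
    using u'(1) square_integrable_iff_sq_int(1)[OF g'] by (auto simp: has_weak_gradient_def weak_grad_def)
qed

text \<open>
  Borel representatives \<open>u'\<close> of an element \<open>u\<close> of \<open>\<Sigma>\<close> and \<open>g'\<close> of its weak gradient.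
\<close>

definition sigma_rep :: "(real ^ 'n::finite \<Rightarrow> complex) \<Rightarrow> (real ^ 'n \<Rightarrow> complex) \<Rightarrow> (real ^ 'n \<Rightarrow> complex ^ 'n) \<Rightarrow> bool" where
  "sigma_rep u u' g' \<longleftrightarrow> weak_grad u' g' \<and> sq_int lborel (\<lambda>x. norm x *\<^sub>R u' x) \<and> (AE x in lborel. u x = u' x)"

lemma sigma_rep_exists:
  assumes "u \<in> Sigma_space"
  obtains u' g' where "sigma_rep u u' g'"
proof -
  have u: "square_integrable u" and xu: "square_integrable (\<lambda>x. norm x *\<^sub>R u x)"
    using assms by (auto simp: Sigma_space_def H1_def)
  obtain g where g: "has_weak_gradient u g" using assms by (auto simp: Sigma_space_def H1_def)
  obtain u' where u': "u' \<in> borel_measurable borel" "AE x in lborel. u x = u' x"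
    using lebesgue_borel_representative u unfolding square_integrable_def by blast
  obtain g' where g': "g' \<in> borel_measurable borel" "AE x in lborel. g x = g' x"
    using lebesgue_borel_representative g unfolding square_integrable_def has_weak_gradient_def by blast
  have su: "sq_int lborel u'" using square_integrable_iff_sq_int(1)[OF u'] u by simp
  have xm: "(\<lambda>x. norm x *\<^sub>R u' x) \<in> borel_measurable borel" using u'(1) by measurable
  have xae: "AE x in lborel. norm x *\<^sub>R u x = norm x *\<^sub>R u' x" using u'(2) by eventually_elim simp
  have "sq_int lborel (\<lambda>x. norm x *\<^sub>R u' x)" using square_integrable_iff_sq_int(1)[OF xm xae] xu by simp
  moreover have "weak_grad u' g'" using has_weak_gradient_iff[OF su u'(2) g'] g by simp
  ultimately show thesis using that u'(2) by (simp add: sigma_rep_def)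
qed

text \<open>
  Uniqueness of the weak gradient makes these values independent of the choice made in
  \<open>weak_gradient\<close>.
\<close>

lemma sigma_rep_values:
  fixes u :: "real ^ 'n::finite \<Rightarrow> complex"
  assumes r: "sigma_rep u u' g'"
  shows "u \<in> Sigma_space" "L2_norm u = l2 lborel u'" "L2_norm (\<lambda>x. norm x *\<^sub>R u x) = l2 lborel (\<lambda>x. norm x *\<^sub>R u' x)"
    "(L2_norm (weak_gradient u))\<^sup>2 = (\<Sum>i\<in>UNIV. (l2 lborel (\<lambda>x. g' x $ i))\<^sup>2)"
    "log_term u = (\<integral>x. (norm (u' x))\<^sup>2 * ln ((norm (u' x))\<^sup>2) \<partial>lborel)"
    "Sigma_norm u = sqrt ((\<Sum>i\<in>UNIV. (l2 lborel (\<lambda>x. g' x $ i))\<^sup>2) + (l2 lborel (\<lambda>x. norm x *\<^sub>R u' x))\<^sup>2)"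
proof -
  have wg: "weak_grad u' g'" and xu': "sq_int lborel (\<lambda>x. norm x *\<^sub>R u' x)" and ae: "AE x in lborel. u x = u' x"
    using r by (auto simp: sigma_rep_def)
  note w = weak_gradD[OF wg]
  have um[measurable]: "u' \<in> borel_measurable borel" and gm: "g' \<in> borel_measurable borel"
    using sq_int_measurable[OF w(1)] sq_int_measurable[OF w(2)] by simp_all
  have xm: "(\<lambda>x. norm x *\<^sub>R u' x) \<in> borel_measurable borel" by measurable
  have xae: "AE x in lborel. norm x *\<^sub>R u x = norm x *\<^sub>R u' x" using ae by eventually_elim simp
  have hw: "has_weak_gradient u g'" using has_weak_gradient_iff[OF w(1) ae gm, of g'] wg by simp
  show "u \<in> Sigma_space"
    using hw square_integrable_iff_sq_int(1)[OF um ae] square_integrable_iff_sq_int(1)[OF xm xae] w(1) xu'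
    by (auto simp: Sigma_space_def H1_def)
  show "L2_norm u = l2 lborel u'" by (rule square_integrable_iff_sq_int(2)[OF um ae])
  show xn: "L2_norm (\<lambda>x. norm x *\<^sub>R u x) = l2 lborel (\<lambda>x. norm x *\<^sub>R u' x)" by (rule square_integrable_iff_sq_int(2)[OF xm xae])
  have hw0: "has_weak_gradient u (weak_gradient u)" unfolding weak_gradient_def by (rule someI[of _ g']) (rule hw)
  then obtain g0 where g0: "g0 \<in> borel_measurable borel" "AE x in lborel. weak_gradient u x = g0 x"
    using lebesgue_borel_representative unfolding square_integrable_def has_weak_gradient_def by blast
  have "weak_grad u' g0" using has_weak_gradient_iff[OF w(1) ae g0] hw0 by simp
  from weak_grad_unique[OF this wg] g0(2) have gae: "AE x in lborel. weak_gradient u x = g' x" by eventually_elim simp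
  have "L2_norm (weak_gradient u) = l2 lborel g'" by (rule square_integrable_iff_sq_int(2)[OF gm gae])
  then show gn: "(L2_norm (weak_gradient u))\<^sup>2 = (\<Sum>i\<in>UNIV. (l2 lborel (\<lambda>x. g' x $ i))\<^sup>2)"
    using sq_int_vecI(2)[OF w(3)] by simp
  have "AE x in lborel. (norm (u x))\<^sup>2 * ln ((norm (u x))\<^sup>2) = (norm (u' x))\<^sup>2 * ln ((norm (u' x))\<^sup>2)"
    using ae by eventually_elim simp
  then show "log_term u = (\<integral>x. (norm (u' x))\<^sup>2 * ln ((norm (u' x))\<^sup>2) \<partial>lborel)"
    unfolding log_term_def by (intro integral_lebesgue_eq_lborel(1)) measurable
  have ae3: "AE x in lborel. (norm (weak_gradient u x))\<^sup>2 + (norm x)\<^sup>2 * (norm (u x))\<^sup>2 = (norm (g' x))\<^sup>2 + (norm x)\<^sup>2 * (norm (u' x))\<^sup>2"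
    using ae gae by eventually_elim simp
  have m3: "(\<lambda>x. (norm (g' x))\<^sup>2 + (norm x)\<^sup>2 * (norm (u' x))\<^sup>2) \<in> borel_measurable borel"
    by (intro borel_measurable_add borel_measurable_times borel_measurable_power measurable_compose[OF gm borel_measurable_norm]
        measurable_compose[OF um borel_measurable_norm] borel_measurable_norm)
  have "(\<integral>x. (norm (weak_gradient u x))\<^sup>2 + (norm x)\<^sup>2 * (norm (u x))\<^sup>2 \<partial>lebesgue) = (\<integral>x. (norm (g' x))\<^sup>2 + (norm x)\<^sup>2 * (norm (u' x))\<^sup>2 \<partial>lborel)"
    by (rule integral_lebesgue_eq_lborel(1)[OF m3 ae3])
  also have "\<dots> = (l2 lborel g')\<^sup>2 + (l2 lborel (\<lambda>x. norm x *\<^sub>R u' x))\<^sup>2"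
    using w(2) xu' by (simp add: l2_power2 sq_int_def power_mult_distrib)
  finally show "Sigma_norm u = sqrt ((\<Sum>i\<in>UNIV. (l2 lborel (\<lambda>x. g' x $ i))\<^sup>2) + (l2 lborel (\<lambda>x. norm x *\<^sub>R u' x))\<^sup>2)"
    by (simp only: Sigma_norm_def sq_int_vecI(2)[OF w(3)])
qed

section \<open>The variational problem\<close>

text \<open>
  The uncertainty identity expresses \<open>\<parallel>\<nabla>u\<parallel>\<^sup>2\<close> by the twisted energy, and the logarithmic Sobolev
  inequality costs only the fraction \<open>1/\<gamma>\<close> of it. The weighted norms cancel exactly.
\<close>

lemma nehari_lower_bound:
  fixes u :: "real ^ 'n::finite \<Rightarrow> complex"
  assumes \<gamma>: "\<gamma> > 0" and r: "sigma_rep u u' g'"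
  shows "(1 - 1 / \<gamma>) * twisted_energy \<gamma> u' g'
      + (L2_norm u)\<^sup>2 * (\<omega> + \<gamma> * real CARD('n) - ln ((L2_norm u)\<^sup>2 / gauss_mass TYPE(real^'n) \<gamma>)) \<le> nehari \<gamma> \<omega> u"
proof -
  have wg: "weak_grad u' g'" and xu': "sq_int lborel (\<lambda>x. norm x *\<^sub>R u' x)"
    using r by (auto simp: sigma_rep_def)
  show ?thesis
    using weak_grad_uncertainty[OF wg xu', of \<gamma>] weak_grad_log_sobolev(2)[OF \<gamma> wg xu']
    unfolding nehari_def sigma_rep_values(2-5)[OF r] by (simp add: algebra_simps power2_eq_square)
qed

lemma sigma_rep_gauss:
  fixes u :: "real ^ 'n::finite \<Rightarrow> complex"
  assumes \<gamma>: "\<gamma> > 0" and ae: "AE x in lborel. u x = c * gauss_fun \<gamma> x"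
  shows "\<exists>g'. sigma_rep u (\<lambda>x. c * gauss_fun \<gamma> x) g' \<and> twisted_energy \<gamma> (\<lambda>x. c * gauss_fun \<gamma> x) g' = 0"
proof -
  note s = gauss_fun_sq_int[OF \<gamma>, where 'n='n] and wg = weak_grad_gauss[OF \<gamma>, where 'n='n]
  let ?u = "\<lambda>x::real^'n. c * gauss_fun \<gamma> x"
  have "weak_grad (\<lambda>x::real^'n. 0::complex) (\<lambda>x. 0)" by (simp add: weak_grad_def sq_int_def)
  from weak_grad_sub[OF this wg, of "- c"]
  have w: "weak_grad ?u (\<lambda>x. \<chi> i. c * gauss_grad \<gamma> x $ i)" by simp
  have "sq_int lborel (\<lambda>x. norm x *\<^sub>R ?u x)" using sq_int_mult[OF s(2), of c] by (simp add: mult_ac scaleR_conv_of_real)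
  then have "sigma_rep u ?u (\<lambda>x. \<chi> i. c * gauss_grad \<gamma> x $ i)" using w ae by (simp add: sigma_rep_def)
  moreover have "twisted_gradient \<gamma> ?u (\<lambda>x. \<chi> i. c * gauss_grad \<gamma> x $ i) i = (\<lambda>x. 0)" for i
    by (simp add: twisted_gradient_def gauss_grad_def fun_eq_iff algebra_simps)
  then have "twisted_energy \<gamma> ?u (\<lambda>x. \<chi> i. c * gauss_grad \<gamma> x $ i) = 0" by (simp add: twisted_energy_def l2_def)
  ultimately show ?thesis by blast
qed

lemma nehari_gauss:
  fixes u :: "real ^ 'n::finite \<Rightarrow> complex"
  assumes \<gamma>: "\<gamma> > 0" and ae: "AE x in lborel. u x = c * gauss_fun \<gamma> x" and c: "c \<noteq> 0"
  shows "u \<in> Sigma_nonzero" "(L2_norm u)\<^sup>2 = (norm c)\<^sup>2 * gauss_mass TYPE(real^'n) \<gamma>"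
    "nehari \<gamma> \<omega> u = (L2_norm u)\<^sup>2 * (\<omega> + \<gamma> * real CARD('n) - ln ((norm c)\<^sup>2))"
proof -
  let ?u = "\<lambda>x::real^'n. c * gauss_fun \<gamma> x"
  obtain g' where r: "sigma_rep u ?u g'" and tw: "twisted_energy \<gamma> ?u g' = 0" using sigma_rep_gauss[OF \<gamma> ae] by blast
  have wg: "weak_grad ?u g'" and xu: "sq_int lborel (\<lambda>x. norm x *\<^sub>R ?u x)" using r by (auto simp: sigma_rep_def)
  show m: "(L2_norm u)\<^sup>2 = (norm c)\<^sup>2 * gauss_mass TYPE(real^'n) \<gamma>"
    by (simp only: sigma_rep_values(2)[OF r] l2_mult power_mult_distrib gauss_fun_sq_int(3)[OF \<gamma>])
  have "(L2_norm u)\<^sup>2 \<noteq> 0" using m c gauss_mass_pos[OF \<gamma>, where 'a="real^'n"] by simp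
  then have n0: "\<not> (AE x in lborel. u x = 0)"
  proof (rule contrapos_nn)
    assume "AE x in lborel. u x = 0"
    then have "AE x in lborel. ?u x = 0" using ae by eventually_elim simp
    then have "l2 lborel ?u = 0" using l2_eq_0_iff[OF weak_gradD(1)[OF wg]] by blast
    then show "(L2_norm u)\<^sup>2 = 0" by (simp add: sigma_rep_values(2)[OF r])
  qed
  then show "u \<in> Sigma_nonzero" using sigma_rep_values(1)[OF r] by (simp add: Sigma_nonzero_def AE_completion_iff)
  have i1: "integrable lborel (\<lambda>x. (norm (?u x))\<^sup>2)" using weak_gradD(1)[OF wg] by (simp only: sq_int_def)
  have i2: "integrable lborel (\<lambda>x. (norm (norm x *\<^sub>R ?u x))\<^sup>2)" using xu by (simp only: sq_int_def)
  have "(norm (?u x))\<^sup>2 * ln ((norm (?u x))\<^sup>2) = ln ((norm c)\<^sup>2) * (norm (?u x))\<^sup>2 - \<gamma> * (norm (norm x *\<^sub>R ?u x))\<^sup>2" for x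
  proof -
    have e: "(norm (?u x))\<^sup>2 = (norm c)\<^sup>2 * exp (- \<gamma> * (norm x)\<^sup>2)"
      by (simp add: gauss_fun_def norm_mult power_mult_distrib exp_double[symmetric])
    have ln_eq: "ln ((norm (?u x))\<^sup>2) = ln ((norm c)\<^sup>2) - \<gamma> * (norm x)\<^sup>2"
      unfolding e using c by (subst ln_mult) auto
    have x_eq: "(norm (norm x *\<^sub>R ?u x))\<^sup>2 = (norm x)\<^sup>2 * (norm (?u x))\<^sup>2" by (simp add: power_mult_distrib)
    have "N * (a - \<gamma> * t) = a * N - \<gamma> * (t * N)" for N a t :: real by (simp add: algebra_simps)
    then show ?thesis unfolding ln_eq x_eq .
  qed
  note log_integrand = this
  have "log_term u = ln ((norm c)\<^sup>2) * (l2 lborel ?u)\<^sup>2 - \<gamma> * (l2 lborel (\<lambda>x. norm x *\<^sub>R ?u x))\<^sup>2"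
    unfolding sigma_rep_values(5)[OF r] l2_power2 log_integrand
    by (subst Bochner_Integration.integral_diff[OF integrable_mult_right[OF i1] integrable_mult_right[OF i2]])
       (simp only: integral_mult_right_zero)
  then show "nehari \<gamma> \<omega> u = (L2_norm u)\<^sup>2 * (\<omega> + \<gamma> * real CARD('n) - ln ((norm c)\<^sup>2))"
    using weak_grad_uncertainty[OF wg xu, of \<gamma>] tw
    unfolding nehari_def sigma_rep_values(2-4)[OF r] by (simp add: algebra_simps power2_eq_square)
qed

text \<open>
  The squared \<open>L\<^sup>2\<close> norm of the gausson.
\<close>

definition critical_mass :: "'n::finite itself \<Rightarrow> real \<Rightarrow> real \<Rightarrow> real" where
  "critical_mass _ \<gamma> \<omega> = exp (\<omega> + \<gamma> * real CARD('n)) * gauss_mass TYPE(real^'n) \<gamma>"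

lemma critical_mass_le:
  fixes u :: "real ^ 'n::finite \<Rightarrow> complex"
  assumes \<gamma>: "\<gamma> > 1" and u: "u \<in> Sigma_nonzero" and n: "nehari \<gamma> \<omega> u = 0"
  shows "critical_mass TYPE('n) \<gamma> \<omega> \<le> (L2_norm u)\<^sup>2"
proof -
  have \<gamma>0: "\<gamma> > 0" using \<gamma> by simp
  note Z = gauss_mass_pos[OF \<gamma>0, where 'a="real^'n"]
  obtain u' g' where r: "sigma_rep u u' g'" using u sigma_rep_exists by (auto simp: Sigma_nonzero_def)
  have wg: "weak_grad u' g'" and ae: "AE x in lborel. u x = u' x" using r by (auto simp: sigma_rep_def)
  have "L2_norm u \<noteq> 0"
  proof
    assume "L2_norm u = 0"
    then have "AE x in lborel. u' x = 0" using l2_eq_0_iff[OF weak_gradD(1)[OF wg]] by (simp add: sigma_rep_values(2)[OF r])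
    then have "AE x in lborel. u x = 0" using ae by eventually_elim simp
    then show False using u by (simp add: Sigma_nonzero_def AE_completion)
  qed
  then have U: "(L2_norm u)\<^sup>2 > 0" by simp
  have "(1 - 1 / \<gamma>) * twisted_energy \<gamma> u' g' \<ge> 0"
    using \<gamma> by (intro mult_nonneg_nonneg) (auto simp: twisted_energy_def sum_nonneg)
  then have "(L2_norm u)\<^sup>2 * (\<omega> + \<gamma> * real CARD('n) - ln ((L2_norm u)\<^sup>2 / gauss_mass TYPE(real^'n) \<gamma>)) \<le> 0"
    using nehari_lower_bound[OF \<gamma>0 r, of \<omega>] n by linarith
  then have "\<omega> + \<gamma> * real CARD('n) \<le> ln ((L2_norm u)\<^sup>2 / gauss_mass TYPE(real^'n) \<gamma>)"
    using U by (simp add: mult_le_0_iff)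
  then have "exp (\<omega> + \<gamma> * real CARD('n)) \<le> (L2_norm u)\<^sup>2 / gauss_mass TYPE(real^'n) \<gamma>"
    using U Z by (subst (asm) ln_ge_iff) auto
  then show ?thesis using Z by (simp add: critical_mass_def pos_le_divide_eq)
qed

lemma min_action_eq:
  assumes \<gamma>: "\<gamma> > 1"
  shows "min_action TYPE('n::finite) \<gamma> \<omega> = critical_mass TYPE('n) \<gamma> \<omega> / 2"
  unfolding min_action_def
proof (rule cInf_eq_minimum)
  have \<gamma>0: "\<gamma> > 0" using \<gamma> by simp
  let ?c = "of_real (exp ((\<omega> + \<gamma> * real CARD('n)) / 2)) :: complex"
  let ?u = "\<lambda>x::real^'n. ?c * gauss_fun \<gamma> x"
  have c2: "(norm ?c)\<^sup>2 = exp (\<omega> + \<gamma> * real CARD('n))" by (simp add: exp_double[symmetric])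
  note g = nehari_gauss[OF \<gamma>0, of ?u ?c]
  have u: "?u \<in> Sigma_nonzero" "(L2_norm ?u)\<^sup>2 = critical_mass TYPE('n) \<gamma> \<omega>"
    using g(1,2) by (simp_all add: c2 critical_mass_def del: norm_of_real)
  have n: "nehari \<gamma> \<omega> ?u = 0" using g(3)[of \<omega>] by (simp add: c2 del: norm_of_real)
  have "action \<gamma> \<omega> ?u = critical_mass TYPE('n) \<gamma> \<omega> / 2" by (simp add: action_eq_nehari n u(2))
  then show "critical_mass TYPE('n) \<gamma> \<omega> / 2 \<in> {action \<gamma> \<omega> u |u :: real ^ 'n \<Rightarrow> complex. u \<in> Sigma_nonzero \<and> nehari \<gamma> \<omega> u = 0}"
    using u(1) n by (intro CollectI exI[of _ ?u]) simp
  fix s assume "s \<in> {action \<gamma> \<omega> u |u :: real ^ 'n \<Rightarrow> complex. u \<in> Sigma_nonzero \<and> nehari \<gamma> \<omega> u = 0}"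
  then show "critical_mass TYPE('n) \<gamma> \<omega> / 2 \<le> s"
    using critical_mass_le[OF \<gamma>] by (force simp: action_eq_nehari)
qed

text \<open>
  The number \<open>I / Z\<close> is the coefficient of the orthogonal projection of \<open>u'\<close> onto the Gaussian:
  the first inequality is Bessel's, the second is the Poincare inequality.
\<close>

lemma gauss_coefficient:
  fixes u :: "real ^ 'n::finite \<Rightarrow> complex"
  assumes \<gamma>: "\<gamma> > 0" and r: "sigma_rep u u' g'"
  defines "I \<equiv> (\<integral>x. exp (- (\<gamma>/2) * (norm x)\<^sup>2) *\<^sub>R u' x \<partial>lborel)" and "Z \<equiv> gauss_mass TYPE(real^'n) \<gamma>"
  shows "(norm (I /\<^sub>R Z))\<^sup>2 * Z \<le> (L2_norm u)\<^sup>2" "(L2_norm u)\<^sup>2 - (norm (I /\<^sub>R Z))\<^sup>2 * Z \<le> twisted_energy \<gamma> u' g' / (2 * \<gamma>)"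
    "(l2 lborel (\<lambda>x. u' x - c * gauss_fun \<gamma> x))\<^sup>2 = (L2_norm u)\<^sup>2 + (norm c)\<^sup>2 * Z - 2 * Z * ((I /\<^sub>R Z) \<bullet> c)"
proof -
  have wg: "weak_grad u' g'" and xu: "sq_int lborel (\<lambda>x. norm x *\<^sub>R u' x)" using r by (auto simp: sigma_rep_def)
  have Z: "Z > 0" unfolding Z_def by (rule gauss_mass_pos[OF \<gamma>])
  have IZ: "(norm (I /\<^sub>R Z))\<^sup>2 * Z = (norm I)\<^sup>2 / Z" using Z by (simp add: power_mult_distrib power2_eq_square field_simps)
  show pr: "(L2_norm u)\<^sup>2 - (norm (I /\<^sub>R Z))\<^sup>2 * Z \<le> twisted_energy \<gamma> u' g' / (2 * \<gamma>)"
    unfolding IZ sigma_rep_values(2)[OF r] using weak_grad_poincare[OF \<gamma> wg xu] by (simp only: I_def Z_def)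
  show l: "(l2 lborel (\<lambda>x. u' x - c * gauss_fun \<gamma> x))\<^sup>2 = (L2_norm u)\<^sup>2 + (norm c)\<^sup>2 * Z - 2 * Z * ((I /\<^sub>R Z) \<bullet> c)" for c
    unfolding l2_sub_gauss[OF \<gamma> weak_gradD(1)[OF wg]] sigma_rep_values(2)[OF r] I_def[symmetric] Z_def[symmetric]
    using Z by simp
  have "0 \<le> (L2_norm u)\<^sup>2 + (norm (I /\<^sub>R Z))\<^sup>2 * Z - 2 * Z * ((I /\<^sub>R Z) \<bullet> (I /\<^sub>R Z))"
    unfolding l[symmetric] by simp
  then show "(norm (I /\<^sub>R Z))\<^sup>2 * Z \<le> (L2_norm u)\<^sup>2"
    unfolding power2_norm_eq_inner[of "I /\<^sub>R Z", symmetric]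
  proof -
    have "K * Z \<le> U" if "0 \<le> U + K * Z - 2 * Z * K" for K U :: real using that by (simp add: algebra_simps)
    then show "0 \<le> (L2_norm u)\<^sup>2 + (norm (I /\<^sub>R Z))\<^sup>2 * Z - 2 * Z * (norm (I /\<^sub>R Z))\<^sup>2 \<Longrightarrow> (norm (I /\<^sub>R Z))\<^sup>2 * Z \<le> (L2_norm u)\<^sup>2" .
  qed
qed

lemma complex_polar_exp: "\<exists>\<theta>. c = exp (\<i> * of_real \<theta>) * of_real (norm c)"
  using rcis_cmod_Arg[of c] by (metis cis_conv_exp mult.commute rcis_def)

lemma gausson_eq: "gausson \<gamma> \<omega> x = of_real (exp ((\<omega> + \<gamma> * real CARD('n)) / 2)) * gauss_fun \<gamma> (x :: real ^ 'n::finite)"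
  by (simp add: gausson_def gauss_fun_def)

lemma gauss_multiple_minimizer:
  fixes u :: "real ^ 'n::finite \<Rightarrow> complex"
  assumes \<gamma>: "\<gamma> > 1" and c: "(norm c)\<^sup>2 = exp (\<omega> + \<gamma> * real CARD('n))" and ae: "AE x in lborel. u x = c * gauss_fun \<gamma> x"
  shows "u \<in> Sigma_nonzero" "nehari \<gamma> \<omega> u = 0" "action \<gamma> \<omega> u = min_action TYPE('n) \<gamma> \<omega>"
proof -
  have \<gamma>0: "\<gamma> > 0" using \<gamma> by simp
  have c0: "c \<noteq> 0" using c by auto
  note g = nehari_gauss[OF \<gamma>0 ae c0]
  show "u \<in> Sigma_nonzero" by (rule g(1))
  show n: "nehari \<gamma> \<omega> u = 0" using g(3)[of \<omega>] by (simp add: c)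
  show "action \<gamma> \<omega> u = min_action TYPE('n) \<gamma> \<omega>"
    by (simp add: action_eq_nehari n min_action_eq[OF \<gamma>] g(2) critical_mass_def c)
qed

text \<open>
  At the minimal mass the lower bound for the Nehari functional leaves no room for twisted
  energy. The Poincare inequality then identifies the function as a multiple of the Gaussian.
\<close>

theorem ground_states_eq:
  assumes \<gamma>: "\<gamma> > 1"
  shows "(ground_states \<gamma> \<omega> :: (real ^ 'n::finite \<Rightarrow> complex) set)
    = {u. \<exists>\<theta>::real. AE x in lebesgue. u x = exp (\<i> * of_real \<theta>) * gausson \<gamma> \<omega> x}"
proof (intro equalityI subsetI)
  have \<gamma>0: "\<gamma> > 0" using \<gamma> by simp
  let ?E = "exp (\<omega> + \<gamma> * real CARD('n))" and ?e = "exp ((\<omega> + \<gamma> * real CARD('n)) / 2)"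
  have E: "?e\<^sup>2 = ?E" by (simp add: exp_double[symmetric])
  note Z = gauss_mass_pos[OF \<gamma>0, where 'a="real^'n"]
  {
    fix u :: "real ^ 'n \<Rightarrow> complex"
    assume "u \<in> {u. \<exists>\<theta>::real. AE x in lebesgue. u x = exp (\<i> * of_real \<theta>) * gausson \<gamma> \<omega> x}"
    then obtain \<theta> :: real where "AE x in lborel. u x = exp (\<i> * of_real \<theta>) * gausson \<gamma> \<omega> x"
      by (auto simp: AE_completion_iff)
    then have ae: "AE x in lborel. u x = (exp (\<i> * of_real \<theta>) * of_real ?e) * gauss_fun \<gamma> x"
      by (simp add: gausson_eq mult.assoc)
    have "(norm (exp (\<i> * of_real \<theta>) * of_real ?e))\<^sup>2 = ?E" by (simp add: norm_mult E)
    from gauss_multiple_minimizer[OF \<gamma> this ae] show "u \<in> ground_states \<gamma> \<omega>" by (simp add: ground_states_def)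
  next
    fix u :: "real ^ 'n \<Rightarrow> complex"
    assume u: "u \<in> ground_states \<gamma> \<omega>"
    then have uS: "u \<in> Sigma_space" and n: "nehari \<gamma> \<omega> u = 0" and a: "action \<gamma> \<omega> u = critical_mass TYPE('n) \<gamma> \<omega> / 2"
      by (auto simp: ground_states_def Sigma_nonzero_def min_action_eq[OF \<gamma>])
    have U: "(L2_norm u)\<^sup>2 = ?E * gauss_mass TYPE(real^'n) \<gamma>" using a by (simp add: action_eq_nehari n critical_mass_def)
    obtain u' g' where r: "sigma_rep u u' g'" using sigma_rep_exists[OF uS] by blast
    define c where "c = (\<integral>x. exp (- (\<gamma>/2) * (norm x)\<^sup>2) *\<^sub>R u' x \<partial>lborel) /\<^sub>R gauss_mass TYPE(real^'n) \<gamma>"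
    note gc = gauss_coefficient[OF \<gamma>0 r, folded c_def]
    have "ln ((L2_norm u)\<^sup>2 / gauss_mass TYPE(real^'n) \<gamma>) = \<omega> + \<gamma> * real CARD('n)" using Z by (simp add: U)
    then have "(1 - 1 / \<gamma>) * twisted_energy \<gamma> u' g' \<le> 0" using nehari_lower_bound[OF \<gamma>0 r, of \<omega>] n by simp
    then have "twisted_energy \<gamma> u' g' \<le> 0" using \<gamma> by (simp add: mult_le_0_iff)
    then have "twisted_energy \<gamma> u' g' / (2 * \<gamma>) \<le> 0" using \<gamma>0 by (simp add: divide_le_0_iff)
    then have cU: "(norm c)\<^sup>2 * gauss_mass TYPE(real^'n) \<gamma> = (L2_norm u)\<^sup>2" using gc(1,2) by linarith
    have "(l2 lborel (\<lambda>x. u' x - c * gauss_fun \<gamma> x))\<^sup>2 = 0"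
      unfolding gc(3) cU[symmetric] by (simp add: power2_norm_eq_inner)
    moreover have wg: "weak_grad u' g'" and ae: "AE x in lborel. u x = u' x" using r by (auto simp: sigma_rep_def)
    ultimately have "AE x in lborel. u' x - c * gauss_fun \<gamma> x = 0"
      using l2_eq_0_iff[OF sq_int_diff[OF weak_gradD(1)[OF wg] sq_int_mult[OF gauss_fun_sq_int(1)[OF \<gamma>0]]]] by simp
    then have uc: "AE x in lborel. u x = c * gauss_fun \<gamma> x" using ae by eventually_elim simp
    have "(norm c)\<^sup>2 = ?e\<^sup>2" using cU Z unfolding U E by simp
    then have nc: "norm c = ?e" by (simp only: power2_eq_iff_nonneg norm_ge_zero exp_ge_zero)
    obtain \<theta> where "c = exp (\<i> * of_real \<theta>) * of_real ?e" using complex_polar_exp[of c] unfolding nc by blast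
    then have "AE x in lborel. u x = exp (\<i> * of_real \<theta>) * gausson \<gamma> \<omega> x" using uc by (simp add: gausson_eq mult.assoc)
    then show "u \<in> {u. \<exists>\<theta>::real. AE x in lebesgue. u x = exp (\<i> * of_real \<theta>) * gausson \<gamma> \<omega> x}"
      by (auto intro: AE_completion)
  }
qed

text \<open>
  The lower bound for the Nehari functional drives the twisted energy to zero. By the Poincare
  inequality the moduli of the projection coefficients converge, so a subsequence of the coefficients
  converges; the limit of \<open>u\<close> along it is the corresponding multiple of the Gaussian.
\<close>

theorem minimizing_sequence_compact:
  fixes u :: "nat \<Rightarrow> real ^ 'n::finite \<Rightarrow> complex"
  assumes \<gamma>: "\<gamma> > 1" and uS: "\<And>n. u n \<in> Sigma_space" and n0: "\<And>n. nehari \<gamma> \<omega> (u n) = 0"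
    and lim: "(\<lambda>n. action \<gamma> \<omega> (u n)) \<longlonglongrightarrow> min_action TYPE('n) \<gamma> \<omega>"
  shows "\<exists>r \<phi>. strict_mono r \<and> \<phi> \<in> Sigma_space \<and> action \<gamma> \<omega> \<phi> = min_action TYPE('n) \<gamma> \<omega> \<and>
          (\<lambda>n. Sigma_norm (\<lambda>x. u (r n) x - \<phi> x)) \<longlonglongrightarrow> 0"
proof -
  have \<gamma>0: "\<gamma> > 0" using \<gamma> by simp
  define Z where "Z = gauss_mass TYPE(real^'n) \<gamma>"
  have Z: "Z > 0" unfolding Z_def by (rule gauss_mass_pos[OF \<gamma>0])
  let ?E = "exp (\<omega> + \<gamma> * real CARD('n))"
  have "\<forall>n. \<exists>u' g'. sigma_rep (u n) u' g'" using sigma_rep_exists[OF uS] by metis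
  then obtain u' g' where r: "\<And>n. sigma_rep (u n) (u' n) (g' n)" by metis
  have "(\<lambda>n. 2 * action \<gamma> \<omega> (u n)) \<longlonglongrightarrow> 2 * min_action TYPE('n) \<gamma> \<omega>" by (intro tendsto_intros lim)
  then have U: "(\<lambda>n. (L2_norm (u n))\<^sup>2) \<longlonglongrightarrow> ?E * Z"
    by (simp add: action_eq_nehari n0 min_action_eq[OF \<gamma>] critical_mass_def Z_def)
  define tw where "tw n = twisted_energy \<gamma> (u' n) (g' n)" for n
  have tw0: "tw n \<ge> 0" for n by (simp add: tw_def twisted_energy_def sum_nonneg)
  have tw: "tw \<longlonglongrightarrow> 0"
  proof (rule tendsto_sandwich[OF _ _ tendsto_const])
    let ?B = "\<lambda>n. (- ((L2_norm (u n))\<^sup>2 * (\<omega> + \<gamma> * real CARD('n) - ln ((L2_norm (u n))\<^sup>2 / Z)))) / (1 - 1 / \<gamma>)"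
    have "?B \<longlonglongrightarrow> (- ((?E * Z) * (\<omega> + \<gamma> * real CARD('n) - ln ((?E * Z) / Z)))) / (1 - 1 / \<gamma>)"
      using Z \<gamma> by (intro tendsto_intros U) auto
    then show "?B \<longlonglongrightarrow> 0" using Z by simp
    have bnd: "(1 - 1 / \<gamma>) * tw n \<le> - ((L2_norm (u n))\<^sup>2 * (\<omega> + \<gamma> * real CARD('n) - ln ((L2_norm (u n))\<^sup>2 / Z)))" for n
      using nehari_lower_bound[OF \<gamma>0 r[of n], of \<omega>] n0[of n] by (simp add: tw_def Z_def)
    have g: "1 - 1 / \<gamma> > 0" using \<gamma> by simp
    show "\<forall>\<^sub>F n in sequentially. tw n \<le> ?B n"
      using bnd by (intro always_eventually allI) (simp only: pos_le_divide_eq[OF g] mult.commute)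
  qed (use tw0 in auto)
  define c where "c n = (\<integral>x. exp (- (\<gamma>/2) * (norm x)\<^sup>2) *\<^sub>R u' n x \<partial>lborel) /\<^sub>R Z" for n
  have gc: "(norm (c n))\<^sup>2 * Z \<le> (L2_norm (u n))\<^sup>2" "(L2_norm (u n))\<^sup>2 - tw n / (2 * \<gamma>) \<le> (norm (c n))\<^sup>2 * Z"
    "(l2 lborel (\<lambda>x. u' n x - l * gauss_fun \<gamma> x))\<^sup>2 = (L2_norm (u n))\<^sup>2 + (norm l)\<^sup>2 * Z - 2 * Z * (c n \<bullet> l)" for n l
    using gauss_coefficient(1,2)[OF \<gamma>0 r[of n]] gauss_coefficient(3)[OF \<gamma>0 r[of n], where c=l] unfolding c_def Z_def tw_def by linarith+
  have nc: "(\<lambda>n. (norm (c n))\<^sup>2 * Z) \<longlonglongrightarrow> ?E * Z"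
  proof (rule tendsto_sandwich[OF _ _ _ U])
    show "\<forall>\<^sub>F n in sequentially. (L2_norm (u n))\<^sup>2 - tw n / (2 * \<gamma>) \<le> (norm (c n))\<^sup>2 * Z"
      using gc(2) by (intro always_eventually allI)
    show "\<forall>\<^sub>F n in sequentially. (norm (c n))\<^sup>2 * Z \<le> (L2_norm (u n))\<^sup>2"
      using gc(1) by (intro always_eventually allI)
    have "(\<lambda>n. (L2_norm (u n))\<^sup>2 - tw n / (2 * \<gamma>)) \<longlonglongrightarrow> ?E * Z - 0 / (2 * \<gamma>)"
      using \<gamma>0 by (intro tendsto_intros U tw) auto
    then show "(\<lambda>n. (L2_norm (u n))\<^sup>2 - tw n / (2 * \<gamma>)) \<longlonglongrightarrow> ?E * Z" by simp
  qed
  then have "(\<lambda>n. (norm (c n))\<^sup>2 * Z / Z) \<longlonglongrightarrow> ?E * Z / Z" using Z by (intro tendsto_intros) auto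
  then have nc2: "(\<lambda>n. (norm (c n))\<^sup>2) \<longlonglongrightarrow> ?E" using Z by simp
  then have "(\<lambda>n. sqrt ((norm (c n))\<^sup>2)) \<longlonglongrightarrow> sqrt ?E" by (rule tendsto_real_sqrt)
  then have "(\<lambda>n. norm (c n)) \<longlonglongrightarrow> sqrt ?E" by simp
  then have "Bseq (\<lambda>n. norm (c n))" by (intro convergent_imp_Bseq) (auto simp: convergent_def)
  then have "bounded (range c)" by (simp add: Bseq_eq_bounded[symmetric] Bseq_def)
  then obtain l s where s: "strict_mono s" and l: "(c \<circ> s) \<longlonglongrightarrow> l"
    using bounded_imp_convergent_subsequence by blast
  have cl: "(\<lambda>n. c (s n)) \<longlonglongrightarrow> l" using l by (simp add: comp_def)
  have "(\<lambda>n. (norm (c (s n)))\<^sup>2) \<longlonglongrightarrow> (norm l)\<^sup>2" by (intro tendsto_intros cl)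
  then have lE: "(norm l)\<^sup>2 = ?E"
    using LIMSEQ_subseq_LIMSEQ[OF nc2 s] LIMSEQ_unique by (auto simp: comp_def)
  define \<phi> where "\<phi> x = l * gauss_fun \<gamma> x" for x :: "real ^ 'n"
  have \<phi>: "\<phi> \<in> Sigma_nonzero" "action \<gamma> \<omega> \<phi> = min_action TYPE('n) \<gamma> \<omega>"
    using gauss_multiple_minimizer[OF \<gamma> lE, of \<phi>] by (simp_all add: \<phi>_def)
  define d where "d n = (l2 lborel (\<lambda>x. u' (s n) x - l * gauss_fun \<gamma> x))\<^sup>2" for n
  have d0: "d \<longlonglongrightarrow> 0"
  proof -
    have "(\<lambda>n. (L2_norm (u (s n)))\<^sup>2 + (norm l)\<^sup>2 * Z - 2 * Z * (c (s n) \<bullet> l)) \<longlonglongrightarrow> ?E * Z + (norm l)\<^sup>2 * Z - 2 * Z * (l \<bullet> l)"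
      by (intro tendsto_intros cl LIMSEQ_subseq_LIMSEQ[OF U s, unfolded comp_def])
    then show ?thesis unfolding d_def gc(3) by (simp add: lE[symmetric] power2_norm_eq_inner)
  qed
  have bound: "(Sigma_norm (\<lambda>x. u (s n) x - \<phi> x))\<^sup>2 \<le> tw (s n) + \<gamma> * real CARD('n) * d n" for n
  proof -
    let ?w = "\<lambda>x. u' (s n) x - l * gauss_fun \<gamma> x" and ?k = "\<lambda>x. \<chi> i. g' (s n) x $ i - l * gauss_grad \<gamma> x $ i"
    have wg: "weak_grad (u' (s n)) (g' (s n))" and xu: "sq_int lborel (\<lambda>x. norm x *\<^sub>R u' (s n) x)"
      and ae: "AE x in lborel. u (s n) x = u' (s n) x" using r[of "s n"] by (auto simp: sigma_rep_def)
    have wk: "weak_grad ?w ?k" by (rule weak_grad_sub[OF wg weak_grad_gauss[OF \<gamma>0]])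
    have "norm x *\<^sub>R ?w x = norm x *\<^sub>R u' (s n) x - l * (norm x *\<^sub>R gauss_fun \<gamma> x)" for x
      by (simp add: scaleR_diff_right)
    then have xw: "sq_int lborel (\<lambda>x. norm x *\<^sub>R ?w x)"
      using sq_int_diff[OF xu sq_int_mult[OF gauss_fun_sq_int(2)[OF \<gamma>0], of l]] by (simp only:)
    have "AE x in lborel. u (s n) x - \<phi> x = ?w x" using ae by eventually_elim (simp add: \<phi>_def)
    then have rw: "sigma_rep (\<lambda>x. u (s n) x - \<phi> x) ?w ?k" using wk xw by (simp add: sigma_rep_def)
    let ?X = "(l2 lborel (\<lambda>x. norm x *\<^sub>R ?w x))\<^sup>2" and ?G = "\<Sum>i\<in>UNIV. (l2 lborel (\<lambda>x. ?k x $ i))\<^sup>2"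
    have "(Sigma_norm (\<lambda>x. u (s n) x - \<phi> x))\<^sup>2 = ?G + ?X"
      unfolding sigma_rep_values(6)[OF rw] by (intro real_sqrt_pow2 add_nonneg_nonneg sum_nonneg) auto
    also have "\<dots> \<le> ?G + \<gamma>\<^sup>2 * ?X"
    proof -
      have "1 \<le> \<gamma>\<^sup>2" using \<gamma> by (simp add: one_le_power)
      then have "1 * ?X \<le> \<gamma>\<^sup>2 * ?X" by (intro mult_right_mono) auto
      then show ?thesis by simp
    qed
    also have "\<dots> = twisted_energy \<gamma> ?w ?k + \<gamma> * real CARD('n) * (l2 lborel ?w)\<^sup>2"
      using weak_grad_uncertainty[OF wk xw, of \<gamma>] by simp
    also have "twisted_energy \<gamma> ?w ?k = tw (s n)"
      unfolding twisted_energy_def tw_def twisted_gradient_sub_gauss ..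
    finally show ?thesis by (simp add: d_def)
  qed
  have "(\<lambda>n. tw (s n) + \<gamma> * real CARD('n) * d n) \<longlonglongrightarrow> 0 + \<gamma> * real CARD('n) * 0"
    by (intro tendsto_intros d0 LIMSEQ_subseq_LIMSEQ[OF tw s, unfolded comp_def])
  then have bound0: "(\<lambda>n. tw (s n) + \<gamma> * real CARD('n) * d n) \<longlonglongrightarrow> 0" by simp
  have "(\<lambda>n. (Sigma_norm (\<lambda>x. u (s n) x - \<phi> x))\<^sup>2) \<longlonglongrightarrow> 0"
  proof (rule Lim_null_comparison[OF _ bound0], rule always_eventually, rule allI)
    show "norm ((Sigma_norm (\<lambda>x. u (s n) x - \<phi> x))\<^sup>2) \<le> tw (s n) + \<gamma> * real CARD('n) * d n" for n
      using bound[of n] by simp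
  qed
  then have "(\<lambda>n. sqrt ((Sigma_norm (\<lambda>x. u (s n) x - \<phi> x))\<^sup>2)) \<longlonglongrightarrow> sqrt 0" by (rule tendsto_real_sqrt)
  then have "(\<lambda>n. Sigma_norm (\<lambda>x. u (s n) x - \<phi> x)) \<longlonglongrightarrow> 0"
    by (simp add: tendsto_rabs_zero_iff)
  then show ?thesis using s \<phi> by (auto simp: Sigma_nonzero_def)
qed

theorem theorem1p2:
  fixes \<gamma> \<omega> :: real
  assumes "\<gamma> > 1"
  shows
    "(\<forall>u :: nat \<Rightarrow> real ^ 'n::finite \<Rightarrow> complex.
        (\<forall>n. u n \<in> Sigma_space) \<longrightarrow> (\<forall>n. nehari \<gamma> \<omega> (u n) = 0) \<longrightarrow>
        (\<lambda>n. action \<gamma> \<omega> (u n)) \<longlonglongrightarrow> min_action TYPE('n) \<gamma> \<omega> \<longrightarrow>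
        (\<exists>r \<phi>. strict_mono r \<and> \<phi> \<in> Sigma_space \<and>
          action \<gamma> \<omega> \<phi> = min_action TYPE('n) \<gamma> \<omega> \<and>
          (\<lambda>n. Sigma_norm (\<lambda>x. u (r n) x - \<phi> x)) \<longlonglongrightarrow> 0))
     \<and> (ground_states \<gamma> \<omega> :: (real ^ 'n \<Rightarrow> complex) set)
        = {u. \<exists>\<theta>::real. AE x in lebesgue. u x = exp (\<i> * of_real \<theta>) * gausson \<gamma> \<omega> x}"
  using minimizing_sequence_compact[OF assms] ground_states_eq[OF assms] by blast

end
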